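(* Let $(R,\mathfrak{m},k)$ be a local integral domain of depth $d>0$, and let $M:=\mathfrak{m}$ and $N:=R$. Suppose there is a torsionless $R$-module $U\neq0$ such that $$\operatorname{depth}(M\otimes_R U)=\operatorname{depth}(N\otimes_R U).$$ Then $\operatorname{depth}M\le\operatorname{depth}N$ and $d=1$.
   Context: All rings are commutative and noetherian. An $R$-module $U$ is torsionless if the natural map $U\to U^{**}$ is injective, where $(-)^*=\operatorname{Hom}_R(-,R)$. Depth is taken with respect to $\mathfrak{m}$: $\operatorname{depth}(X)=\inf\{i: H^i_{\mathfrak{m}}(X)\ne0\}$.
   Formalization: The module U is additionally assumed finitely generated; for arbitrary torsionless U the claim fails, e.g. R = k[[x,y,z]] and U the kernel of a free cover of H^3_m(R), where both depths are 1 but d = 3. *)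

theory Defs
  imports "HOL-Algebra.Algebra" "HOL-Library.Extended_Nat"
begin

section \<open>Modules\<close>

text \<open>Only the fields \<open>carrier\<close>, \<open>zero\<close>, \<open>add\<close> and \<open>smult\<close> of a module record are
  meaningful for \<^locale>\<open>module\<close>; the ring fields \<open>mult\<close> and \<open>one\<close> of the records constructed
  below are irrelevant.\<close>

definition ring_module :: "'a ring \<Rightarrow> ('a, 'a) module" where
  "ring_module R = \<lparr>carrier = carrier R, monoid.mult = monoid.mult R, one = one R,
     ring.zero = ring.zero R, ring.add = ring.add R, smult = monoid.mult R\<rparr>"

definition submodule_span :: "'a ring \<Rightarrow> ('a, 'b) module \<Rightarrow> 'b set \<Rightarrow> 'b set" where
  "submodule_span R M S = \<Inter>{H. submodule H R M \<and> S \<subseteq> H}"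

definition finitely_generated_module :: "'a ring \<Rightarrow> ('a, 'b) module \<Rightarrow> bool" where
  "finitely_generated_module R M \<longleftrightarrow>
     module R M \<and> (\<exists>S. finite S \<and> S \<subseteq> carrier M \<and> submodule_span R M S = carrier M)"

definition module_hom :: "'a ring \<Rightarrow> ('a, 'b) module \<Rightarrow> ('a, 'c) module \<Rightarrow> ('b \<Rightarrow> 'c) set" where
  "module_hom R M N = {f \<in> carrier M \<rightarrow> carrier N.
     (\<forall>x \<in> carrier M. \<forall>y \<in> carrier M. f (x \<oplus>\<^bsub>M\<^esub> y) = f x \<oplus>\<^bsub>N\<^esub> f y) \<and>
     (\<forall>r \<in> carrier R. \<forall>x \<in> carrier M. f (r \<odot>\<^bsub>M\<^esub> x) = r \<odot>\<^bsub>N\<^esub> f x)}"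

definition quotient_module :: "('a, 'b) module \<Rightarrow> 'b set \<Rightarrow> ('a, 'b set) module" where
  "quotient_module M H = \<lparr>carrier = a_rcosets\<^bsub>M\<^esub> H, monoid.mult = undefined, one = undefined,
     ring.zero = H, ring.add = (\<lambda>P Q. P <+>\<^bsub>M\<^esub> Q),
     smult = (\<lambda>r Q. \<Union>x\<in>Q. H +>\<^bsub>M\<^esub> (r \<odot>\<^bsub>M\<^esub> x))\<rparr>"


section \<open>Duals and torsionless modules\<close>

definition dual_module :: "'a ring \<Rightarrow> ('a, 'b) module \<Rightarrow> ('a, 'b \<Rightarrow> 'a) module" where
  "dual_module R U = \<lparr>carrier = module_hom R U (ring_module R) \<inter> extensional (carrier U),
     monoid.mult = undefined, one = undefined,
     ring.zero = (\<lambda>u \<in> carrier U. \<zero>\<^bsub>R\<^esub>),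
     ring.add = (\<lambda>f g. \<lambda>u \<in> carrier U. f u \<oplus>\<^bsub>R\<^esub> g u),
     smult = (\<lambda>r f. \<lambda>u \<in> carrier U. r \<otimes>\<^bsub>R\<^esub> f u)\<rparr>"

text \<open>The natural map from \<open>U\<close> to \<open>dual_module R (dual_module R U)\<close>.\<close>

definition biduality_map :: "'a ring \<Rightarrow> ('a, 'b) module \<Rightarrow> 'b \<Rightarrow> (('b \<Rightarrow> 'a) \<Rightarrow> 'a)" where
  "biduality_map R U = (\<lambda>u \<in> carrier U. \<lambda>f \<in> carrier (dual_module R U). f u)"

definition torsionless :: "'a ring \<Rightarrow> ('a, 'b) module \<Rightarrow> bool" where
  "torsionless R U \<longleftrightarrow> module R U \<and> inj_on (biduality_map R U) (carrier U)"


section \<open>Tensor products\<close>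

text \<open>The free module on a set \<open>S\<close>: finitely supported functions on \<open>S\<close>, extended by zero.\<close>

definition free_module :: "'a ring \<Rightarrow> 's set \<Rightarrow> ('a, 's \<Rightarrow> 'a) module" where
  "free_module R S = \<lparr>carrier = {f. range f \<subseteq> carrier R \<and> (\<forall>s. s \<notin> S \<longrightarrow> f s = \<zero>\<^bsub>R\<^esub>) \<and>
       finite {s. f s \<noteq> \<zero>\<^bsub>R\<^esub>}},
     monoid.mult = undefined, one = undefined,
     ring.zero = (\<lambda>s. \<zero>\<^bsub>R\<^esub>), ring.add = (\<lambda>f g s. f s \<oplus>\<^bsub>R\<^esub> g s),
     smult = (\<lambda>r f s. r \<otimes>\<^bsub>R\<^esub> f s)\<rparr>"

definition free_generator :: "'a ring \<Rightarrow> 's \<Rightarrow> 's \<Rightarrow> 'a" where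
  "free_generator R s = (\<lambda>t. if t = s then \<one>\<^bsub>R\<^esub> else \<zero>\<^bsub>R\<^esub>)"

definition tensor_relations ::
  "'a ring \<Rightarrow> ('a, 'b) module \<Rightarrow> ('a, 'c) module \<Rightarrow> ('b \<times> 'c \<Rightarrow> 'a) set" where
  "tensor_relations R M N = (let F = free_module R (carrier M \<times> carrier N); e = free_generator R in
     {e (x \<oplus>\<^bsub>M\<^esub> x', y) \<ominus>\<^bsub>F\<^esub> (e (x, y) \<oplus>\<^bsub>F\<^esub> e (x', y)) | x x' y.
        x \<in> carrier M \<and> x' \<in> carrier M \<and> y \<in> carrier N} \<union>
     {e (x, y \<oplus>\<^bsub>N\<^esub> y') \<ominus>\<^bsub>F\<^esub> (e (x, y) \<oplus>\<^bsub>F\<^esub> e (x, y')) | x y y'.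
        x \<in> carrier M \<and> y \<in> carrier N \<and> y' \<in> carrier N} \<union>
     {e (r \<odot>\<^bsub>M\<^esub> x, y) \<ominus>\<^bsub>F\<^esub> r \<odot>\<^bsub>F\<^esub> e (x, y) | r x y.
        r \<in> carrier R \<and> x \<in> carrier M \<and> y \<in> carrier N} \<union>
     {e (x, r \<odot>\<^bsub>N\<^esub> y) \<ominus>\<^bsub>F\<^esub> r \<odot>\<^bsub>F\<^esub> e (x, y) | r x y.
        r \<in> carrier R \<and> x \<in> carrier M \<and> y \<in> carrier N})"

definition tensor_product ::
  "'a ring \<Rightarrow> ('a, 'b) module \<Rightarrow> ('a, 'c) module \<Rightarrow> ('a, ('b \<times> 'c \<Rightarrow> 'a) set) module" where
  "tensor_product R M N = (let F = free_module R (carrier M \<times> carrier N) in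
     quotient_module F (submodule_span R F (tensor_relations R M N)))"


section \<open>Local cohomology and depth\<close>

text \<open>HOL does not quantify over types, so the extension property is tested on the modules
  whose elements have the same type \<open>'e\<close> as those of \<open>E\<close>. If the type of ring elements embeds
  into \<open>'e\<close>, as in all uses below, this is injectivity in the usual sense, because the test
  modules then include, up to isomorphism, the ring itself (Baer's criterion).\<close>

definition injective_module :: "'a ring \<Rightarrow> ('a, 'e) module \<Rightarrow> bool" where
  "injective_module R E \<longleftrightarrow> module R E \<and>
     (\<forall>(B :: ('a, 'e) module) A. \<forall>f \<in> module_hom R (B\<lparr>carrier := A\<rparr>) E.
        module R B \<and> submodule A R B \<longrightarrow>
        (\<exists>g \<in> module_hom R B E. \<forall>a \<in> A. g a = f a))"

definition module_kernel :: "('a, 'b) module \<Rightarrow> ('a, 'c) module \<Rightarrow> ('b \<Rightarrow> 'c) \<Rightarrow> 'b set" where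
  "module_kernel M N f = {x \<in> carrier M. f x = \<zero>\<^bsub>N\<^esub>}"

definition injective_resolution ::
  "'a ring \<Rightarrow> ('a, 'b) module \<Rightarrow> ('b \<Rightarrow> 'e) \<Rightarrow> (nat \<Rightarrow> ('a, 'e) module) \<Rightarrow> (nat \<Rightarrow> 'e \<Rightarrow> 'e) \<Rightarrow> bool"
where
  "injective_resolution R Q \<epsilon> E \<delta> \<longleftrightarrow>
     (\<forall>n. injective_module R (E n)) \<and>
     \<epsilon> \<in> module_hom R Q (E 0) \<and>
     (\<forall>n. \<delta> n \<in> module_hom R (E n) (E (Suc n))) \<and>
     inj_on \<epsilon> (carrier Q) \<and>
     \<epsilon> ` carrier Q = module_kernel (E 0) (E (Suc 0)) (\<delta> 0) \<and>
     (\<forall>n. \<delta> n ` carrier (E n) = module_kernel (E (Suc n)) (E (Suc (Suc n))) (\<delta> (Suc n)))"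

text \<open>The functor \<open>\<Gamma>\<close> of elements killed by some power of the ideal \<open>J\<close>.\<close>

definition torsion_part :: "'a ring \<Rightarrow> 'a set \<Rightarrow> ('a, 'b) module \<Rightarrow> 'b set" where
  "torsion_part R J Q = {x \<in> carrier Q.
     \<exists>n::nat. \<forall>a \<in> J [^]\<^bsub>ideals_set R\<^esub> n. a \<odot>\<^bsub>Q\<^esub> x = \<zero>\<^bsub>Q\<^esub>}"

definition torsion_cocycles ::
  "'a ring \<Rightarrow> 'a set \<Rightarrow> (nat \<Rightarrow> ('a, 'e) module) \<Rightarrow> (nat \<Rightarrow> 'e \<Rightarrow> 'e) \<Rightarrow> nat \<Rightarrow> 'e set" where
  "torsion_cocycles R J E \<delta> i =
     torsion_part R J (E i) \<inter> module_kernel (E i) (E (Suc i)) (\<delta> i)"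

definition torsion_coboundaries ::
  "'a ring \<Rightarrow> 'a set \<Rightarrow> (nat \<Rightarrow> ('a, 'e) module) \<Rightarrow> (nat \<Rightarrow> 'e \<Rightarrow> 'e) \<Rightarrow> nat \<Rightarrow> 'e set" where
  "torsion_coboundaries R J E \<delta> i =
     (case i of 0 \<Rightarrow> {\<zero>\<^bsub>E 0\<^esub>} | Suc j \<Rightarrow> \<delta> j ` torsion_part R J (E j))"

text \<open>Over a noetherian ring every module \<open>Q\<close> embeds into an injective module of cardinality at
  most the maximum of those of \<open>R\<close>, \<open>Q\<close> and the natural numbers (adjoin countably often
  solutions of all extension problems from the finitely generated ideals of \<open>R\<close>). Hence the
  following type has room for an injective resolution of every \<open>Q\<close> with elements of
  type \<open>'b\<close>.\<close>

type_synonym ('a, 'b) resolution_universe = "('a + 'b + nat) list"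

text \<open>The right derived functors of \<open>\<Gamma>\<close>. The choice of the resolution does not matter up to
  isomorphism.\<close>

definition local_cohomology ::
  "'a ring \<Rightarrow> 'a set \<Rightarrow> nat \<Rightarrow> ('a, 'b) module \<Rightarrow>
     ('a, ('a, 'b) resolution_universe set) module" where
  "local_cohomology R J i Q =
     (let (E, \<delta>) = (SOME (E, \<delta>). \<exists>\<epsilon>. injective_resolution R Q \<epsilon> E \<delta>) in
      quotient_module ((E i)\<lparr>carrier := torsion_cocycles R J E \<delta> i\<rparr>)
        (torsion_coboundaries R J E \<delta> i))"

definition zero_module :: "('a, 'b) module \<Rightarrow> bool" where
  "zero_module M \<longleftrightarrow> carrier M = {\<zero>\<^bsub>M\<^esub>}"

text \<open>The infimum of the empty set is \<open>\<infinity>\<close>.\<close>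

definition depth :: "'a ring \<Rightarrow> 'a set \<Rightarrow> ('a, 'b) module \<Rightarrow> enat" where
  "depth R J Q = Inf {enat i | i. \<not> zero_module (local_cohomology R J i Q)}"


section \<open>Local rings\<close>

definition noetherian_local_ring :: "'a ring \<Rightarrow> 'a set \<Rightarrow> bool" where
  "noetherian_local_ring R \<mm> \<longleftrightarrow> cring R \<and> noetherian_ring R \<and>
     maximalideal \<mm> R \<and> (\<forall>J. maximalideal J R \<longrightarrow> J = \<mm>)"

end

theory Submission
  imports Defs
begin

text \<open>
  Only the first two local cohomology modules are needed. If \<open>\<Gamma>(Q)\<close> denotes the elements of a
  module \<open>Q\<close> that are killed by a power of \<open>\<mm>\<close>, then \<open>H\<^sup>0(Q) = 0\<close> if and only if \<open>\<Gamma>(Q) = 0\<close>, and in this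
  case \<open>H\<^sup>1(Q) = 0\<close> if and only if every homomorphism from a power of \<open>\<mm>\<close> to \<open>Q\<close> is multiplication
  with an element of \<open>Q\<close> (\<open>local_cohomology_01\<close>). Hence \<open>depth Q > 0\<close> means \<open>\<Gamma>(Q) = 0\<close>
  (\<open>depth_pos_iff\<close>), and for such \<open>Q\<close> the depth is one if and only if some homomorphism
  \<open>\<mm>\<^sup>n \<rightarrow> Q\<close> does not extend to \<open>R\<close> (\<open>depth_eq_one_iff\<close>).

  As \<open>R\<close> is a domain of positive depth, \<open>\<mm> \<noteq> 0\<close>. The identity of \<open>\<mm>\<close> does not extend to a map from \<open>R\<close>
  to \<open>\<mm>\<close>, so \<open>\<mm>\<close> has depth one, which is the first claim. A torsionless \<open>U\<close> is torsion-free, so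
  \<open>R \<otimes> U \<cong> U\<close> has positive depth, and so has \<open>\<mm> \<otimes> U\<close> by hypothesis. Then \<open>U\<close> is free: the kernel of
  \<open>\<mm> \<otimes> U \<rightarrow> U\<close> is killed by \<open>\<mm>\<close> and therefore zero; it contains the tensors \<open>\<Sum> c\<^sub>s \<otimes> s\<close> of the
  relations \<open>\<Sum> c\<^sub>s s = 0\<close> among minimal generators \<open>s\<close> of \<open>U\<close>, and so the ideal \<open>I\<close> of the coefficients
  that a fixed generator can have in such relations satisfies \<open>I = \<mm> I\<close>, whence \<open>I = 0\<close> by Nakayama's
  lemma (\<open>coefficient_ideal_zero\<close>, \<open>coordinates\<close>). For a basis element \<open>t\<close> the map \<open>a \<mapsto> a \<otimes> t\<close> does not
  extend from \<open>\<mm>\<close> to \<open>R\<close>, so \<open>\<mm> \<otimes> U\<close> has depth one, and so has \<open>R \<otimes> U\<close> by hypothesis. Since this module is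
  free, a homomorphism from a power of \<open>\<mm>\<close> that does not extend yields one to \<open>R\<close>, and \<open>d = 1\<close>.

  Local cohomology is defined with a chosen injective resolution over a fixed type, so the criterion
  for \<open>H\<^sup>0\<close> and \<open>H\<^sup>1\<close> needs the existence of such a resolution (\<open>injective_resolution_exists\<close>). Every
  quotient \<open>P / H\<close> embeds into a product of copies of \<open>Hom\<^sub>\<int>(R, \<complex>\<^sup>\<times>)\<close>, which is injective by Baer's criterion
  (\<open>char_module_embedding\<close>, \<open>baer_char_module\<close>). Inside this large module the closure of the image of \<open>P\<close> under
  the module operations and under a chosen solution of each finite solvable system of equations
  \<open>a x = e\<close> is again injective, because ideals are finitely generated. Its elements are described by finite
  expressions, here programs of a stack machine, and so it fits into the given type
  (\<open>injective_embedding\<close>).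
\<close>

section \<open>Modules, submodules and homomorphisms\<close>

text \<open>Additive inverses come for free: \<open>- x = (- 1) x\<close>.\<close>

lemma module_from_smult:
  fixes R (structure) and M (structure)
  assumes R: "cring R"
    and z: "\<zero>\<^bsub>M\<^esub> \<in> carrier M"
    and cl: "\<And>x y. x \<in> carrier M \<Longrightarrow> y \<in> carrier M \<Longrightarrow> x \<oplus>\<^bsub>M\<^esub> y \<in> carrier M"
    and assoc: "\<And>x y w. x \<in> carrier M \<Longrightarrow> y \<in> carrier M \<Longrightarrow> w \<in> carrier M \<Longrightarrow>
      (x \<oplus>\<^bsub>M\<^esub> y) \<oplus>\<^bsub>M\<^esub> w = x \<oplus>\<^bsub>M\<^esub> (y \<oplus>\<^bsub>M\<^esub> w)"
    and comm: "\<And>x y. x \<in> carrier M \<Longrightarrow> y \<in> carrier M \<Longrightarrow> x \<oplus>\<^bsub>M\<^esub> y = y \<oplus>\<^bsub>M\<^esub> x"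
    and lz: "\<And>x. x \<in> carrier M \<Longrightarrow> \<zero>\<^bsub>M\<^esub> \<oplus>\<^bsub>M\<^esub> x = x"
    and scl: "\<And>a x. a \<in> carrier R \<Longrightarrow> x \<in> carrier M \<Longrightarrow> a \<odot>\<^bsub>M\<^esub> x \<in> carrier M"
    and ld: "\<And>a b x. a \<in> carrier R \<Longrightarrow> b \<in> carrier R \<Longrightarrow> x \<in> carrier M \<Longrightarrow>
      (a \<oplus> b) \<odot>\<^bsub>M\<^esub> x = (a \<odot>\<^bsub>M\<^esub> x) \<oplus>\<^bsub>M\<^esub> (b \<odot>\<^bsub>M\<^esub> x)"
    and rd: "\<And>a x y. a \<in> carrier R \<Longrightarrow> x \<in> carrier M \<Longrightarrow> y \<in> carrier M \<Longrightarrow>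
      a \<odot>\<^bsub>M\<^esub> (x \<oplus>\<^bsub>M\<^esub> y) = (a \<odot>\<^bsub>M\<^esub> x) \<oplus>\<^bsub>M\<^esub> (a \<odot>\<^bsub>M\<^esub> y)"
    and sa: "\<And>a b x. a \<in> carrier R \<Longrightarrow> b \<in> carrier R \<Longrightarrow> x \<in> carrier M \<Longrightarrow>
      (a \<otimes> b) \<odot>\<^bsub>M\<^esub> x = a \<odot>\<^bsub>M\<^esub> (b \<odot>\<^bsub>M\<^esub> x)"
    and s1: "\<And>x. x \<in> carrier M \<Longrightarrow> \<one> \<odot>\<^bsub>M\<^esub> x = x"
    and s0: "\<And>x. x \<in> carrier M \<Longrightarrow> \<zero> \<odot>\<^bsub>M\<^esub> x = \<zero>\<^bsub>M\<^esub>"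
  shows "module R M"
proof (rule moduleI[OF R])
  interpret R: cring R by (rule R)
  show "abelian_group M"
  proof (rule abelian_groupI)
    fix x assume x: "x \<in> carrier M"
    have "(\<ominus> \<one>) \<odot>\<^bsub>M\<^esub> x \<oplus>\<^bsub>M\<^esub> x = (\<ominus> \<one> \<oplus> \<one>) \<odot>\<^bsub>M\<^esub> x"
      using x ld s1 by simp
    also have "\<dots> = \<zero>\<^bsub>M\<^esub>" using x s0 by (simp add: R.l_neg)
    finally show "\<exists>y\<in>carrier M. y \<oplus>\<^bsub>M\<^esub> x = \<zero>\<^bsub>M\<^esub>" using x scl R.a_inv_closed R.one_closed by blast
  qed (use z cl assoc comm lz in auto)
qed (use scl ld rd sa s1 in auto)

lemma (in module) submodule_iff:
  "submodule H R M \<longleftrightarrow> H \<subseteq> carrier M \<and> \<zero>\<^bsub>M\<^esub> \<in> H \<and> (\<forall>x\<in>H. \<forall>y\<in>H. x \<oplus>\<^bsub>M\<^esub> y \<in> H) \<and>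
    (\<forall>a\<in>carrier R. \<forall>x\<in>H. a \<odot>\<^bsub>M\<^esub> x \<in> H)" (is "_ \<longleftrightarrow> ?C")
proof
  assume H: "submodule H R M"
  then have "\<zero>\<^bsub>M\<^esub> \<in> H" using subgroup.one_closed[OF submodule.axioms(1)[OF H]] by simp
  then show ?C using submoduleE[OF H] by auto
next
  assume C: ?C
  show "submodule H R M"
  proof (rule submoduleI)
    fix x assume x: "x \<in> H"
    have "\<ominus>\<^bsub>M\<^esub> x = (\<ominus> \<one>) \<odot>\<^bsub>M\<^esub> x"
      using x C smult_l_minus[of \<one> x] by auto
    then show "\<ominus>\<^bsub>M\<^esub> x \<in> H" using x C by simp
  qed (use C in auto)
qed

lemma submoduleD:
  assumes "submodule H R M" "module R M"
  shows "H \<subseteq> carrier M" "\<zero>\<^bsub>M\<^esub> \<in> H" "\<And>x y. x \<in> H \<Longrightarrow> y \<in> H \<Longrightarrow> x \<oplus>\<^bsub>M\<^esub> y \<in> H"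
    "\<And>a x. a \<in> carrier R \<Longrightarrow> x \<in> H \<Longrightarrow> a \<odot>\<^bsub>M\<^esub> x \<in> H"
  using assms module.submodule_iff[OF assms(2)] by auto

lemma module_ring_module: "cring R \<Longrightarrow> module R (ring_module R)"
proof -
  assume R: "cring R"
  then interpret cring R .
  show ?thesis
    unfolding ring_module_def
    by (rule module_from_smult) (auto simp: R a_ac l_distr r_distr m_assoc)
qed

lemma ring_module_simps [simp]:
  "carrier (ring_module R) = carrier R" "\<zero>\<^bsub>ring_module R\<^esub> = \<zero>\<^bsub>R\<^esub>"
  "x \<oplus>\<^bsub>ring_module R\<^esub> y = x \<oplus>\<^bsub>R\<^esub> y" "x \<odot>\<^bsub>ring_module R\<^esub> y = x \<otimes>\<^bsub>R\<^esub> y"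
  by (simp_all add: ring_module_def)

lemma submodule_ring_module_iff: 
  assumes "cring R"
  shows "submodule I R (ring_module R) \<longleftrightarrow> ideal I R"
proof -
  interpret R: cring R by fact
  interpret M: module R "ring_module R" using module_ring_module assms .
  show ?thesis
  proof
    assume "submodule I R (ring_module R)"
    then have I: "I \<subseteq> carrier R" "\<zero>\<^bsub>R\<^esub> \<in> I" "\<And>x y. x \<in> I \<Longrightarrow> y \<in> I \<Longrightarrow> x \<oplus>\<^bsub>R\<^esub> y \<in> I"
      "\<And>a x. a \<in> carrier R \<Longrightarrow> x \<in> I \<Longrightarrow> a \<otimes>\<^bsub>R\<^esub> x \<in> I"
      using M.submodule_iff by auto
    have "\<ominus>\<^bsub>R\<^esub> x \<in> I" if "x \<in> I" for x
      using I(4)[of "\<ominus>\<^bsub>R\<^esub> \<one>\<^bsub>R\<^esub>" x] I(1) that by (auto simp: R.l_minus)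
    moreover have "x \<otimes>\<^bsub>R\<^esub> a \<in> I" if "a \<in> carrier R" "x \<in> I" for a x
      using I(4)[OF that] I(1) that R.m_comm by auto
    ultimately show "ideal I R"
      by (intro idealI R.ring_axioms R.add.subgroupI)
        (use I in \<open>auto simp: a_inv_def[symmetric]\<close>)
  next
    assume "ideal I R"
    then interpret I: ideal I R .
    show "submodule I R (ring_module R)"
      unfolding M.submodule_iff using I.a_subset I.I_l_closed I.a_closed by auto
  qed
qed

lemma module_homI:
  assumes "\<And>x. x \<in> carrier M \<Longrightarrow> f x \<in> carrier N"
    "\<And>x y. x \<in> carrier M \<Longrightarrow> y \<in> carrier M \<Longrightarrow> f (x \<oplus>\<^bsub>M\<^esub> y) = f x \<oplus>\<^bsub>N\<^esub> f y"
    "\<And>r x. r \<in> carrier R \<Longrightarrow> x \<in> carrier M \<Longrightarrow> f (r \<odot>\<^bsub>M\<^esub> x) = r \<odot>\<^bsub>N\<^esub> f x"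
  shows "f \<in> module_hom R M N"
  using assms by (auto simp: module_hom_def)

lemma module_homD:
  assumes "f \<in> module_hom R M N"
  shows "x \<in> carrier M \<Longrightarrow> f x \<in> carrier N"
    "x \<in> carrier M \<Longrightarrow> y \<in> carrier M \<Longrightarrow> f (x \<oplus>\<^bsub>M\<^esub> y) = f x \<oplus>\<^bsub>N\<^esub> f y"
    "r \<in> carrier R \<Longrightarrow> x \<in> carrier M \<Longrightarrow> f (r \<odot>\<^bsub>M\<^esub> x) = r \<odot>\<^bsub>N\<^esub> f x"
  using assms by (auto simp: module_hom_def)

lemma module_hom_comp:
  "f \<in> module_hom R L M \<Longrightarrow> g \<in> module_hom R M N \<Longrightarrow> (\<lambda>x. g (f x)) \<in> module_hom R L N"
  by (auto simp: module_hom_def Pi_def)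

lemma module_hom_zero:
  assumes "module R M" "module R N" "f \<in> module_hom R M N"
  shows "f \<zero>\<^bsub>M\<^esub> = \<zero>\<^bsub>N\<^esub>"
proof -
  interpret M: module R M by fact
  interpret N: module R N by fact
  have "f (\<zero>\<^bsub>R\<^esub> \<odot>\<^bsub>M\<^esub> \<zero>\<^bsub>M\<^esub>) = \<zero>\<^bsub>R\<^esub> \<odot>\<^bsub>N\<^esub> f \<zero>\<^bsub>M\<^esub>" using module_homD[OF assms(3)] by blast
  then show ?thesis using module_homD[OF assms(3)] by auto
qed

lemma module_hom_neg:
  assumes "module R M" "module R N" "f \<in> module_hom R M N" "x \<in> carrier M"
  shows "f (\<ominus>\<^bsub>M\<^esub> x) = \<ominus>\<^bsub>N\<^esub> f x"
proof -
  interpret M: module R M by fact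
  interpret N: module R N by fact
  have "f x \<oplus>\<^bsub>N\<^esub> f (\<ominus>\<^bsub>M\<^esub> x) = f (x \<oplus>\<^bsub>M\<^esub> \<ominus>\<^bsub>M\<^esub> x)"
    using module_homD(2)[OF assms(3,4)] assms(4) by (metis M.a_inv_closed)
  also have "\<dots> = \<zero>\<^bsub>N\<^esub>" using module_hom_zero[OF assms(1-3)] M.r_neg[OF assms(4)] by metis
  finally show ?thesis using module_homD(1)[OF assms(3)] assms(4)
    by (metis M.a_inv_closed N.a_comm N.minus_equality)
qed

lemma module_hom_minus:
  assumes "module R M" "module R N" "f \<in> module_hom R M N" "x \<in> carrier M" "y \<in> carrier M"
  shows "f (x \<ominus>\<^bsub>M\<^esub> y) = f x \<ominus>\<^bsub>N\<^esub> f y"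
proof -
  interpret M: module R M by fact
  show ?thesis using assms module_homD[OF assms(3)] module_hom_neg[OF assms(1-3)]
    by (simp add: a_minus_def)
qed

lemma (in abelian_group) minus_eq_zero_iff:
  assumes "x \<in> carrier G" "y \<in> carrier G"
  shows "x \<ominus> y = \<zero> \<longleftrightarrow> x = y"
  using assms by (metis a_inv_closed minus_equality minus_minus minus_eq r_neg)

lemma module_hom_finsum:
  assumes "module R M" "module R N" "f \<in> module_hom R M N" "finite A" "g \<in> A \<rightarrow> carrier M"
  shows "f (\<Oplus>\<^bsub>M\<^esub>i\<in>A. g i) = (\<Oplus>\<^bsub>N\<^esub>i\<in>A. f (g i))"
proof -
  interpret M: module R M by fact
  interpret N: module R N by fact
  show ?thesis using assms(4,5)
  proof (induction A rule: finite_induct)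
    case empty
    then show ?case using module_hom_zero[OF assms(1-3)] by simp
  next
    case (insert a A)
    then show ?case using module_homD[OF assms(3)] by (simp add: Pi_def)
  qed
qed

lemma submodule_kernel:
  assumes "module R M" "module R N" "f \<in> module_hom R M N"
  shows "submodule (module_kernel M N f) R M"
proof -
  interpret M: module R M by fact
  interpret N: module R N by fact
  show ?thesis unfolding M.submodule_iff module_kernel_def
    using module_homD[OF assms(3)] module_hom_zero[OF assms] by auto
qed

lemma submodule_image:
  assumes "module R M" "module R N" "f \<in> module_hom R M N" "submodule H R M"
  shows "submodule (f ` H) R N"
proof -
  interpret M: module R M by fact
  interpret N: module R N by fact
  have H: "H \<subseteq> carrier M" "\<zero>\<^bsub>M\<^esub> \<in> H" "\<forall>x\<in>H. \<forall>y\<in>H. x \<oplus>\<^bsub>M\<^esub> y \<in> H"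
    "\<forall>a\<in>carrier R. \<forall>x\<in>H. a \<odot>\<^bsub>M\<^esub> x \<in> H" using assms(4) M.submodule_iff by auto
  show ?thesis unfolding N.submodule_iff
  proof (intro conjI ballI)
    show "f ` H \<subseteq> carrier N" using H module_homD[OF assms(3)] by auto
    show "\<zero>\<^bsub>N\<^esub> \<in> f ` H" using H(2) module_hom_zero[OF assms(1-3)] by (metis imageI)
    fix x y assume "x \<in> f ` H" "y \<in> f ` H"
    then show "x \<oplus>\<^bsub>N\<^esub> y \<in> f ` H" using H module_homD(2)[OF assms(3)]
      by (smt (verit, best) image_iff subsetD)
  next
    fix a x assume "a \<in> carrier R" "x \<in> f ` H"
    then show "a \<odot>\<^bsub>N\<^esub> x \<in> f ` H" using H module_homD(3)[OF assms(3)]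
      by (smt (verit, best) image_iff subsetD)
  qed
qed

text \<open>The copy of a module along an injection of its carrier into another type.\<close>

definition transport_module :: "('b \<Rightarrow> 'c) \<Rightarrow> ('a, 'b) module \<Rightarrow> ('a, 'c) module" where
  "transport_module j M = (let k = inv_into (carrier M) j in
     \<lparr>carrier = j ` carrier M, monoid.mult = undefined, one = undefined, ring.zero = j \<zero>\<^bsub>M\<^esub>,
      ring.add = (\<lambda>x y. j (k x \<oplus>\<^bsub>M\<^esub> k y)), smult = (\<lambda>r x. j (r \<odot>\<^bsub>M\<^esub> k x))\<rparr>)"

lemma transport_module_simps:
  assumes "inj_on j (carrier M)"
  shows "carrier (transport_module j M) = j ` carrier M"
    "\<zero>\<^bsub>transport_module j M\<^esub> = j \<zero>\<^bsub>M\<^esub>"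
    "x \<in> carrier M \<Longrightarrow> y \<in> carrier M \<Longrightarrow> j x \<oplus>\<^bsub>transport_module j M\<^esub> j y = j (x \<oplus>\<^bsub>M\<^esub> y)"
    "x \<in> carrier M \<Longrightarrow> r \<odot>\<^bsub>transport_module j M\<^esub> j x = j (r \<odot>\<^bsub>M\<^esub> x)"
  using assms by (simp_all add: transport_module_def Let_def)

lemma module_transport:
  assumes "module R M" "inj_on j (carrier M)"
  shows "module R (transport_module j M)"
proof -
  interpret M: module R M by fact
  note s = transport_module_simps[OF assms(2)]
  show ?thesis
    by (rule module_from_smult)
      (auto simp: s M.a_ac M.smult_l_distr M.smult_r_distr M.smult_assoc1 M.R.is_cring)
qed


section \<open>Quotient modules\<close>

lemma module_quotient:
  fixes M :: "('a, 'b) module"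
  assumes "module R M" "submodule H R M"
  shows "module R (quotient_module M H)"
    and "carrier (quotient_module M H) = (\<lambda>x. H +>\<^bsub>M\<^esub> x) ` carrier M"
    and "(\<lambda>x. H +>\<^bsub>M\<^esub> x) \<in> module_hom R M (quotient_module M H)"
    and "x \<in> carrier M \<Longrightarrow> H +>\<^bsub>M\<^esub> x = \<zero>\<^bsub>quotient_module M H\<^esub> \<longleftrightarrow> x \<in> H"
proof -
  interpret M: module R M by fact
  note H = submoduleD[OF assms(2,1)]
  interpret S: abelian_subgroup H M
    by (rule abelian_subgroupI3) (use assms(2) in \<open>auto simp: submodule_def additive_subgroup_def M.abelian_group_axioms\<close>)
  let ?Q = "quotient_module M H"
  show c: "carrier ?Q = (\<lambda>x. H +>\<^bsub>M\<^esub> x) ` carrier M"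
    by (auto simp: quotient_module_def A_RCOSETS_def')
  have a: "(H +>\<^bsub>M\<^esub> x) \<oplus>\<^bsub>?Q\<^esub> (H +>\<^bsub>M\<^esub> y) = H +>\<^bsub>M\<^esub> (x \<oplus>\<^bsub>M\<^esub> y)"
    if "x \<in> carrier M" "y \<in> carrier M" for x y
    using that by (simp add: quotient_module_def S.a_rcos_sum)
  have z: "H +>\<^bsub>M\<^esub> x = H \<longleftrightarrow> x \<in> H" if "x \<in> carrier M" for x
    using that S.a_rcos_self[of x] S.a_rcos_const by auto
  have eq: "H +>\<^bsub>M\<^esub> x = H +>\<^bsub>M\<^esub> y \<longleftrightarrow> x \<ominus>\<^bsub>M\<^esub> y \<in> H" if "x \<in> carrier M" "y \<in> carrier M" for x y
    using that by (metis M.minus_eq S.a_rcos_module S.a_rcos_self S.a_repr_independence')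
  have sm: "r \<odot>\<^bsub>?Q\<^esub> (H +>\<^bsub>M\<^esub> x) = H +>\<^bsub>M\<^esub> (r \<odot>\<^bsub>M\<^esub> x)" if r: "r \<in> carrier R" and x: "x \<in> carrier M" for r x
  proof -
    have "H +>\<^bsub>M\<^esub> (r \<odot>\<^bsub>M\<^esub> y) = H +>\<^bsub>M\<^esub> (r \<odot>\<^bsub>M\<^esub> x)" if y: "y \<in> H +>\<^bsub>M\<^esub> x" for y
    proof -
      have yc: "y \<in> carrier M" using y x S.a_elemrcos_carrier by blast
      obtain h where h: "h \<in> H" "y = h \<oplus>\<^bsub>M\<^esub> x" using y by (auto simp: a_r_coset_def')
      then have hc: "h \<in> carrier M" using H by auto
      have "r \<odot>\<^bsub>M\<^esub> y \<ominus>\<^bsub>M\<^esub> r \<odot>\<^bsub>M\<^esub> x = r \<odot>\<^bsub>M\<^esub> h"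
        using h r x hc by (simp add: M.smult_r_distr M.minus_eq M.a_assoc M.r_neg)
      then show ?thesis using eq r x yc h H(4) by auto
    qed
    moreover have "x \<in> H +>\<^bsub>M\<^esub> x" using S.a_rcos_self x by blast
    ultimately have "(\<Union>y\<in>H +>\<^bsub>M\<^esub> x. H +>\<^bsub>M\<^esub> (r \<odot>\<^bsub>M\<^esub> y)) = H +>\<^bsub>M\<^esub> (r \<odot>\<^bsub>M\<^esub> x)"
      by blast
    then show ?thesis unfolding quotient_module_def by simp
  qed
  have z0: "\<zero>\<^bsub>?Q\<^esub> = H +>\<^bsub>M\<^esub> \<zero>\<^bsub>M\<^esub>" 
    unfolding quotient_module_def using M.a_coset_add_zero[OF H(1)] by simp
  have ex: "\<exists>x'\<in>carrier M. x = H +>\<^bsub>M\<^esub> x'" if "x \<in> carrier ?Q" for x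
    using that unfolding c by blast
  have mem: "H +>\<^bsub>M\<^esub> x \<in> carrier ?Q" if "x \<in> carrier M" for x
    using that unfolding c by blast
  show "module R ?Q"
  proof (rule module_from_smult)
    show "cring R" by (rule M.R.is_cring)
    show "\<zero>\<^bsub>?Q\<^esub> \<in> carrier ?Q" unfolding z0 by (rule mem) simp
  next
    fix x y w assume "x \<in> carrier ?Q" "y \<in> carrier ?Q" "w \<in> carrier ?Q"
    then obtain x' y' w' where *: "x' \<in> carrier M" "y' \<in> carrier M" "w' \<in> carrier M"
      and e: "x = H +>\<^bsub>M\<^esub> x'" "y = H +>\<^bsub>M\<^esub> y'" "w = H +>\<^bsub>M\<^esub> w'" using ex by metis
    show "(x \<oplus>\<^bsub>?Q\<^esub> y) \<oplus>\<^bsub>?Q\<^esub> w = x \<oplus>\<^bsub>?Q\<^esub> (y \<oplus>\<^bsub>?Q\<^esub> w)"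
      using * unfolding e by (simp only: a M.a_closed M.a_assoc)
  next
    fix x y assume "x \<in> carrier ?Q" "y \<in> carrier ?Q"
    then obtain x' y' where *: "x' \<in> carrier M" "y' \<in> carrier M"
      and e: "x = H +>\<^bsub>M\<^esub> x'" "y = H +>\<^bsub>M\<^esub> y'" using ex by metis
    show "x \<oplus>\<^bsub>?Q\<^esub> y \<in> carrier ?Q" using * unfolding e by (simp only: a M.a_closed mem)
    show "x \<oplus>\<^bsub>?Q\<^esub> y = y \<oplus>\<^bsub>?Q\<^esub> x"
      using * M.a_comm[of x' y'] unfolding e by (simp only: a)
    fix r assume r: "r \<in> carrier R"
    show "r \<odot>\<^bsub>?Q\<^esub> (x \<oplus>\<^bsub>?Q\<^esub> y) = r \<odot>\<^bsub>?Q\<^esub> x \<oplus>\<^bsub>?Q\<^esub> r \<odot>\<^bsub>?Q\<^esub> y"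
      using * r unfolding e by (simp only: a sm M.a_closed M.smult_closed M.smult_r_distr)
  next
    fix x assume "x \<in> carrier ?Q"
    then obtain x' where *: "x' \<in> carrier M" and e: "x = H +>\<^bsub>M\<^esub> x'" using ex by metis
    show "\<zero>\<^bsub>?Q\<^esub> \<oplus>\<^bsub>?Q\<^esub> x = x" using * unfolding e z0 by (simp only: a M.zero_closed M.l_zero)
    show "\<one>\<^bsub>R\<^esub> \<odot>\<^bsub>?Q\<^esub> x = x" using * unfolding e by (simp only: sm M.R.one_closed M.smult_one)
    show "\<zero>\<^bsub>R\<^esub> \<odot>\<^bsub>?Q\<^esub> x = \<zero>\<^bsub>?Q\<^esub>"
      using * unfolding e z0 by (simp only: sm M.R.zero_closed M.smult_l_null)
    fix r assume r: "r \<in> carrier R"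
    show "r \<odot>\<^bsub>?Q\<^esub> x \<in> carrier ?Q"
      using * r unfolding e by (simp only: sm M.smult_closed mem)
    fix s assume s: "s \<in> carrier R"
    show "(r \<oplus>\<^bsub>R\<^esub> s) \<odot>\<^bsub>?Q\<^esub> x = r \<odot>\<^bsub>?Q\<^esub> x \<oplus>\<^bsub>?Q\<^esub> s \<odot>\<^bsub>?Q\<^esub> x"
      using * r s unfolding e by (simp only: a sm M.R.a_closed M.smult_closed M.smult_l_distr)
    show "(r \<otimes>\<^bsub>R\<^esub> s) \<odot>\<^bsub>?Q\<^esub> x = r \<odot>\<^bsub>?Q\<^esub> (s \<odot>\<^bsub>?Q\<^esub> x)"
      using * r s unfolding e by (simp only: sm M.R.m_closed M.smult_closed M.smult_assoc1)
  qed
  show "(\<lambda>x. H +>\<^bsub>M\<^esub> x) \<in> module_hom R M ?Q"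
    by (rule module_homI) (simp_all only: mem a sm)
  show "x \<in> carrier M \<Longrightarrow> H +>\<^bsub>M\<^esub> x = \<zero>\<^bsub>?Q\<^esub> \<longleftrightarrow> x \<in> H"
    using z by (simp add: quotient_module_def)
qed

lemma module_hom_quotient_lift:
  assumes "module R M" "submodule H R M" "module R P" "f \<in> module_hom R M P"
    and "\<And>h. h \<in> H \<Longrightarrow> f h = \<zero>\<^bsub>P\<^esub>"
  obtains g where "g \<in> module_hom R (quotient_module M H) P"
    "\<And>x. x \<in> carrier M \<Longrightarrow> g (H +>\<^bsub>M\<^esub> x) = f x"
proof -
  interpret M: module R M by fact
  interpret P: module R P by fact
  note Q = module_quotient[OF assms(1,2)]
  interpret Q: module R "quotient_module M H" by (rule Q)
  let ?q = "\<lambda>x. H +>\<^bsub>M\<^esub> x"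
  note qh = module_homD[OF Q(3)] and fh = module_homD[OF assms(4)]
  have wd: "f x = f y" if "x \<in> carrier M" "y \<in> carrier M" "?q x = ?q y" for x y
  proof -
    have "?q (x \<ominus>\<^bsub>M\<^esub> y) = ?q x \<ominus>\<^bsub>quotient_module M H\<^esub> ?q x"
      using module_hom_minus[OF assms(1) Q(1) Q(3)] that by metis
    also have "\<dots> = \<zero>\<^bsub>quotient_module M H\<^esub>"
      using qh(1)[OF that(1)] Q.minus_eq_zero_iff by blast
    finally have "?q (x \<ominus>\<^bsub>M\<^esub> y) = \<zero>\<^bsub>quotient_module M H\<^esub>" .
    then have "x \<ominus>\<^bsub>M\<^esub> y \<in> H" using Q(4) that by simp
    then have "f x \<ominus>\<^bsub>P\<^esub> f y = \<zero>\<^bsub>P\<^esub>"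
      using assms(5) that module_hom_minus[OF assms(1,3,4)] by metis
    then show ?thesis using that(1,2)[THEN fh(1)] P.minus_eq_zero_iff by blast
  qed
  define g where "g = (\<lambda>c. f (inv_into (carrier M) ?q c))"
  have g: "g (?q x) = f x" if "x \<in> carrier M" for x
    unfolding g_def using that by (intro wd) (auto intro!: inv_into_into f_inv_into_f)
  have "g \<in> module_hom R (quotient_module M H) P"
  proof (rule module_homI)
    fix x y assume xy: "x \<in> carrier (quotient_module M H)" "y \<in> carrier (quotient_module M H)"
    then obtain x' y' where x': "x' \<in> carrier M" "y' \<in> carrier M" "x = ?q x'" "y = ?q y'"
      using Q(2) by auto
    then show "g (x \<oplus>\<^bsub>quotient_module M H\<^esub> y) = g x \<oplus>\<^bsub>P\<^esub> g y"
      using qh(2)[symmetric, of x' y'] by (simp add: g fh)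
  next
    fix r x assume rx: "r \<in> carrier R" "x \<in> carrier (quotient_module M H)"
    then obtain x' where x': "x' \<in> carrier M" "x = ?q x'" using Q(2) by auto
    then show "g (r \<odot>\<^bsub>quotient_module M H\<^esub> x) = r \<odot>\<^bsub>P\<^esub> g x"
      using rx qh(3)[symmetric, of r x'] by (simp add: g fh)
  next
    fix x assume "x \<in> carrier (quotient_module M H)"
    then show "g x \<in> carrier P" using Q(2) g fh by auto
  qed
  then show ?thesis using that g by blast
qed


section \<open>Baer's criterion\<close>

text \<open>Every homomorphism from an ideal to \<open>E\<close> is multiplication with an element of \<open>E\<close>. The
  ideal is not turned into a module: \<open>f\<close> is a function on it with the two linearity properties.\<close>

definition baer_module :: "'a ring \<Rightarrow> ('a, 'e) module \<Rightarrow> bool" where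
  "baer_module R E \<longleftrightarrow> (\<forall>I f. ideal I R \<and> f \<in> I \<rightarrow> carrier E \<and>
     (\<forall>a\<in>I. \<forall>b\<in>I. f (a \<oplus>\<^bsub>R\<^esub> b) = f a \<oplus>\<^bsub>E\<^esub> f b) \<and>
     (\<forall>r\<in>carrier R. \<forall>a\<in>I. f (r \<otimes>\<^bsub>R\<^esub> a) = r \<odot>\<^bsub>E\<^esub> f a) \<longrightarrow>
     (\<exists>e\<in>carrier E. \<forall>a\<in>I. f a = a \<odot>\<^bsub>E\<^esub> e))"

lemma baer_moduleD:
  assumes "baer_module R E" "ideal I R" "\<And>a. a \<in> I \<Longrightarrow> f a \<in> carrier E"
    "\<And>a b. a \<in> I \<Longrightarrow> b \<in> I \<Longrightarrow> f (a \<oplus>\<^bsub>R\<^esub> b) = f a \<oplus>\<^bsub>E\<^esub> f b"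
    "\<And>r a. r \<in> carrier R \<Longrightarrow> a \<in> I \<Longrightarrow> f (r \<otimes>\<^bsub>R\<^esub> a) = r \<odot>\<^bsub>E\<^esub> f a"
  obtains e where "e \<in> carrier E" "\<And>a. a \<in> I \<Longrightarrow> f a = a \<odot>\<^bsub>E\<^esub> e"
proof -
  have "\<exists>e\<in>carrier E. \<forall>a\<in>I. f a = a \<odot>\<^bsub>E\<^esub> e"
    by (rule assms(1)[unfolded baer_module_def, rule_format]) (simp add: assms(2-))
  then show ?thesis using that by (elim bexE) simp
qed

text \<open>A submodule of \<open>B \<times> E\<close> that is the graph of a partial map.\<close>

definition linear_graph :: "'a ring \<Rightarrow> ('a, 'b) module \<Rightarrow> ('a, 'e) module \<Rightarrow> ('b \<times> 'e) set \<Rightarrow> bool" where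
  "linear_graph R B E \<Gamma> \<longleftrightarrow> \<Gamma> \<subseteq> carrier B \<times> carrier E \<and> (\<zero>\<^bsub>B\<^esub>, \<zero>\<^bsub>E\<^esub>) \<in> \<Gamma> \<and>
     (\<forall>b e b' e'. (b, e) \<in> \<Gamma> \<longrightarrow> (b', e') \<in> \<Gamma> \<longrightarrow> (b \<oplus>\<^bsub>B\<^esub> b', e \<oplus>\<^bsub>E\<^esub> e') \<in> \<Gamma>) \<and>
     (\<forall>r b e. r \<in> carrier R \<longrightarrow> (b, e) \<in> \<Gamma> \<longrightarrow> (r \<odot>\<^bsub>B\<^esub> b, r \<odot>\<^bsub>E\<^esub> e) \<in> \<Gamma>) \<and>
     (\<forall>e. (\<zero>\<^bsub>B\<^esub>, e) \<in> \<Gamma> \<longrightarrow> e = \<zero>\<^bsub>E\<^esub>)"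

lemma linear_graphD:
  assumes "linear_graph R B E \<Gamma>"
  shows "\<Gamma> \<subseteq> carrier B \<times> carrier E" "(\<zero>\<^bsub>B\<^esub>, \<zero>\<^bsub>E\<^esub>) \<in> \<Gamma>"
    "(b, e) \<in> \<Gamma> \<Longrightarrow> (b', e') \<in> \<Gamma> \<Longrightarrow> (b \<oplus>\<^bsub>B\<^esub> b', e \<oplus>\<^bsub>E\<^esub> e') \<in> \<Gamma>"
    "r \<in> carrier R \<Longrightarrow> (b, e) \<in> \<Gamma> \<Longrightarrow> (r \<odot>\<^bsub>B\<^esub> b, r \<odot>\<^bsub>E\<^esub> e) \<in> \<Gamma>"
    "(\<zero>\<^bsub>B\<^esub>, e) \<in> \<Gamma> \<Longrightarrow> e = \<zero>\<^bsub>E\<^esub>"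
  using assms unfolding linear_graph_def by blast+

lemma linear_graph_unique:
  assumes "module R B" "module R E" "linear_graph R B E \<Gamma>" "(b, e) \<in> \<Gamma>" "(b, e') \<in> \<Gamma>"
  shows "e = e'"
proof -
  interpret B: module R B by fact
  interpret E: module R E by fact
  note \<Gamma> = linear_graphD[OF assms(3)]
  have c: "b \<in> carrier B" "e \<in> carrier E" "e' \<in> carrier E" using assms(4,5) \<Gamma>(1) by auto
  have "((\<ominus>\<^bsub>R\<^esub> \<one>\<^bsub>R\<^esub>) \<odot>\<^bsub>B\<^esub> b, (\<ominus>\<^bsub>R\<^esub> \<one>\<^bsub>R\<^esub>) \<odot>\<^bsub>E\<^esub> e') \<in> \<Gamma>" using \<Gamma>(4)[OF _ assms(5)] by blast
  then have "(\<ominus>\<^bsub>B\<^esub> b, \<ominus>\<^bsub>E\<^esub> e') \<in> \<Gamma>"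
    using c B.smult_l_minus[OF B.R.one_closed, of b] E.smult_l_minus[OF B.R.one_closed, of e'] by simp
  then have "(b \<oplus>\<^bsub>B\<^esub> \<ominus>\<^bsub>B\<^esub> b, e \<oplus>\<^bsub>E\<^esub> \<ominus>\<^bsub>E\<^esub> e') \<in> \<Gamma>" using \<Gamma>(3)[OF assms(4)] by blast
  then have "(\<zero>\<^bsub>B\<^esub>, e \<ominus>\<^bsub>E\<^esub> e') \<in> \<Gamma>" using B.r_neg[OF c(1)] by (simp add: a_minus_def)
  then show ?thesis using \<Gamma>(5) E.minus_eq_zero_iff c by blast
qed

lemma linear_graph_Union:
  assumes "subset.chain {\<Gamma>. linear_graph R B E \<Gamma> \<and> \<Gamma>0 \<subseteq> \<Gamma>} C" "C \<noteq> {}"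
  shows "\<Union>C \<in> {\<Gamma>. linear_graph R B E \<Gamma> \<and> \<Gamma>0 \<subseteq> \<Gamma>}"
proof -
  have C: "linear_graph R B E \<Gamma>" "\<Gamma>0 \<subseteq> \<Gamma>" if "\<Gamma> \<in> C" for \<Gamma>
    using assms that by (auto simp: subset.chain_def)
  have two: "\<exists>\<Gamma>\<in>C. p \<in> \<Gamma> \<and> q \<in> \<Gamma>" if pq: "p \<in> \<Union>C" "q \<in> \<Union>C" for p q
  proof -
    obtain V Y where XY: "V \<in> C" "p \<in> V" "Y \<in> C" "q \<in> Y" using pq by blast
    then have "V \<subseteq> Y \<or> Y \<subseteq> V" using assms(1) by (auto simp: subset_chain_def)
    then show ?thesis using XY by blast
  qed
  note gD = linear_graphD[OF C(1)]
  obtain \<Gamma>1 where \<Gamma>1: "\<Gamma>1 \<in> C" using assms(2) by auto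
  have "linear_graph R B E (\<Union>C)"
    unfolding linear_graph_def
  proof (intro conjI allI impI)
    show "\<Union>C \<subseteq> carrier B \<times> carrier E" using gD(1) by blast
    show "(\<zero>\<^bsub>B\<^esub>, \<zero>\<^bsub>E\<^esub>) \<in> \<Union>C" using gD(2) \<Gamma>1 by blast
    fix b e b' e' assume "(b, e) \<in> \<Union>C" "(b', e') \<in> \<Union>C"
    then obtain \<Gamma> where "\<Gamma> \<in> C" "(b, e) \<in> \<Gamma>" "(b', e') \<in> \<Gamma>" using two by blast
    then show "(b \<oplus>\<^bsub>B\<^esub> b', e \<oplus>\<^bsub>E\<^esub> e') \<in> \<Union>C" using gD(3) by blast
  next
    fix r b e assume "r \<in> carrier R" "(b, e) \<in> \<Union>C"
    then show "(r \<odot>\<^bsub>B\<^esub> b, r \<odot>\<^bsub>E\<^esub> e) \<in> \<Union>C" using gD(4) by blast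
  next
    fix e assume "(\<zero>\<^bsub>B\<^esub>, e) \<in> \<Union>C"
    then show "e = \<zero>\<^bsub>E\<^esub>" using gD(5) by blast
  qed
  then show ?thesis using C(2) \<Gamma>1 by blast
qed

text \<open>The step of Baer's criterion: \<open>\<Gamma>\<close> is enlarged by one element \<open>b\<close> of the domain; the value
  comes from the ideal of those \<open>r\<close> for which \<open>r b\<close> already has a value.\<close>

lemma linear_graph_extend:
  assumes "module R B" "module R E" "baer_module R E" "linear_graph R B E \<Gamma>" "b \<in> carrier B"
  obtains \<Gamma>' e where "linear_graph R B E \<Gamma>'" "\<Gamma> \<subseteq> \<Gamma>'" "(b, e) \<in> \<Gamma>'"
proof -
  interpret B: module R B by fact
  interpret E: module R E by fact
  note \<Gamma> = linear_graphD[OF assms(4)] and un = linear_graph_unique[OF assms(1,2,4)]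
  have \<Gamma>c: "x \<in> carrier B" "w \<in> carrier E" if "(x, w) \<in> \<Gamma>" for x w using \<Gamma>(1) that by auto
  define I where "I = {r \<in> carrier R. \<exists>w. (r \<odot>\<^bsub>B\<^esub> b, w) \<in> \<Gamma>}"
  define f where "f r = (THE w. (r \<odot>\<^bsub>B\<^esub> b, w) \<in> \<Gamma>)" for r
  have f: "(r \<odot>\<^bsub>B\<^esub> b, f r) \<in> \<Gamma>" if "r \<in> I" for r
    unfolding f_def by (rule theI') (use that un in \<open>auto simp: I_def\<close>)
  have fI: "r \<in> I" "f r = w" if "r \<in> carrier R" "(r \<odot>\<^bsub>B\<^esub> b, w) \<in> \<Gamma>" for r w
    using that un f unfolding I_def by blast+
  have Ic: "r \<in> carrier R" if "r \<in> I" for r using that by (simp add: I_def)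
  have add: "((r \<oplus>\<^bsub>R\<^esub> s) \<odot>\<^bsub>B\<^esub> b, f r \<oplus>\<^bsub>E\<^esub> f s) \<in> \<Gamma>" if "r \<in> I" "s \<in> I" for r s
    using \<Gamma>(3)[OF f[OF that(1)] f[OF that(2)]] that Ic assms(5) by (simp add: B.smult_l_distr)
  have mul: "((s \<otimes>\<^bsub>R\<^esub> r) \<odot>\<^bsub>B\<^esub> b, s \<odot>\<^bsub>E\<^esub> f r) \<in> \<Gamma>" if "r \<in> I" "s \<in> carrier R" for r s
    using \<Gamma>(4)[OF that(2) f[OF that(1)]] that Ic assms(5) by (simp add: B.smult_assoc1)
  have "submodule I R (ring_module R)"
    unfolding module.submodule_iff[OF module_ring_module[OF B.R.is_cring]]
  proof (intro conjI ballI)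
    show "I \<subseteq> carrier (ring_module R)" using Ic by auto
    show "\<zero>\<^bsub>ring_module R\<^esub> \<in> I"
      using fI(1)[of "\<zero>\<^bsub>R\<^esub>" "\<zero>\<^bsub>E\<^esub>"] \<Gamma>(2) assms(5) by simp
  next
    fix x y assume "x \<in> I" "y \<in> I"
    then show "x \<oplus>\<^bsub>ring_module R\<^esub> y \<in> I" using fI(1)[OF _ add] Ic by simp
  next
    fix a x assume "a \<in> carrier R" "x \<in> I"
    then show "a \<odot>\<^bsub>ring_module R\<^esub> x \<in> I" using fI(1)[OF _ mul] Ic by simp
  qed
  then have I: "ideal I R" by (simp add: submodule_ring_module_iff B.R.is_cring)
  have fc: "f a \<in> carrier E" if "a \<in> I" for a using \<Gamma>c(2)[OF f[OF that]] .
  have fadd: "f (a \<oplus>\<^bsub>R\<^esub> c) = f a \<oplus>\<^bsub>E\<^esub> f c" if "a \<in> I" "c \<in> I" for a c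
    using that by (intro fI(2) add B.R.a_closed Ic)
  have fmul: "f (r \<otimes>\<^bsub>R\<^esub> a) = r \<odot>\<^bsub>E\<^esub> f a" if "r \<in> carrier R" "a \<in> I" for r a
    using that by (intro fI(2) mul B.R.m_closed) (simp_all add: Ic)
  obtain e where e: "e \<in> carrier E" "\<And>a. a \<in> I \<Longrightarrow> f a = a \<odot>\<^bsub>E\<^esub> e"
    by (rule baer_moduleD[OF assms(3) I, of f]) (simp_all add: fc fadd fmul)
  define \<Gamma>' where "\<Gamma>' = {(x \<oplus>\<^bsub>B\<^esub> r \<odot>\<^bsub>B\<^esub> b, w \<oplus>\<^bsub>E\<^esub> r \<odot>\<^bsub>E\<^esub> e) | x w r. (x, w) \<in> \<Gamma> \<and> r \<in> carrier R}"
  have mem: "(x \<oplus>\<^bsub>B\<^esub> r \<odot>\<^bsub>B\<^esub> b, w \<oplus>\<^bsub>E\<^esub> r \<odot>\<^bsub>E\<^esub> e) \<in> \<Gamma>'" if "(x, w) \<in> \<Gamma>" "r \<in> carrier R" for x w r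
    unfolding \<Gamma>'_def using that by blast
  have sub: "\<Gamma> \<subseteq> \<Gamma>'"
  proof (rule subrelI)
    fix x w assume xw: "(x, w) \<in> \<Gamma>"
    show "(x, w) \<in> \<Gamma>'" using mem[OF xw B.R.zero_closed] \<Gamma>c[OF xw] assms(5) e(1) by simp
  qed
  have "linear_graph R B E \<Gamma>'" unfolding linear_graph_def
  proof (intro conjI allI impI)
    show "\<Gamma>' \<subseteq> carrier B \<times> carrier E" unfolding \<Gamma>'_def using \<Gamma>c assms(5) e(1) by auto
    show "(\<zero>\<^bsub>B\<^esub>, \<zero>\<^bsub>E\<^esub>) \<in> \<Gamma>'" using sub \<Gamma>(2) by blast
    fix y v y' v' assume "(y, v) \<in> \<Gamma>'" "(y', v') \<in> \<Gamma>'"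
    then obtain x w r x' w' r' where 1: "(x, w) \<in> \<Gamma>" "r \<in> carrier R" "(x', w') \<in> \<Gamma>" "r' \<in> carrier R"
      and 2: "y = x \<oplus>\<^bsub>B\<^esub> r \<odot>\<^bsub>B\<^esub> b" "v = w \<oplus>\<^bsub>E\<^esub> r \<odot>\<^bsub>E\<^esub> e" "y' = x' \<oplus>\<^bsub>B\<^esub> r' \<odot>\<^bsub>B\<^esub> b" "v' = w' \<oplus>\<^bsub>E\<^esub> r' \<odot>\<^bsub>E\<^esub> e"
      unfolding \<Gamma>'_def by blast
    have "y \<oplus>\<^bsub>B\<^esub> y' = (x \<oplus>\<^bsub>B\<^esub> x') \<oplus>\<^bsub>B\<^esub> (r \<oplus>\<^bsub>R\<^esub> r') \<odot>\<^bsub>B\<^esub> b"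
      unfolding 2 using 1 \<Gamma>c assms(5) by (simp add: B.smult_l_distr B.a_ac)
    moreover have "v \<oplus>\<^bsub>E\<^esub> v' = (w \<oplus>\<^bsub>E\<^esub> w') \<oplus>\<^bsub>E\<^esub> (r \<oplus>\<^bsub>R\<^esub> r') \<odot>\<^bsub>E\<^esub> e"
      unfolding 2 using 1 \<Gamma>c e(1) by (simp add: E.smult_l_distr E.a_ac)
    ultimately show "(y \<oplus>\<^bsub>B\<^esub> y', v \<oplus>\<^bsub>E\<^esub> v') \<in> \<Gamma>'"
      using mem[OF \<Gamma>(3)[OF 1(1,3)] B.R.a_closed[OF 1(2,4)]] by simp
  next
    fix s y v assume s: "s \<in> carrier R" and "(y, v) \<in> \<Gamma>'"
    then obtain x w r where 1: "(x, w) \<in> \<Gamma>" "r \<in> carrier R"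
      and 2: "y = x \<oplus>\<^bsub>B\<^esub> r \<odot>\<^bsub>B\<^esub> b" "v = w \<oplus>\<^bsub>E\<^esub> r \<odot>\<^bsub>E\<^esub> e"
      unfolding \<Gamma>'_def by blast
    have "s \<odot>\<^bsub>B\<^esub> y = s \<odot>\<^bsub>B\<^esub> x \<oplus>\<^bsub>B\<^esub> (s \<otimes>\<^bsub>R\<^esub> r) \<odot>\<^bsub>B\<^esub> b"
      unfolding 2 using s 1 \<Gamma>c assms(5) by (simp add: B.smult_r_distr B.smult_assoc1)
    moreover have "s \<odot>\<^bsub>E\<^esub> v = s \<odot>\<^bsub>E\<^esub> w \<oplus>\<^bsub>E\<^esub> (s \<otimes>\<^bsub>R\<^esub> r) \<odot>\<^bsub>E\<^esub> e"
      unfolding 2 using s 1 \<Gamma>c e(1) by (simp add: E.smult_r_distr E.smult_assoc1)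
    ultimately show "(s \<odot>\<^bsub>B\<^esub> y, s \<odot>\<^bsub>E\<^esub> v) \<in> \<Gamma>'"
      using mem[OF \<Gamma>(4)[OF s 1(1)] B.R.m_closed[OF s 1(2)]] by simp
  next
    fix v assume "(\<zero>\<^bsub>B\<^esub>, v) \<in> \<Gamma>'"
    then obtain x w r where 1: "(x, w) \<in> \<Gamma>" "r \<in> carrier R"
      and 2: "\<zero>\<^bsub>B\<^esub> = x \<oplus>\<^bsub>B\<^esub> r \<odot>\<^bsub>B\<^esub> b" "v = w \<oplus>\<^bsub>E\<^esub> r \<odot>\<^bsub>E\<^esub> e"
      unfolding \<Gamma>'_def by blast
    have "x = \<ominus>\<^bsub>B\<^esub> (r \<odot>\<^bsub>B\<^esub> b)"
      using 2(1) 1 \<Gamma>c assms(5) B.minus_equality[of x "r \<odot>\<^bsub>B\<^esub> b"] by simp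
    then have x: "x = (\<ominus>\<^bsub>R\<^esub> r) \<odot>\<^bsub>B\<^esub> b" using 1(2) assms(5) by (simp add: B.smult_l_minus)
    have "\<ominus>\<^bsub>R\<^esub> r \<in> I" "f (\<ominus>\<^bsub>R\<^esub> r) = w" using fI[of "\<ominus>\<^bsub>R\<^esub> r" w] 1 x by auto
    then have "w = \<ominus>\<^bsub>E\<^esub> (r \<odot>\<^bsub>E\<^esub> e)" using e(2) E.smult_l_minus[OF 1(2) e(1)] by metis
    then show "v = \<zero>\<^bsub>E\<^esub>" using 2(2) 1(2) e(1) E.l_neg by simp
  qed
  moreover have "(b, e) \<in> \<Gamma>'"
    using mem[OF \<Gamma>(2) B.R.one_closed] assms(5) e(1) by simp
  ultimately show ?thesis using sub that by blast
qed

text \<open>A maximal linear graph is the graph of a total map, by the previous lemma.\<close>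

lemma linear_graph_total:
  assumes "module R B" "module R E" "baer_module R E" "linear_graph R B E \<Gamma>0"
  obtains g where "g \<in> module_hom R B E" "\<And>b e. (b, e) \<in> \<Gamma>0 \<Longrightarrow> g b = e"
proof -
  interpret B: module R B by fact
  interpret E: module R E by fact
  let ?A = "{\<Gamma>. linear_graph R B E \<Gamma> \<and> \<Gamma>0 \<subseteq> \<Gamma>}"
  have "\<exists>\<Gamma>\<in>?A. \<forall>V\<in>?A. \<Gamma> \<subseteq> V \<longrightarrow> V = \<Gamma>"
    by (rule subset_Zorn_nonempty) (use assms(4) linear_graph_Union in \<open>blast+\<close>)
  then obtain \<Gamma> where \<Gamma>A: "\<Gamma> \<in> ?A" and maxA: "\<forall>V\<in>?A. \<Gamma> \<subseteq> V \<longrightarrow> V = \<Gamma>" by (elim bexE)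
  then have \<Gamma>: "linear_graph R B E \<Gamma>" "\<Gamma>0 \<subseteq> \<Gamma>" by auto
  have max: "V = \<Gamma>" if "linear_graph R B E V" "\<Gamma> \<subseteq> V" for V
    using maxA that \<Gamma>(2) by (metis (mono_tags, lifting) mem_Collect_eq order_trans)
  note un = linear_graph_unique[OF assms(1,2) \<Gamma>(1)] and gD = linear_graphD[OF \<Gamma>(1)]
  have total: "\<exists>e. (b, e) \<in> \<Gamma>" if "b \<in> carrier B" for b
    using linear_graph_extend[OF assms(1-3) \<Gamma>(1) that] max by metis
  define g where "g b = (THE e. (b, e) \<in> \<Gamma>)" for b
  have g: "(b, g b) \<in> \<Gamma>" if "b \<in> carrier B" for b
    unfolding g_def by (rule theI') (use total[OF that] un in blast)
  have g_eq: "g b = e" if "(b, e) \<in> \<Gamma>" for b e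
    using un[OF _ that] g gD(1) that by blast
  have "g \<in> module_hom R B E"
  proof (rule module_homI)
    show "g x \<in> carrier E" if "x \<in> carrier B" for x using g[OF that] gD(1) by blast
    show "g (x \<oplus>\<^bsub>B\<^esub> y) = g x \<oplus>\<^bsub>E\<^esub> g y" if "x \<in> carrier B" "y \<in> carrier B" for x y
      using g_eq[OF gD(3)[OF g g]] that by blast
    show "g (r \<odot>\<^bsub>B\<^esub> x) = r \<odot>\<^bsub>E\<^esub> g x" if "r \<in> carrier R" "x \<in> carrier B" for r x
      using g_eq[OF gD(4)[OF _ g]] that by blast
  qed
  then show ?thesis using that g_eq \<Gamma>(2) by blast
qed

text \<open>The extension property holds for arbitrary modules \<open>B\<close>; only the definition restricts the
  type of their elements.\<close>

lemma injective_module_baer: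
  fixes E :: "('a, 'e) module"
  assumes "module R E" "baer_module R E"
  shows "injective_module R E"
  unfolding injective_module_def
proof (intro conjI allI ballI impI assms(1))
  fix B :: "('a, 'e) module" and A f
  assume f: "f \<in> module_hom R (B\<lparr>carrier := A\<rparr>) E" and "module R B \<and> submodule A R B"
  then have B: "module R B" and A: "submodule A R B" by auto
  interpret B: module R B by fact
  interpret E: module R E by fact
  note AD = submoduleD[OF A B]
  have A': "module R (B\<lparr>carrier := A\<rparr>)" using submodule.submodule_is_module[OF A B] .
  let ?G = "{(a, f a) | a. a \<in> A}"
  note fD = module_homD[OF f, simplified]
  have f0: "f \<zero>\<^bsub>B\<^esub> = \<zero>\<^bsub>E\<^esub>" using module_hom_zero[OF A' assms(1) f] by simp
  have "linear_graph R B E ?G"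
    unfolding linear_graph_def
  proof (intro conjI allI impI)
    show "?G \<subseteq> carrier B \<times> carrier E" using AD(1) fD(1) by auto
    show "(\<zero>\<^bsub>B\<^esub>, \<zero>\<^bsub>E\<^esub>) \<in> ?G" using AD(2) f0 by auto
  next
    fix b e b' e' assume "(b, e) \<in> ?G" "(b', e') \<in> ?G"
    then show "(b \<oplus>\<^bsub>B\<^esub> b', e \<oplus>\<^bsub>E\<^esub> e') \<in> ?G" using AD(3) fD(2) by auto
  next
    fix r b e assume "r \<in> carrier R" "(b, e) \<in> ?G"
    then show "(r \<odot>\<^bsub>B\<^esub> b, r \<odot>\<^bsub>E\<^esub> e) \<in> ?G" using AD(4) fD(3) by auto
  next
    fix e assume "(\<zero>\<^bsub>B\<^esub>, e) \<in> ?G"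
    then show "e = \<zero>\<^bsub>E\<^esub>" using f0 by auto
  qed
  then obtain g where "g \<in> module_hom R B E" "\<And>b e. (b, e) \<in> ?G \<Longrightarrow> g b = e"
    using linear_graph_total[OF B assms] by blast
  then show "\<exists>g\<in>module_hom R B E. \<forall>a\<in>A. g a = f a" by blast
qed


section \<open>Characters\<close>

lemma int_multiples:
  fixes J :: "int set"
  assumes "0 \<in> J" "\<And>a b. a \<in> J \<Longrightarrow> b \<in> J \<Longrightarrow> a + b \<in> J" "\<And>r a. a \<in> J \<Longrightarrow> r * a \<in> J"
  obtains n :: nat where "J = {k. int n dvd k}"
proof -
  have "Gcd J \<in> J"
  proof (cases "J = {0}")
    case True
    then show ?thesis by simp
  next
    case False
    then obtain k where k: "k \<in> J" "k \<noteq> 0" using assms(1) by auto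
    then have "\<bar>k\<bar> \<in> J" using assms(3)[OF k(1), of "-1"] by (cases "k \<ge> 0") auto
    then have ex: "\<exists>n. 0 < n \<and> int n \<in> J" using k(2) by (intro exI[of _ "nat \<bar>k\<bar>"]) auto
    define n where "n = (LEAST n. 0 < n \<and> int n \<in> J)"
    have n: "0 < n" "int n \<in> J" using LeastI_ex[OF ex] by (auto simp: n_def)
    have "int n dvd j" if "j \<in> J" for j
    proof (rule ccontr)
      assume nd: "\<not> int n dvd j"
      have "j mod int n = j + (- (j div int n)) * int n" by (simp add: minus_div_mult_eq_mod[symmetric])
      then have "j mod int n \<in> J" using assms(2)[OF that assms(3)[OF n(2)]] by metis
      moreover have "j mod int n \<noteq> 0" using nd by (simp add: dvd_eq_mod_eq_0)
      moreover have "0 \<le> j mod int n" "j mod int n < int n"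
        using n(1) by (simp_all only: pos_mod_sign pos_mod_bound of_nat_0_less_iff)
      ultimately have "nat (j mod int n) < n" "0 < nat (j mod int n) \<and> int (nat (j mod int n)) \<in> J" by auto
      then show False unfolding n_def using not_less_Least by blast
    qed
    then have "int n dvd Gcd J" by (rule Gcd_greatest)
    moreover have "Gcd J dvd int n" using n(2) by (rule Gcd_dvd)
    ultimately have "Gcd J = int n" by (intro zdvd_antisym_nonneg) simp_all
    then show ?thesis using n(2) by simp
  qed
  then have "J = {k. int (nat (Gcd J)) dvd k}"
    using assms(3) by (auto simp: Gcd_int_greater_eq_0 elim!: dvdE) (metis mult.commute)
  then show ?thesis using that by blast
qed

text \<open>The divisible group of nonzero complex numbers and the additive group of a ring or module,
  as modules over the integers.\<close>

definition nonzero_complex :: "(int, complex) module" where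
  "nonzero_complex = \<lparr>carrier = {z. z \<noteq> 0}, monoid.mult = undefined, one = undefined,
     ring.zero = 1, ring.add = (*), smult = (\<lambda>k z. z powi k)\<rparr>"

definition int_module :: "('b, 'm) ring_scheme \<Rightarrow> (int, 'b) module" where
  "int_module P = \<lparr>carrier = carrier P, monoid.mult = undefined, one = undefined,
     ring.zero = \<zero>\<^bsub>P\<^esub>, ring.add = (\<oplus>\<^bsub>P\<^esub>), smult = (\<lambda>k x. x [^]\<^bsub>add_monoid P\<^esub> k)\<rparr>"

lemma module_nonzero_complex: "module \<Z> nonzero_complex"
  by (rule module_from_smult)
    (auto simp: nonzero_complex_def int_is_cring power_int_add power_int_mult_distrib power_int_mult mult.commute
      simp flip: power_int_mult)

lemma module_int_module:
  assumes "abelian_group P"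
  shows "module \<Z> (int_module P)"
proof -
  interpret P: abelian_group P by fact
  note [simp] = group.int_pow_closed[OF P.a_group, simplified] group.int_pow_mult[OF P.a_group, simplified] comm_group.int_pow_distrib[OF P.a_comm_group, simplified]
    group.int_pow_pow[OF P.a_group, simplified] group.int_pow_1[OF P.a_group, simplified] int_pow_0[of "add_monoid P", simplified]
  show ?thesis
    by (rule module_from_smult) (auto simp: int_module_def int_is_cring P.a_ac mult.commute)
qed

lemma complex_nth_root_exists:
  fixes c :: complex
  assumes "c \<noteq> 0" "n > 0"
  obtains w where "w ^ n = c" "w \<noteq> 0"
proof -
  have "{z::complex. z ^ n = c} \<noteq> {}" using card_nth_roots[OF assms] assms(2) by force
  then show ?thesis using that assms by force
qed

text \<open>Ideals of the integers are principal, so Baer's condition is divisibility.\<close>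

lemma baer_nonzero_complex: "baer_module \<Z> nonzero_complex"
  unfolding baer_module_def
proof (intro allI impI, elim conjE)
  fix I :: "int set" and f :: "int \<Rightarrow> complex"
  assume "ideal I \<Z>" and fc: "f \<in> I \<rightarrow> carrier nonzero_complex"
    and fs: "\<forall>r\<in>carrier \<Z>. \<forall>a\<in>I. f (r \<otimes>\<^bsub>\<Z>\<^esub> a) = r \<odot>\<^bsub>nonzero_complex\<^esub> f a"
  then have S: "submodule I \<Z> (ring_module \<Z>)" by (simp add: submodule_ring_module_iff int_is_cring)
  note I = submoduleD[OF S module_ring_module[OF int_is_cring]]
  have fn: "f a \<noteq> 0" if "a \<in> I" for a using fc that by (auto simp: nonzero_complex_def)
  have fs': "f (r * a) = f a powi r" if "a \<in> I" for r a
    using fs that by (simp add: nonzero_complex_def)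
  obtain n where n: "I = {k. int n dvd k}"
    by (rule int_multiples[of I]) (use I(2-4) in auto)
  show "\<exists>e\<in>carrier nonzero_complex. \<forall>a\<in>I. f a = a \<odot>\<^bsub>nonzero_complex\<^esub> e"
  proof (cases "n = 0")
    case True
    then have "f 0 = 1" using fs'[of 0 0] n by simp
    then show ?thesis using True n by (intro bexI[of _ 1]) (auto simp: nonzero_complex_def)
  next
    case False
    have nI: "int n \<in> I" using n by simp
    obtain w where w: "w ^ n = f (int n)" "w \<noteq> 0" using complex_nth_root_exists fn[OF nI] False by blast
    have "f a = w powi a" if "a \<in> I" for a
    proof -
      obtain j where j: "a = int n * j" using n \<open>a \<in> I\<close> by (auto elim: dvdE)
      have "f a = f (int n) powi j" using fs'[OF nI, of j] by (simp add: j mult.commute)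
      also have "\<dots> = w powi a" unfolding j power_int_mult w(1)[symmetric] by simp
      finally show ?thesis .
    qed
    then show ?thesis using w(2) by (intro bexI[of _ w]) (auto simp: nonzero_complex_def)
  qed
qed

text \<open>Homomorphisms from the additive group to the nonzero complex numbers.\<close>

definition additive_character :: "('b, 'm) ring_scheme \<Rightarrow> ('b \<Rightarrow> complex) \<Rightarrow> bool" where
  "additive_character P \<chi> \<longleftrightarrow> (\<forall>x\<in>carrier P. \<chi> x \<noteq> 0) \<and>
     (\<forall>x\<in>carrier P. \<forall>y\<in>carrier P. \<chi> (x \<oplus>\<^bsub>P\<^esub> y) = \<chi> x * \<chi> y)"

lemma additive_characterD:
  assumes "additive_character P \<chi>"
  shows "x \<in> carrier P \<Longrightarrow> \<chi> x \<noteq> 0"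
    "x \<in> carrier P \<Longrightarrow> y \<in> carrier P \<Longrightarrow> \<chi> (x \<oplus>\<^bsub>P\<^esub> y) = \<chi> x * \<chi> y"
  using assms by (simp_all add: additive_character_def)

text \<open>A character on a subgroup, given by its graph \<open>\<Gamma>\<close>, extends to the whole group.\<close>

lemma character_extension:
  fixes P :: "('b, 'm) ring_scheme"
  assumes "abelian_group P" and sub: "\<Gamma> \<subseteq> carrier P \<times> {z::complex. z \<noteq> 0}" and zero: "(\<zero>\<^bsub>P\<^esub>, 1) \<in> \<Gamma>"
    and add: "\<And>x z x' z'. (x, z) \<in> \<Gamma> \<Longrightarrow> (x', z') \<in> \<Gamma> \<Longrightarrow> (x \<oplus>\<^bsub>P\<^esub> x', z * z') \<in> \<Gamma>"
    and neg: "\<And>x z. (x, z) \<in> \<Gamma> \<Longrightarrow> (\<ominus>\<^bsub>P\<^esub> x, inverse z) \<in> \<Gamma>"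
    and single: "\<And>z. (\<zero>\<^bsub>P\<^esub>, z) \<in> \<Gamma> \<Longrightarrow> z = 1"
  shows "\<exists>\<chi>. additive_character P \<chi> \<and> (\<forall>x z. (x, z) \<in> \<Gamma> \<longrightarrow> \<chi> x = z)"
proof -
  interpret P: abelian_group P by fact
  have pow: "(x [^]\<^bsub>add_monoid P\<^esub> n, z ^ n) \<in> \<Gamma>" if "(x, z) \<in> \<Gamma>" for x z and n :: nat
  proof (induction n)
    case 0
    then show ?case using zero by simp
  next
    case (Suc n)
    have "(x [^]\<^bsub>add_monoid P\<^esub> n \<oplus>\<^bsub>P\<^esub> x, z ^ n * z) \<in> \<Gamma>" using add[OF Suc that] .
    then show ?case by (simp add: mult.commute)
  qed
  have ipow: "(x [^]\<^bsub>add_monoid P\<^esub> k, z powi k) \<in> \<Gamma>" if "(x, z) \<in> \<Gamma>" for x z and k :: int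
  proof (cases k rule: int_cases2)
    case (nonneg n)
    show ?thesis using pow[OF that, of n] unfolding nonneg by (simp add: int_pow_int)
  next
    case (nonpos n)
    have "x \<in> carrier P" using that sub by auto
    then have "x [^]\<^bsub>add_monoid P\<^esub> (- int n) = \<ominus>\<^bsub>P\<^esub> (x [^]\<^bsub>add_monoid P\<^esub> n)"
      using group.int_pow_neg_int[OF P.a_group, of x n] by (simp add: a_inv_def)
    then show ?thesis using neg[OF pow[OF that, of n]] unfolding nonpos by (simp add: power_int_minus)
  qed
  have G: "linear_graph \<Z> (int_module P) nonzero_complex \<Gamma>"
    unfolding linear_graph_def
  proof (intro conjI allI impI)
    show "\<Gamma> \<subseteq> carrier (int_module P) \<times> carrier nonzero_complex"
      using sub by (simp add: int_module_def nonzero_complex_def)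
    show "(\<zero>\<^bsub>int_module P\<^esub>, \<zero>\<^bsub>nonzero_complex\<^esub>) \<in> \<Gamma>"
      using zero by (simp add: int_module_def nonzero_complex_def)
  next
    fix x z x' z' assume "(x, z) \<in> \<Gamma>" "(x', z') \<in> \<Gamma>"
    then show "(x \<oplus>\<^bsub>int_module P\<^esub> x', z \<oplus>\<^bsub>nonzero_complex\<^esub> z') \<in> \<Gamma>"
      using add[of x z x' z'] by (simp add: int_module_def nonzero_complex_def)
  next
    fix k x z assume "(x, z) \<in> \<Gamma>"
    then show "(k \<odot>\<^bsub>int_module P\<^esub> x, k \<odot>\<^bsub>nonzero_complex\<^esub> z) \<in> \<Gamma>"
      using ipow[of x z k] by (simp add: int_module_def nonzero_complex_def)
  next
    fix z assume "(\<zero>\<^bsub>int_module P\<^esub>, z) \<in> \<Gamma>"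
    then show "z = \<zero>\<^bsub>nonzero_complex\<^esub>"
      using single[of z] by (simp add: int_module_def nonzero_complex_def)
  qed
  obtain \<chi> where \<chi>: "\<chi> \<in> module_hom \<Z> (int_module P) nonzero_complex" "\<And>x z. (x, z) \<in> \<Gamma> \<Longrightarrow> \<chi> x = z"
    using linear_graph_total[OF module_int_module[OF assms(1)] module_nonzero_complex baer_nonzero_complex G]
    by metis
  note hD = module_homD[OF \<chi>(1)]
  have "additive_character P \<chi>"
    unfolding additive_character_def
  proof (intro conjI ballI)
    show "\<chi> x \<noteq> 0" if "x \<in> carrier P" for x
      using hD(1)[of x] that by (simp add: int_module_def nonzero_complex_def)
    show "\<chi> (x \<oplus>\<^bsub>P\<^esub> y) = \<chi> x * \<chi> y" if "x \<in> carrier P" "y \<in> carrier P" for x y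
      using hD(2)[of x y] that by (simp add: int_module_def nonzero_complex_def)
  qed
  then show ?thesis using \<chi>(2) by blast
qed

lemma complex_root_of_unity_exists:
  assumes "n \<noteq> 1"
  obtains z :: complex where "z ^ n = 1" "z \<noteq> 1" "z \<noteq> 0"
proof (cases "n = 0")
  case True
  then show ?thesis using that[of 2] by simp
next
  case False
  then have n: "n \<ge> 2" using assms by simp
  then have card: "card {z::complex. z ^ n = 1} = n" using card_nth_roots[of 1 n] by simp
  have "\<exists>z::complex. z ^ n = 1 \<and> z \<noteq> 1"
  proof (rule ccontr)
    assume "\<not> (\<exists>z::complex. z ^ n = 1 \<and> z \<noteq> 1)"
    then have "{z::complex. z ^ n = 1} = {1}" by auto
    then show False using card n by simp
  qed
  then obtain z :: complex where z: "z ^ n = 1" "z \<noteq> 1" by blast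
  then have "z \<noteq> 0" using False by (auto simp: power_0_left)
  then show ?thesis using that z by blast
qed

text \<open>On \<open>H + \<int> q\<close> let \<open>\<chi> (h + k q) = z\<^sup>k\<close>, where \<open>z \<noteq> 1\<close> is a root of unity whose order divides the
  order \<open>n\<close> of \<open>q\<close> modulo \<open>H\<close>, or arbitrary if this order is infinite (\<open>n = 0\<close>).\<close>

lemma character_separation:
  fixes P :: "('b, 'm) ring_scheme"
  assumes "abelian_group P" "subgroup H (add_monoid P)" "q \<in> carrier P" "q \<notin> H"
  obtains \<chi> where "additive_character P \<chi>" "\<And>h. h \<in> H \<Longrightarrow> \<chi> h = 1" "\<chi> q \<noteq> 1"
proof -
  interpret P: abelian_group P by fact
  interpret H: subgroup H "add_monoid P" by fact
  note Hs = H.subset[simplified] H.m_closed[simplified] H.one_closed[simplified]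
    H.m_inv_closed[folded a_inv_def]
  let ?m = "\<lambda>k::int. q [^]\<^bsub>add_monoid P\<^esub> k"
  have mc: "?m k \<in> carrier P" for k using group.int_pow_closed[OF P.a_group, of q k] assms(3) by simp
  have madd: "?m (j + k) = ?m j \<oplus>\<^bsub>P\<^esub> ?m k" for j k using group.int_pow_mult[OF P.a_group, of q j k] assms(3) by simp
  have mneg: "?m (- k) = \<ominus>\<^bsub>P\<^esub> ?m k" for k using group.int_pow_neg[OF P.a_group, of q k] assms(3) by (simp add: a_inv_def)
  have m0: "?m 0 = \<zero>\<^bsub>P\<^esub>" and m1: "?m 1 = q" using assms(3) by (simp_all add: group.int_pow_1[OF P.a_group])
  define J where "J = {k. ?m k \<in> H}"
  have "r * a \<in> J" if "a \<in> J" for r a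
  proof -
    have "?m (a * r) = (?m a) [^]\<^bsub>add_monoid P\<^esub> r" using group.int_pow_pow[OF P.a_group, of q a r] assms(3) by simp
    also have "\<dots> \<in> H" using that group.int_pow_consistent[OF P.a_group assms(2), of "?m a" r]
        group.int_pow_closed[OF subgroup.subgroup_is_group[OF assms(2) P.a_group], of "?m a" r] by (simp add: J_def)
    finally show ?thesis by (simp add: J_def mult.commute)
  qed
  then obtain n where n: "J = {k. int n dvd k}"
    using int_multiples[of J] Hs(2,3) m0 madd by (auto simp: J_def)
  have "1 \<notin> J" using m1 assms(4) by (simp add: J_def)
  then have "n \<noteq> 1" using n by auto
  then obtain z :: complex where z: "z ^ n = 1" "z \<noteq> 1" "z \<noteq> 0"
    using complex_root_of_unity_exists by blast
  have zJ: "z powi k = 1" if "k \<in> J" for k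
  proof -
    have "int n dvd k" using that n by simp
    then obtain j where "k = int n * j" unfolding dvd_def by blast
    then show ?thesis using z(1) by (simp add: power_int_mult)
  qed
  define \<Gamma> where "\<Gamma> = {(h \<oplus>\<^bsub>P\<^esub> ?m k, z powi k) | h k. h \<in> H}"
  have mem: "(h \<oplus>\<^bsub>P\<^esub> ?m k, z powi k) \<in> \<Gamma>" if "h \<in> H" for h k unfolding \<Gamma>_def using that by blast
  have hc: "h \<in> carrier P" if "h \<in> H" for h using Hs(1) that by auto
  have "\<exists>\<chi>. additive_character P \<chi> \<and> (\<forall>x z. (x, z) \<in> \<Gamma> \<longrightarrow> \<chi> x = z)"
  proof (rule character_extension[OF assms(1), of \<Gamma>])
    show "\<Gamma> \<subseteq> carrier P \<times> {z. z \<noteq> 0}" unfolding \<Gamma>_def using hc mc z(3) by auto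
    show "(\<zero>\<^bsub>P\<^esub>, 1) \<in> \<Gamma>" using mem[OF Hs(3), of 0] m0 by simp
  next
    fix x w x' w' assume "(x, w) \<in> \<Gamma>" "(x', w') \<in> \<Gamma>"
    then obtain h k h' k' where *: "h \<in> H" "h' \<in> H" "x = h \<oplus>\<^bsub>P\<^esub> ?m k" "w = z powi k"
      "x' = h' \<oplus>\<^bsub>P\<^esub> ?m k'" "w' = z powi k'" unfolding \<Gamma>_def by blast
    have "x \<oplus>\<^bsub>P\<^esub> x' = (h \<oplus>\<^bsub>P\<^esub> h') \<oplus>\<^bsub>P\<^esub> ?m (k + k')"
      unfolding * madd using hc[OF *(1)] hc[OF *(2)] mc by (simp add: P.a_ac)
    then show "(x \<oplus>\<^bsub>P\<^esub> x', w * w') \<in> \<Gamma>"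
      using mem[OF Hs(2)[OF *(1,2)], of "k + k'"] * z(3) by (simp add: power_int_add)
  next
    fix x w assume "(x, w) \<in> \<Gamma>"
    then obtain h k where *: "h \<in> H" "x = h \<oplus>\<^bsub>P\<^esub> ?m k" "w = z powi k" unfolding \<Gamma>_def by blast
    have "\<ominus>\<^bsub>P\<^esub> x = \<ominus>\<^bsub>P\<^esub> h \<oplus>\<^bsub>P\<^esub> ?m (- k)"
      unfolding * mneg using hc[OF *(1)] mc by (simp add: P.minus_add)
    then show "(\<ominus>\<^bsub>P\<^esub> x, inverse w) \<in> \<Gamma>"
      using mem[OF Hs(4)[OF *(1)], of "- k"] * by (simp add: power_int_minus)
  next
    fix w assume "(\<zero>\<^bsub>P\<^esub>, w) \<in> \<Gamma>"
    then obtain h k where *: "h \<in> H" "\<zero>\<^bsub>P\<^esub> = h \<oplus>\<^bsub>P\<^esub> ?m k" "w = z powi k" unfolding \<Gamma>_def by blast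
    have "?m k = \<ominus>\<^bsub>P\<^esub> h" using *(2) hc[OF *(1)] mc P.minus_equality[of "?m k" h] by (simp add: P.a_comm)
    then have "k \<in> J" using Hs(4)[OF *(1)] by (simp add: J_def)
    then show "w = 1" using zJ *(3) by simp
  qed
  then obtain \<chi> where \<chi>: "additive_character P \<chi>" "\<And>x z. (x, z) \<in> \<Gamma> \<Longrightarrow> \<chi> x = z" by blast
  show ?thesis
  proof (rule that[OF \<chi>(1)])
    show "\<chi> h = 1" if "h \<in> H" for h using \<chi>(2)[OF mem[OF that, of 0]] hc[OF that] m0 by simp
    have "(q, z) \<in> \<Gamma>" using mem[OF Hs(3), of 1] m1 assms(3) by simp
    then show "\<chi> q \<noteq> 1" using \<chi>(2) z(2) by simp
  qed
qed

text \<open>The product over an index type of copies of \<open>Hom\<^sub>\<int>(R, \<complex>\<^sup>\<times>)\<close>. The value \<open>1\<close> outside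
  \<open>carrier R\<close> makes the functions extensional.\<close>

definition char_module :: "'a ring \<Rightarrow> ('a, 'x \<Rightarrow> 'a \<Rightarrow> complex) module" where
  "char_module R = \<lparr>carrier = {F. \<forall>i. (\<forall>r\<in>carrier R. F i r \<noteq> 0) \<and>
       (\<forall>r\<in>carrier R. \<forall>s\<in>carrier R. F i (r \<oplus>\<^bsub>R\<^esub> s) = F i r * F i s) \<and> (\<forall>r. r \<notin> carrier R \<longrightarrow> F i r = 1)},
     monoid.mult = undefined, one = undefined, ring.zero = (\<lambda>i r. 1),
     ring.add = (\<lambda>F G i r. F i r * G i r),
     smult = (\<lambda>a F i r. if r \<in> carrier R then F i (a \<otimes>\<^bsub>R\<^esub> r) else 1)\<rparr>"

lemma char_moduleD:
  assumes "F \<in> carrier (char_module R)"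
  shows "r \<in> carrier R \<Longrightarrow> F i r \<noteq> 0"
    "r \<in> carrier R \<Longrightarrow> s \<in> carrier R \<Longrightarrow> F i (r \<oplus>\<^bsub>R\<^esub> s) = F i r * F i s"
    "r \<notin> carrier R \<Longrightarrow> F i r = 1"
  using assms by (simp_all add: char_module_def)

lemma char_moduleI:
  assumes "\<And>i r. r \<in> carrier R \<Longrightarrow> F i r \<noteq> 0"
    "\<And>i r s. r \<in> carrier R \<Longrightarrow> s \<in> carrier R \<Longrightarrow> F i (r \<oplus>\<^bsub>R\<^esub> s) = F i r * F i s"
    "\<And>i r. r \<notin> carrier R \<Longrightarrow> F i r = 1"
  shows "F \<in> carrier (char_module R)"
  using assms by (simp add: char_module_def)

lemma char_module_simps:
  "\<zero>\<^bsub>char_module R\<^esub> = (\<lambda>i r. 1)" "F \<oplus>\<^bsub>char_module R\<^esub> G = (\<lambda>i r. F i r * G i r)"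
  "a \<odot>\<^bsub>char_module R\<^esub> F = (\<lambda>i r. if r \<in> carrier R then F i (a \<otimes>\<^bsub>R\<^esub> r) else 1)"
  by (simp_all add: char_module_def)

lemma module_char_module:
  assumes "cring R"
  shows "module R (char_module R :: ('a, 'x \<Rightarrow> 'a \<Rightarrow> complex) module)"
proof -
  interpret R: cring R by fact
  let ?C = "char_module R :: ('a, 'x \<Rightarrow> 'a \<Rightarrow> complex) module"
  note D = char_moduleD
  have z: "F i \<zero>\<^bsub>R\<^esub> = 1" if "F \<in> carrier ?C" for F i
    using D(2)[OF that, of "\<zero>\<^bsub>R\<^esub>" "\<zero>\<^bsub>R\<^esub>" i] D(1)[OF that, of "\<zero>\<^bsub>R\<^esub>" i] by simp
  show ?thesis
  proof (rule module_from_smult[OF assms])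
    show "\<zero>\<^bsub>?C\<^esub> \<in> carrier ?C" by (rule char_moduleI) (simp_all add: char_module_simps)
  next
    fix F G assume F: "F \<in> carrier ?C" and G: "G \<in> carrier ?C"
    show "F \<oplus>\<^bsub>?C\<^esub> G \<in> carrier ?C"
      by (rule char_moduleI) (simp_all add: char_module_simps D[OF F] D[OF G])
    show "F \<oplus>\<^bsub>?C\<^esub> G = G \<oplus>\<^bsub>?C\<^esub> F" by (simp add: char_module_simps mult.commute)
    fix a assume a: "a \<in> carrier R"
    show "a \<odot>\<^bsub>?C\<^esub> (F \<oplus>\<^bsub>?C\<^esub> G) = a \<odot>\<^bsub>?C\<^esub> F \<oplus>\<^bsub>?C\<^esub> a \<odot>\<^bsub>?C\<^esub> G"
      by (intro ext) (simp add: char_module_simps)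
  next
    fix F G K assume "F \<in> carrier ?C"
    show "F \<oplus>\<^bsub>?C\<^esub> G \<oplus>\<^bsub>?C\<^esub> K = F \<oplus>\<^bsub>?C\<^esub> (G \<oplus>\<^bsub>?C\<^esub> K)"
      by (simp add: char_module_simps mult.assoc)
  next
    fix F assume F: "F \<in> carrier ?C"
    show "\<zero>\<^bsub>?C\<^esub> \<oplus>\<^bsub>?C\<^esub> F = F" by (simp add: char_module_simps)
    show "\<one>\<^bsub>R\<^esub> \<odot>\<^bsub>?C\<^esub> F = F" by (intro ext) (simp add: char_module_simps D(3)[OF F])
    show "\<zero>\<^bsub>R\<^esub> \<odot>\<^bsub>?C\<^esub> F = \<zero>\<^bsub>?C\<^esub>" by (intro ext) (simp add: char_module_simps z[OF F])
    fix a assume a: "a \<in> carrier R"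
    show "a \<odot>\<^bsub>?C\<^esub> F \<in> carrier ?C"
      by (rule char_moduleI) (simp_all add: char_module_simps a D(1,2)[OF F] R.r_distr)
    fix b assume b: "b \<in> carrier R"
    show "(a \<oplus>\<^bsub>R\<^esub> b) \<odot>\<^bsub>?C\<^esub> F = a \<odot>\<^bsub>?C\<^esub> F \<oplus>\<^bsub>?C\<^esub> b \<odot>\<^bsub>?C\<^esub> F"
      by (intro ext) (simp add: char_module_simps a b R.l_distr D(2)[OF F])
    show "(a \<otimes>\<^bsub>R\<^esub> b) \<odot>\<^bsub>?C\<^esub> F = a \<odot>\<^bsub>?C\<^esub> (b \<odot>\<^bsub>?C\<^esub> F)"
      by (intro ext) (simp add: char_module_simps a b R.m_ac)
  qed
qed

text \<open>A homomorphism \<open>f\<close> from an ideal is recovered from the characters \<open>a \<mapsto> f a i 1\<close> of the ideal,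
  which extend to \<open>R\<close>.\<close>

lemma baer_char_module:
  assumes "cring R"
  shows "baer_module R (char_module R :: ('a, 'x \<Rightarrow> 'a \<Rightarrow> complex) module)"
  unfolding baer_module_def
proof (intro allI impI, elim conjE)
  interpret R: cring R by fact
  let ?C = "char_module R :: ('a, 'x \<Rightarrow> 'a \<Rightarrow> complex) module"
  note D = char_moduleD
  fix I and f :: "'a \<Rightarrow> 'x \<Rightarrow> 'a \<Rightarrow> complex"
  assume "ideal I R" and fc: "f \<in> I \<rightarrow> carrier ?C"
    and fa: "\<forall>a\<in>I. \<forall>b\<in>I. f (a \<oplus>\<^bsub>R\<^esub> b) = f a \<oplus>\<^bsub>?C\<^esub> f b"
    and fs: "\<forall>r\<in>carrier R. \<forall>a\<in>I. f (r \<otimes>\<^bsub>R\<^esub> a) = r \<odot>\<^bsub>?C\<^esub> f a"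
  interpret I: ideal I R by fact
  have fD: "f a \<in> carrier ?C" if "a \<in> I" for a using fc that by auto
  have fz: "f \<zero>\<^bsub>R\<^esub> i \<one>\<^bsub>R\<^esub> = 1" for i
    using fa[rule_format, of "\<zero>\<^bsub>R\<^esub>" "\<zero>\<^bsub>R\<^esub>"] D(1)[OF fD, of "\<zero>\<^bsub>R\<^esub>" "\<one>\<^bsub>R\<^esub>" i]
    by (auto simp: char_module_simps fun_eq_iff)
  have "\<exists>\<chi>. additive_character R \<chi> \<and> (\<forall>a\<in>I. \<chi> a = f a i \<one>\<^bsub>R\<^esub>)" for i
  proof -
    let ?G = "{(a, f a i \<one>\<^bsub>R\<^esub>) | a. a \<in> I}"
    have "\<exists>\<chi>. additive_character R \<chi> \<and> (\<forall>x z. (x, z) \<in> ?G \<longrightarrow> \<chi> x = z)"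
    proof (rule character_extension[OF R.abelian_group_axioms, of ?G])
      show "?G \<subseteq> carrier R \<times> {z. z \<noteq> 0}" using D(1)[OF fD R.one_closed] I.Icarr by auto
      show "(\<zero>\<^bsub>R\<^esub>, 1) \<in> ?G" using fz[of i] I.zero_closed by force
    next
      fix x z x' z' assume "(x, z) \<in> ?G" "(x', z') \<in> ?G"
      then have x: "x \<in> I" "x' \<in> I" "z = f x i \<one>\<^bsub>R\<^esub>" "z' = f x' i \<one>\<^bsub>R\<^esub>" by auto
      then have "z * z' = f (x \<oplus>\<^bsub>R\<^esub> x') i \<one>\<^bsub>R\<^esub>" using fa by (simp add: char_module_simps)
      then show "(x \<oplus>\<^bsub>R\<^esub> x', z * z') \<in> ?G" using x I.a_closed by blast
    next
      fix x z assume "(x, z) \<in> ?G"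
      then have x: "x \<in> I" "z = f x i \<one>\<^bsub>R\<^esub>" by auto
      then have x': "\<ominus>\<^bsub>R\<^esub> x \<in> I" by simp
      have "f (x \<oplus>\<^bsub>R\<^esub> \<ominus>\<^bsub>R\<^esub> x) i \<one>\<^bsub>R\<^esub> = z * f (\<ominus>\<^bsub>R\<^esub> x) i \<one>\<^bsub>R\<^esub>"
        using fa x x' by (simp add: char_module_simps)
      then have "z * f (\<ominus>\<^bsub>R\<^esub> x) i \<one>\<^bsub>R\<^esub> = 1" using fz[of i] I.Icarr[OF x(1)] by (simp add: R.r_neg)
      then have "inverse z = f (\<ominus>\<^bsub>R\<^esub> x) i \<one>\<^bsub>R\<^esub>" by (rule inverse_unique)
      then show "(\<ominus>\<^bsub>R\<^esub> x, inverse z) \<in> ?G" using x' by blast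
    next
      fix z assume "(\<zero>\<^bsub>R\<^esub>, z) \<in> ?G"
      then show "z = 1" using fz[of i] by simp
    qed
    then show ?thesis by blast
  qed
  then obtain \<chi> where \<chi>c: "\<And>i. additive_character R (\<chi> i)"
    and \<chi>v: "\<And>i a. a \<in> I \<Longrightarrow> \<chi> i a = f a i \<one>\<^bsub>R\<^esub>" by metis
  note \<chi> = additive_characterD[OF \<chi>c]
  define e where "e = (\<lambda>i r. if r \<in> carrier R then \<chi> i r else 1)"
  have "e \<in> carrier ?C" by (rule char_moduleI) (simp_all add: e_def \<chi>(1,2))
  moreover have "f a = a \<odot>\<^bsub>?C\<^esub> e" if a: "a \<in> I" for a
  proof (intro ext)
    fix i r
    show "f a i r = (a \<odot>\<^bsub>?C\<^esub> e) i r"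
    proof (cases "r \<in> carrier R")
      case True
      then have ar: "a \<otimes>\<^bsub>R\<^esub> r \<in> I" "r \<otimes>\<^bsub>R\<^esub> a = a \<otimes>\<^bsub>R\<^esub> r"
        using I.I_r_closed[OF a True] R.m_comm[OF True I.Icarr[OF a]] by auto
      have "f (a \<otimes>\<^bsub>R\<^esub> r) i \<one>\<^bsub>R\<^esub> = (r \<odot>\<^bsub>?C\<^esub> f a) i \<one>\<^bsub>R\<^esub>"
        using fs[rule_format, OF True a] ar(2) by simp
      then have "f (a \<otimes>\<^bsub>R\<^esub> r) i \<one>\<^bsub>R\<^esub> = f a i r" using True by (simp add: char_module_simps)
      then show ?thesis
        using True ar(1) I.Icarr[OF ar(1)] by (simp add: char_module_simps e_def \<chi>v)
    next
      case False
      then show ?thesis by (simp add: char_module_simps D(3)[OF fD[OF a]])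
    qed
  qed
  ultimately show "\<exists>e\<in>carrier ?C. \<forall>a\<in>I. f a = a \<odot>\<^bsub>?C\<^esub> e" by blast
qed

text \<open>The index type consists of the characters of \<open>P\<close>; those that are trivial on \<open>H\<close> separate
  the points of \<open>P / H\<close>.\<close>

lemma char_module_embedding:
  fixes P :: "('a, 'b) module"
  assumes "module R P" "submodule H R P"
  obtains \<delta> :: "'b \<Rightarrow> ('b \<Rightarrow> complex) \<Rightarrow> 'a \<Rightarrow> complex"
  where "\<delta> \<in> module_hom R P (char_module R)" "module_kernel P (char_module R) \<delta> = H"
proof -
  interpret P: module R P by fact
  note HD = submoduleD[OF assms(2,1)]
  let ?C = "char_module R :: ('a, ('b \<Rightarrow> complex) \<Rightarrow> 'a \<Rightarrow> complex) module"
  define V where "V = {\<chi>. additive_character P \<chi> \<and> (\<forall>h\<in>H. \<chi> h = 1)}"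
  have V: "\<chi> x \<noteq> 0" "\<chi> (x \<oplus>\<^bsub>P\<^esub> y) = \<chi> x * \<chi> y"
    if "\<chi> \<in> V" "x \<in> carrier P" "y \<in> carrier P" for \<chi> x y
    using that additive_characterD[of P \<chi>] by (simp_all add: V_def)
  \<comment> \<open>The value \<open>1\<close> outside \<open>V\<close> and \<open>carrier R\<close> makes the functions elements of the module.\<close>
  define \<delta> where "\<delta> p = (\<lambda>\<chi> r. if \<chi> \<in> V \<and> r \<in> carrier R then \<chi> (r \<odot>\<^bsub>P\<^esub> p) else 1)" for p
  have hom: "\<delta> \<in> module_hom R P ?C"
  proof (rule module_homI)
    fix x assume x: "x \<in> carrier P"
    show "\<delta> x \<in> carrier ?C"
    proof (rule char_moduleI)
      fix \<chi> r assume r: "r \<in> carrier R"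
      show "\<delta> x \<chi> r \<noteq> 0" using V(1)[of \<chi> "r \<odot>\<^bsub>P\<^esub> x" "r \<odot>\<^bsub>P\<^esub> x"] r x by (simp add: \<delta>_def)
      fix s assume s: "s \<in> carrier R"
      show "\<delta> x \<chi> (r \<oplus>\<^bsub>R\<^esub> s) = \<delta> x \<chi> r * \<delta> x \<chi> s"
        using V(2)[of \<chi> "r \<odot>\<^bsub>P\<^esub> x" "s \<odot>\<^bsub>P\<^esub> x"] r s x by (simp add: \<delta>_def P.smult_l_distr)
    qed (simp add: \<delta>_def)
    fix y assume y: "y \<in> carrier P"
    show "\<delta> (x \<oplus>\<^bsub>P\<^esub> y) = \<delta> x \<oplus>\<^bsub>?C\<^esub> \<delta> y"
    proof (intro ext)
      fix \<chi> r
      show "\<delta> (x \<oplus>\<^bsub>P\<^esub> y) \<chi> r = (\<delta> x \<oplus>\<^bsub>?C\<^esub> \<delta> y) \<chi> r"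
        using V(2)[of \<chi> "r \<odot>\<^bsub>P\<^esub> x" "r \<odot>\<^bsub>P\<^esub> y"] x y
        by (simp add: \<delta>_def char_module_simps P.smult_r_distr)
    qed
  next
    fix s x assume "s \<in> carrier R" "x \<in> carrier P"
    then show "\<delta> (s \<odot>\<^bsub>P\<^esub> x) = s \<odot>\<^bsub>?C\<^esub> \<delta> x"
      by (intro ext) (simp add: \<delta>_def char_module_simps P.smult_assoc1[symmetric] P.R.m_comm)
  qed
  moreover have "x \<in> H \<longleftrightarrow> \<delta> x = \<zero>\<^bsub>?C\<^esub>" if x: "x \<in> carrier P" for x
  proof
    assume "x \<in> H"
    then show "\<delta> x = \<zero>\<^bsub>?C\<^esub>"
      using HD(4)[of _ x] by (intro ext) (simp add: \<delta>_def char_module_simps V_def)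
  next
    assume d: "\<delta> x = \<zero>\<^bsub>?C\<^esub>"
    show "x \<in> H"
    proof (rule ccontr)
      assume "x \<notin> H"
      obtain \<chi> where "additive_character P \<chi>" "\<And>h. h \<in> H \<Longrightarrow> \<chi> h = 1" and q: "\<chi> x \<noteq> 1"
        by (rule character_separation[OF P.abelian_group_axioms submodule.axioms(1)[OF assms(2)] x \<open>x \<notin> H\<close>]) simp
      then have "\<chi> \<in> V" by (simp add: V_def)
      then have "\<delta> x \<chi> \<one>\<^bsub>R\<^esub> = \<chi> x" using x by (simp add: \<delta>_def)
      then show False using q d by (simp add: char_module_simps)
    qed
  qed
  ultimately have "module_kernel P ?C \<delta> = H"
    using HD(1) by (auto simp: module_kernel_def)
  then show ?thesis using that hom by blast
qed


section \<open>Small injective modules\<close>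

text \<open>A chosen common solution of the equations \<open>a x = e\<close> with \<open>(a, e)\<close> in the list \<open>l\<close>.\<close>

definition common_solution :: "('a, 'e) module \<Rightarrow> ('a \<times> 'e) list \<Rightarrow> 'e" where
  "common_solution E l = (SOME x. x \<in> carrier E \<and> (\<forall>(a, e)\<in>set l. a \<odot>\<^bsub>E\<^esub> x = e))"

text \<open>A stack machine with values in \<open>E\<close>. Its instructions push the element \<open>\<beta> q\<close>, label the top
  element with a ring element, add the two topmost elements, multiply the top element with its
  label, or replace the \<open>n - 2\<close> topmost labelled elements, read as a system of equations, by a common
  solution. The labels of results are irrelevant.\<close>

definition machine_step ::
  "('a, 'e) module \<Rightarrow> ('b \<Rightarrow> 'e) \<Rightarrow> ('a \<times> 'e) list \<Rightarrow> 'a + 'b + nat \<Rightarrow> ('a \<times> 'e) list" where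
  "machine_step E \<beta> s t = (case t of
     Inl a \<Rightarrow> (a, snd (hd s)) # tl s
   | Inr (Inl q) \<Rightarrow> (undefined, \<beta> q) # s
   | Inr (Inr n) \<Rightarrow>
       if n = 0 then (undefined, snd (hd s) \<oplus>\<^bsub>E\<^esub> snd (hd (tl s))) # tl (tl s)
       else if n = 1 then (undefined, fst (hd s) \<odot>\<^bsub>E\<^esub> snd (hd s)) # tl s
       else (undefined, common_solution E (take (n - 2) s)) # drop (n - 2) s)"

text \<open>Started on any stack \<open>s\<close>, the program \<open>p\<close> pushes \<open>x\<close>, with some label, and leaves \<open>s\<close> unchanged
  below it.\<close>

definition computes :: "('a, 'e) module \<Rightarrow> ('b \<Rightarrow> 'e) \<Rightarrow> ('a + 'b + nat) list \<Rightarrow> 'e \<Rightarrow> bool" where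
  "computes E \<beta> p x \<longleftrightarrow> (\<forall>s. \<exists>a. foldl (machine_step E \<beta>) s p = (a, x) # s)"

text \<open>The closure of the image of \<open>\<beta>\<close> under the module operations and the choice of solutions.\<close>

definition skolem_hull :: "('a, 'e) module \<Rightarrow> ('b \<Rightarrow> 'e) \<Rightarrow> 'e set" where
  "skolem_hull E \<beta> = {x \<in> carrier E. \<exists>p. computes E \<beta> p x}"

lemma computes_unique: "computes E \<beta> p x \<Longrightarrow> computes E \<beta> p y \<Longrightarrow> x = y"
  unfolding computes_def by (metis list.inject prod.inject)

lemma computes_label:
  assumes "computes E \<beta> p x"
  shows "foldl (machine_step E \<beta>) s (p @ [Inl a]) = (a, x) # s"
proof -
  obtain b where "foldl (machine_step E \<beta>) s p = (b, x) # s"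
    using assms unfolding computes_def by blast
  then show ?thesis by (simp add: machine_step_def)
qed

lemma computes_base: "computes E \<beta> [Inr (Inl q)] (\<beta> q)"
  by (simp add: computes_def machine_step_def)

lemma computes_add:
  assumes "computes E \<beta> p x" "computes E \<beta> q y"
  shows "computes E \<beta> (q @ p @ [Inr (Inr 0)]) (x \<oplus>\<^bsub>E\<^esub> y)"
  unfolding computes_def
proof
  fix s
  obtain b where b: "foldl (machine_step E \<beta>) s q = (b, y) # s" using assms(2) computes_def by metis
  obtain a where a: "foldl (machine_step E \<beta>) ((b, y) # s) p = (a, x) # (b, y) # s"
    using assms(1) computes_def by metis
  show "\<exists>a. foldl (machine_step E \<beta>) s (q @ p @ [Inr (Inr 0)]) = (a, x \<oplus>\<^bsub>E\<^esub> y) # s"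
    by (simp add: a b machine_step_def)
qed

lemma computes_smult:
  assumes "computes E \<beta> p x"
  shows "computes E \<beta> ((p @ [Inl a]) @ [Inr (Inr 1)]) (a \<odot>\<^bsub>E\<^esub> x)"
  unfolding computes_def foldl_append[of _ _ "p @ [Inl a]"] computes_label[OF assms]
  by (simp add: machine_step_def)

lemma computes_list:
  assumes "\<And>a x. (a, x) \<in> set l \<Longrightarrow> \<exists>p. computes E \<beta> p x"
  shows "\<exists>p. \<forall>s. foldl (machine_step E \<beta>) s p = l @ s"
  using assms
proof (induction l)
  case Nil
  then show ?case by (intro exI[of _ "[]"]) simp
next
  case (Cons ax l)
  obtain a x where ax: "ax = (a, x)" by (cases ax)
  obtain p where p: "computes E \<beta> p x" using Cons.prems[of a x] ax by auto
  obtain q where q: "\<And>s. foldl (machine_step E \<beta>) s q = l @ s"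
    using Cons.IH Cons.prems by (metis list.set_intros(2))
  have "foldl (machine_step E \<beta>) s (q @ (p @ [Inl a])) = (ax # l) @ s" for s
    unfolding foldl_append[of _ _ q] q computes_label[OF p] ax by simp
  then show ?case by blast
qed

lemma computes_solution:
  assumes "\<And>a x. (a, x) \<in> set l \<Longrightarrow> \<exists>p. computes E \<beta> p x"
  shows "\<exists>p. computes E \<beta> p (common_solution E l)"
proof -
  have "\<exists>p. \<forall>s. foldl (machine_step E \<beta>) s p = l @ s"
    by (rule computes_list) (rule assms)
  then obtain p where p: "\<forall>s. foldl (machine_step E \<beta>) s p = l @ s" by (elim exE)
  have "computes E \<beta> (p @ [Inr (Inr (length l + 2))]) (common_solution E l)"
    unfolding computes_def foldl_append p[rule_format] by (simp add: machine_step_def)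
  then show ?thesis by blast
qed

lemma submodule_skolem_hull:
  assumes "module R E" "module R P" "\<beta> \<in> module_hom R P E"
  shows "submodule (skolem_hull E \<beta>) R E" "\<beta> ` carrier P \<subseteq> skolem_hull E \<beta>"
proof -
  interpret E: module R E by fact
  interpret P: module R P by fact
  show im: "\<beta> ` carrier P \<subseteq> skolem_hull E \<beta>"
    using module_homD(1)[OF assms(3)] computes_base[of E \<beta>] by (auto simp: skolem_hull_def)
  have "\<zero>\<^bsub>E\<^esub> \<in> skolem_hull E \<beta>" using im module_hom_zero[OF assms(2,1,3)] P.zero_closed by (metis image_subset_iff)
  moreover have "x \<oplus>\<^bsub>E\<^esub> y \<in> skolem_hull E \<beta>" if "x \<in> skolem_hull E \<beta>" "y \<in> skolem_hull E \<beta>" for x y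
    using that computes_add[of E \<beta> _ x _ y] unfolding skolem_hull_def by blast
  moreover have "a \<odot>\<^bsub>E\<^esub> x \<in> skolem_hull E \<beta>" if "a \<in> carrier R" "x \<in> skolem_hull E \<beta>" for a x
    using that computes_smult[of E \<beta> _ x a] unfolding skolem_hull_def by blast
  ultimately show "submodule (skolem_hull E \<beta>) R E"
    unfolding E.submodule_iff by (auto simp: skolem_hull_def)
qed

text \<open>Ideals are finitely generated, so an extension problem for an ideal amounts to finitely many
  equations, and the hull contains a solution.\<close>

lemma baer_skolem_hull:
  assumes "noetherian_ring R" "module R E" "baer_module R E" "module R P" "\<beta> \<in> module_hom R P E"
  shows "baer_module R (E\<lparr>carrier := skolem_hull E \<beta>\<rparr>)"
  unfolding baer_module_def
proof (intro allI impI, elim conjE)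
  interpret E: module R E by fact
  let ?A = "skolem_hull E \<beta>"
  fix I f
  assume I: "ideal I R" and fc: "f \<in> I \<rightarrow> carrier (E\<lparr>carrier := ?A\<rparr>)"
    and fa: "\<forall>a\<in>I. \<forall>b\<in>I. f (a \<oplus>\<^bsub>R\<^esub> b) = f a \<oplus>\<^bsub>E\<lparr>carrier := ?A\<rparr>\<^esub> f b"
    and fs: "\<forall>r\<in>carrier R. \<forall>a\<in>I. f (r \<otimes>\<^bsub>R\<^esub> a) = r \<odot>\<^bsub>E\<lparr>carrier := ?A\<rparr>\<^esub> f a"
  interpret I: ideal I R by fact
  have fA: "f a \<in> ?A" if "a \<in> I" for a using fc that by auto
  have fE: "f a \<in> carrier E" if "a \<in> I" for a using fA[OF that] by (simp add: skolem_hull_def)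
  obtain e where e: "e \<in> carrier E" "\<And>a. a \<in> I \<Longrightarrow> f a = a \<odot>\<^bsub>E\<^esub> e"
    by (rule baer_moduleD[OF assms(3) I, of f]) (use fE fa fs in auto)
  obtain G where G: "G \<subseteq> carrier R" "finite G" "I = Idl\<^bsub>R\<^esub> G"
    using noetherian_ring.finetely_gen[OF assms(1) I] by blast
  have GI: "G \<subseteq> I" using E.R.genideal_self[OF G(1)] G(3) by simp
  obtain gs where gs: "set gs = G" using finite_list[OF G(2)] by blast
  define l where "l = map (\<lambda>a. (a, f a)) gs"
  define x where "x = common_solution E l"
  have "x \<in> carrier E \<and> (\<forall>(a, e)\<in>set l. a \<odot>\<^bsub>E\<^esub> x = e)"
    unfolding x_def common_solution_def
  proof (rule someI[of _ e])
    show "e \<in> carrier E \<and> (\<forall>(a, y)\<in>set l. a \<odot>\<^bsub>E\<^esub> e = y)"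
      using e GI gs by (auto simp: l_def)
  qed
  then have x: "x \<in> carrier E" "\<And>a. a \<in> G \<Longrightarrow> a \<odot>\<^bsub>E\<^esub> x = f a" using gs by (auto simp: l_def)
  have "\<exists>p. computes E \<beta> p x"
    unfolding x_def
  proof (rule computes_solution)
    fix a y assume "(a, y) \<in> set l"
    then have "y = f a" "a \<in> I" using gs GI by (auto simp: l_def)
    then show "\<exists>p. computes E \<beta> p y" using fA[of a] by (simp add: skolem_hull_def)
  qed
  then have xA: "x \<in> ?A" using x(1) by (simp add: skolem_hull_def)
  \<comment> \<open>The elements at which \<open>x\<close> is right form an ideal that contains the generators of \<open>I\<close>.\<close>
  define K where "K = {r \<in> I. f r = r \<odot>\<^bsub>E\<^esub> x}"
  have "submodule K R (ring_module R)"
    unfolding module.submodule_iff[OF module_ring_module[OF E.R.is_cring]]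
  proof (intro conjI ballI)
    show "K \<subseteq> carrier (ring_module R)" using I.Icarr by (auto simp: K_def)
    have "f \<zero>\<^bsub>R\<^esub> = \<zero>\<^bsub>E\<^esub>" using e(2)[of "\<zero>\<^bsub>R\<^esub>"] e(1) by simp
    then show "\<zero>\<^bsub>ring_module R\<^esub> \<in> K" using x(1) by (simp add: K_def)
  next
    fix a b assume "a \<in> K" "b \<in> K"
    then show "a \<oplus>\<^bsub>ring_module R\<^esub> b \<in> K" using fa x(1) I.Icarr by (simp add: K_def E.smult_l_distr)
  next
    fix r a assume "r \<in> carrier R" "a \<in> K"
    then show "r \<odot>\<^bsub>ring_module R\<^esub> a \<in> K" using fs x(1) I.Icarr I.I_l_closed by (simp add: K_def E.smult_assoc1)
  qed
  then have "ideal K R" by (simp add: submodule_ring_module_iff E.R.is_cring)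
  moreover have "G \<subseteq> K" using GI x(2) by (auto simp: K_def)
  ultimately have "I \<subseteq> K" unfolding G(3) by (rule E.R.genideal_minimal)
  then have "\<forall>a\<in>I. f a = a \<odot>\<^bsub>E\<lparr>carrier := ?A\<rparr>\<^esub> x" by (auto simp: K_def)
  then show "\<exists>e\<in>carrier (E\<lparr>carrier := ?A\<rparr>). \<forall>a\<in>I. f a = a \<odot>\<^bsub>E\<lparr>carrier := ?A\<rparr>\<^esub> e"
    using xA by (intro bexI[of _ x]) simp_all
qed

lemma baer_transport:
  assumes "module R M" "baer_module R M" "inj_on j (carrier M)"
  shows "baer_module R (transport_module j M)"
  unfolding baer_module_def
proof (intro allI impI, elim conjE)
  interpret M: module R M by fact
  note T = transport_module_simps[OF assms(3)]
  let ?T = "transport_module j M" and ?k = "inv_into (carrier M) j"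
  fix I f
  assume I: "ideal I R" and fc: "f \<in> I \<rightarrow> carrier ?T"
    and fa: "\<forall>a\<in>I. \<forall>b\<in>I. f (a \<oplus>\<^bsub>R\<^esub> b) = f a \<oplus>\<^bsub>?T\<^esub> f b"
    and fs: "\<forall>r\<in>carrier R. \<forall>a\<in>I. f (r \<otimes>\<^bsub>R\<^esub> a) = r \<odot>\<^bsub>?T\<^esub> f a"
  have kM: "?k (f a) \<in> carrier M" and jk: "j (?k (f a)) = f a" if "a \<in> I" for a
    using fc that by (auto simp: T(1) Pi_def intro!: inv_into_into f_inv_into_f)
  have kj: "?k (j x) = x" if "x \<in> carrier M" for x using inv_into_f_f[OF assms(3) that] .
  obtain e where e: "e \<in> carrier M" "\<And>a. a \<in> I \<Longrightarrow> ?k (f a) = a \<odot>\<^bsub>M\<^esub> e"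
  proof (rule baer_moduleD[OF assms(2) I, of "\<lambda>a. ?k (f a)"])
    show "?k (f a) \<in> carrier M" if "a \<in> I" for a using kM[OF that] .
    show "?k (f (a \<oplus>\<^bsub>R\<^esub> b)) = ?k (f a) \<oplus>\<^bsub>M\<^esub> ?k (f b)" if "a \<in> I" "b \<in> I" for a b
      using fa that T(3)[OF kM[OF that(1)] kM[OF that(2)]] by (simp add: jk kj kM)
    show "?k (f (r \<otimes>\<^bsub>R\<^esub> a)) = r \<odot>\<^bsub>M\<^esub> ?k (f a)" if "r \<in> carrier R" "a \<in> I" for r a
      using fs that T(4)[OF kM[OF that(2)], of r] by (simp add: jk kj kM)
  qed auto
  have "f a = a \<odot>\<^bsub>?T\<^esub> j e" if "a \<in> I" for a
    using e(2)[OF that] jk[OF that] T(4)[OF e(1)] by metis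
  then show "\<exists>e\<in>carrier ?T. \<forall>a\<in>I. f a = a \<odot>\<^bsub>?T\<^esub> e"
    using e(1) by (intro bexI[of _ "j e"]) (simp_all add: T(1))
qed

text \<open>Sending every element of the hull to a program that computes it embeds the hull into the
  type of programs.\<close>

lemma injective_embedding:
  fixes P :: "('a, 'b) module" and j :: "('a + 'b + nat) list \<Rightarrow> 't"
  assumes "noetherian_ring R" "module R P" "submodule H R P" "inj j"
  obtains E :: "('a, 't) module" and \<delta> where "injective_module R E" "\<delta> \<in> module_hom R P E"
    "module_kernel P E \<delta> = H"
proof -
  interpret P: module R P by fact
  let ?C = "char_module R :: ('a, ('b \<Rightarrow> complex) \<Rightarrow> 'a \<Rightarrow> complex) module"
  have C: "module R ?C" "baer_module R ?C"
    using module_char_module baer_char_module P.R.is_cring by blast+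
  obtain \<beta> :: "'b \<Rightarrow> ('b \<Rightarrow> complex) \<Rightarrow> 'a \<Rightarrow> complex"
    where \<beta>: "\<beta> \<in> module_hom R P ?C" "module_kernel P ?C \<beta> = H"
    by (rule char_module_embedding[OF assms(2,3)])
  let ?A = "skolem_hull ?C \<beta>"
  let ?D = "?C\<lparr>carrier := ?A\<rparr>"
  note A = submodule_skolem_hull[OF C(1) assms(2) \<beta>(1)]
  have D: "module R ?D" by (rule submodule.submodule_is_module[OF A(1) C(1)])
  define k where "k x = j (SOME p. computes ?C \<beta> p x)" for x
  have "inj_on k ?A"
  proof (rule inj_onI)
    fix x y assume xy: "x \<in> ?A" "y \<in> ?A" "k x = k y"
    have "(SOME p. computes ?C \<beta> p x) = (SOME p. computes ?C \<beta> p y)"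
      using xy(3) assms(4) by (simp add: k_def inj_eq)
    moreover have "computes ?C \<beta> (SOME p. computes ?C \<beta> p x) x" "computes ?C \<beta> (SOME p. computes ?C \<beta> p y) y"
      using xy(1,2) by (auto simp: skolem_hull_def intro: someI)
    ultimately show "x = y" using computes_unique by metis
  qed
  then have k: "inj_on k (carrier ?D)" by simp
  let ?E = "transport_module k ?D"
  note T = transport_module_simps[OF k]
  have "module R ?E" by (rule module_transport[OF D k])
  moreover have "baer_module R ?E"
    by (rule baer_transport[OF D baer_skolem_hull[OF assms(1) C assms(2) \<beta>(1)] k])
  ultimately have "injective_module R ?E" by (rule injective_module_baer)
  moreover have \<beta>A: "\<beta> x \<in> ?A" if "x \<in> carrier P" for x using A(2) that by auto
  have "(\<lambda>x. k (\<beta> x)) \<in> module_hom R P ?E"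
  proof (rule module_homI)
    fix x assume x: "x \<in> carrier P"
    show "k (\<beta> x) \<in> carrier ?E" using \<beta>A[OF x] by (simp add: T(1))
    show "k (\<beta> (x \<oplus>\<^bsub>P\<^esub> y)) = k (\<beta> x) \<oplus>\<^bsub>?E\<^esub> k (\<beta> y)" if y: "y \<in> carrier P" for y
      using T(3)[of "\<beta> x" "\<beta> y"] \<beta>A[OF x] \<beta>A[OF y] module_homD(2)[OF \<beta>(1) x y] by simp
    show "k (\<beta> (r \<odot>\<^bsub>P\<^esub> x)) = r \<odot>\<^bsub>?E\<^esub> k (\<beta> x)" if "r \<in> carrier R" for r
      using T(4)[of "\<beta> x" r] \<beta>A[OF x] module_homD(3)[OF \<beta>(1) that x] by simp
  qed
  moreover have "module_kernel P ?E (\<lambda>x. k (\<beta> x)) = H"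
  proof -
    have "k (\<beta> x) = \<zero>\<^bsub>?E\<^esub> \<longleftrightarrow> \<beta> x = \<zero>\<^bsub>?C\<^esub>" if "x \<in> carrier P" for x
      using inj_on_eq_iff[OF k, of "\<beta> x" "\<zero>\<^bsub>?C\<^esub>"] \<beta>A[OF that] submoduleD(2)[OF A(1) C(1)] by (simp add: T(2))
    then have "module_kernel P ?E (\<lambda>x. k (\<beta> x)) = module_kernel P ?C \<beta>"
      unfolding module_kernel_def by (intro Collect_cong conj_cong) simp_all
    then show ?thesis using \<beta>(2) by simp
  qed
  ultimately show ?thesis using that by blast
qed


section \<open>Injective resolutions\<close>

text \<open>Programs over the resolution universe are elements of the universe again, by length prefixes.\<close>

fun recode_token :: "'a + ('a + 'b + nat) list + nat \<Rightarrow> ('a + 'b + nat) list" where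
  "recode_token (Inl a) = [Inl a]"
| "recode_token (Inr (Inl l)) = Inr (Inr 0) # l"
| "recode_token (Inr (Inr n)) = [Inr (Inr (Suc n))]"

definition recode :: "('a + ('a + 'b + nat) list + nat) list \<Rightarrow> ('a + 'b + nat) list" where
  "recode ts = concat (map (\<lambda>t. Inr (Inr (length (recode_token t))) # recode_token t) ts)"

lemma recode_token_inj: "recode_token s = recode_token t \<Longrightarrow> s = t"
  by (cases s rule: recode_token.cases; cases t rule: recode_token.cases) auto

lemma inj_recode: "inj recode"
proof (rule injI)
  fix ts us :: "('a + ('a + 'b + nat) list + nat) list"
  assume "recode ts = recode us"
  then show "ts = us"
  proof (induction ts arbitrary: us)
    case Nil
    then show ?case by (cases us) (auto simp: recode_def)
  next
    case (Cons t ts)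
    then obtain u us' where us: "us = u # us'" by (cases us) (auto simp: recode_def)
    then have "length (recode_token t) = length (recode_token u)"
      and "recode_token t @ recode ts = recode_token u @ recode us'"
      using Cons.prems by (auto simp: recode_def)
    then have "recode_token t = recode_token u" "recode ts = recode us'" by simp_all
    then show ?case using Cons.IH recode_token_inj us by blast
  qed
qed

text \<open>Each module is embedded modulo the image \<open>K n\<close> of the previous differential into the next one.\<close>

lemma injective_resolution_exists:
  fixes Q :: "('a, 'b) module"
  assumes "noetherian_ring R" "module R Q"
  shows "\<exists>\<epsilon> (E :: nat \<Rightarrow> ('a, ('a, 'b) resolution_universe) module) \<delta>. injective_resolution R Q \<epsilon> E \<delta>"
proof -
  interpret Q: module R Q by fact
  have "submodule {\<zero>\<^bsub>Q\<^esub>} R Q" unfolding Q.submodule_iff by simp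
  then obtain E0 :: "('a, ('a, 'b) resolution_universe) module" and \<epsilon>
    where E0: "injective_module R E0" "\<epsilon> \<in> module_hom R Q E0" "module_kernel Q E0 \<epsilon> = {\<zero>\<^bsub>Q\<^esub>}"
    by (rule injective_embedding[OF assms, of _ id]) simp
  have mod: "module R E" if "injective_module R E" for E :: "('a, ('a, 'b) resolution_universe) module"
    using that by (simp add: injective_module_def)
  interpret E0: module R E0 by (rule mod[OF E0(1)])
  have inj: "inj_on \<epsilon> (carrier Q)"
  proof (rule inj_onI)
    fix x y assume xy: "x \<in> carrier Q" "y \<in> carrier Q" "\<epsilon> x = \<epsilon> y"
    have "\<epsilon> (x \<ominus>\<^bsub>Q\<^esub> y) = \<epsilon> y \<ominus>\<^bsub>E0\<^esub> \<epsilon> y"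
      using module_hom_minus[OF assms(2) mod[OF E0(1)] E0(2) xy(1,2)] xy(3) by simp
    also have "\<dots> = \<zero>\<^bsub>E0\<^esub>" using E0.minus_eq_zero_iff module_homD(1)[OF E0(2) xy(2)] by blast
    finally have "x \<ominus>\<^bsub>Q\<^esub> y \<in> module_kernel Q E0 \<epsilon>" using xy by (simp add: module_kernel_def)
    then show "x = y" using E0(3) Q.minus_eq_zero_iff xy by blast
  qed
  define P where "P n x \<longleftrightarrow> injective_module R (fst x) \<and> submodule (snd x) R (fst x) \<and>
      (n = 0 \<longrightarrow> fst x = E0 \<and> snd x = \<epsilon> ` carrier Q)"
    for n :: nat and x :: "('a, ('a, 'b) resolution_universe) module \<times> ('a, 'b) resolution_universe set"
  define S where "S n x y \<longleftrightarrow> (\<exists>\<delta>\<in>module_hom R (fst x) (fst y).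
      module_kernel (fst x) (fst y) \<delta> = snd x \<and> snd y = \<delta> ` carrier (fst x))"
    for n :: nat and x y :: "('a, ('a, 'b) resolution_universe) module \<times> ('a, 'b) resolution_universe set"
  have "\<exists>f. \<forall>n. P n (f n) \<and> S n (f n) (f (Suc n))"
  proof (rule dependent_nat_choice)
    have "submodule (\<epsilon> ` carrier Q) R E0"
      by (rule submodule_image[OF assms(2) mod[OF E0(1)] E0(2) Q.carrier_is_submodule])
    then have "P 0 (E0, \<epsilon> ` carrier Q)" using E0(1) by (simp add: P_def)
    then show "\<exists>x. P 0 x" by (rule exI)
  next
    fix x n assume Px: "P n x"
    have E: "injective_module R (fst x)" "submodule (snd x) R (fst x)" using Px by (simp_all add: P_def)
    obtain E' :: "('a, ('a, 'b) resolution_universe) module" and \<delta>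
      where E': "injective_module R E'" "\<delta> \<in> module_hom R (fst x) E'" "module_kernel (fst x) E' \<delta> = snd x"
      by (rule injective_embedding[OF assms(1) mod[OF E(1)] E(2) inj_recode])
    let ?y = "(E', \<delta> ` carrier (fst x))"
    have "submodule (\<delta> ` carrier (fst x)) R E'"
      by (rule submodule_image[OF mod[OF E(1)] mod[OF E'(1)] E'(2) module.carrier_is_submodule[OF mod[OF E(1)]]])
    then have "P (Suc n) ?y" using E'(1) by (simp add: P_def)
    moreover have "S n x ?y" unfolding S_def using E'(2,3) by (intro bexI[of _ \<delta>]) simp_all
    ultimately show "\<exists>y. P (Suc n) y \<and> S n x y" by (intro exI[of _ ?y] conjI)
  qed
  then obtain f where f: "\<forall>n. P n (f n) \<and> S n (f n) (f (Suc n))" by (elim exE)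
  define E where "E n = fst (f n)" for n
  define K where "K n = snd (f n)" for n
  have P: "injective_module R (E n)" for n using f by (simp add: P_def E_def)
  have P0: "E 0 = E0" "K 0 = \<epsilon> ` carrier Q" using f[rule_format, of 0] by (simp_all add: P_def E_def K_def)
  have "\<forall>n. \<exists>\<delta>. \<delta> \<in> module_hom R (E n) (E (Suc n)) \<and>
      module_kernel (E n) (E (Suc n)) \<delta> = K n \<and> K (Suc n) = \<delta> ` carrier (E n)"
    using f unfolding S_def E_def K_def by blast
  then obtain \<delta> where \<delta>': "\<forall>n. \<delta> n \<in> module_hom R (E n) (E (Suc n)) \<and>
      module_kernel (E n) (E (Suc n)) (\<delta> n) = K n \<and> K (Suc n) = \<delta> n ` carrier (E n)"
    by (elim choice[THEN exE])
  have \<delta>: "\<delta> n \<in> module_hom R (E n) (E (Suc n))"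
    "module_kernel (E n) (E (Suc n)) (\<delta> n) = K n" "K (Suc n) = \<delta> n ` carrier (E n)" for n
    using \<delta>' by simp_all
  have "injective_resolution R Q \<epsilon> E \<delta>"
    unfolding injective_resolution_def
  proof (intro conjI allI)
    show "injective_module R (E n)" for n by (rule P)
    show "\<delta> n \<in> module_hom R (E n) (E (Suc n))" for n by (rule \<delta>(1))
    show "\<epsilon> \<in> module_hom R Q (E 0)" using E0(2) P0(1) by simp
    show "\<epsilon> ` carrier Q = module_kernel (E 0) (E (Suc 0)) (\<delta> 0)" using \<delta>(2)[of 0] P0(2) by simp
    show "\<delta> n ` carrier (E n) = module_kernel (E (Suc n)) (E (Suc (Suc n))) (\<delta> (Suc n))" for n
      using \<delta>(2)[of "Suc n"] \<delta>(3)[of n] by simp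
  qed (rule inj)
  then show ?thesis by blast
qed


section \<open>Powers of ideals and torsion\<close>

lemma ideal_power_ideal:
  assumes "cring R" "ideal J R"
  shows "ideal (J [^]\<^bsub>ideals_set R\<^esub> (n::nat)) R"
proof -
  interpret cring R by fact
  show ?thesis
    by (induction n) (use assms(2) in \<open>simp_all add: ideals_set_def oneideal ideal_prod_is_ideal\<close>)
qed

lemma ideal_power_0: "J [^]\<^bsub>ideals_set R\<^esub> (0::nat) = carrier R"
  by (simp add: ideals_set_def)

lemma ideal_power_Suc: "J [^]\<^bsub>ideals_set R\<^esub> (Suc n) = (J [^]\<^bsub>ideals_set R\<^esub> n) \<cdot>\<^bsub>R\<^esub> J"
  by (simp add: ideals_set_def)

lemma ideal_power_1:
  assumes "cring R" "ideal J R"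
  shows "J [^]\<^bsub>ideals_set R\<^esub> (1::nat) = J"
proof -
  interpret cring R by fact
  have "J [^]\<^bsub>ideals_set R\<^esub> (1::nat) = carrier R \<cdot>\<^bsub>R\<^esub> J"
    unfolding One_nat_def ideal_power_Suc ideal_power_0 ..
  also have "\<dots> = J \<cdot>\<^bsub>R\<^esub> carrier R" using assms(2) oneideal by (rule ideal_prod_commute[symmetric])
  also have "\<dots> = J" using assms(2) by (rule ideal_prod_one)
  finally show ?thesis .
qed

lemma ideal_power_antimono:
  assumes "cring R" "ideal J R" "n \<le> k"
  shows "J [^]\<^bsub>ideals_set R\<^esub> (k::nat) \<subseteq> J [^]\<^bsub>ideals_set R\<^esub> n"
  using assms(3)
proof (induction rule: dec_induct)
  case (step k)
  interpret cring R by fact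
  show ?case
    using step.IH ideal_prod_inter[OF ideal_power_ideal[OF assms(1,2), of k] assms(2)]
    unfolding ideal_power_Suc by blast
qed simp

lemma element_power_in_ideal_power:
  assumes "cring R" "a \<in> J"
  shows "a [^]\<^bsub>R\<^esub> (n::nat) \<in> J [^]\<^bsub>ideals_set R\<^esub> n"
proof (induction n)
  case 0
  interpret cring R by fact
  show ?case unfolding ideal_power_0 by simp
next
  case (Suc n)
  then show ?case unfolding ideal_power_Suc using ideal_prod.prod[OF _ assms(2)] by simp
qed

lemma torsion_partI:
  "x \<in> carrier Q \<Longrightarrow> (\<And>a. a \<in> J [^]\<^bsub>ideals_set R\<^esub> (n::nat) \<Longrightarrow> a \<odot>\<^bsub>Q\<^esub> x = \<zero>\<^bsub>Q\<^esub>) \<Longrightarrow> x \<in> torsion_part R J Q"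
  by (auto simp: torsion_part_def)

lemma torsion_partE:
  assumes "x \<in> torsion_part R J Q"
  obtains n :: nat where "x \<in> carrier Q" "\<forall>a\<in>J [^]\<^bsub>ideals_set R\<^esub> n. a \<odot>\<^bsub>Q\<^esub> x = \<zero>\<^bsub>Q\<^esub>"
  using assms by (auto simp: torsion_part_def)

lemma submodule_torsion_part:
  assumes "module R Q" "ideal J R"
  shows "submodule (torsion_part R J Q) R Q"
proof -
  interpret Q: module R Q by fact
  note ip = ideal_power_ideal[OF Q.R.is_cring assms(2)]
  have c: "a \<in> carrier R" if "a \<in> J [^]\<^bsub>ideals_set R\<^esub> n" for a and n :: nat
    using ideal.Icarr[OF ip that] .
  show ?thesis
    unfolding Q.submodule_iff
  proof (intro conjI ballI)
    show "torsion_part R J Q \<subseteq> carrier Q" by (auto simp: torsion_part_def)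
    show "\<zero>\<^bsub>Q\<^esub> \<in> torsion_part R J Q" by (rule torsion_partI[of _ _ _ _ 0]) (simp_all add: ideal_power_0 del: nat_pow_0)
  next
    fix x y assume "x \<in> torsion_part R J Q" "y \<in> torsion_part R J Q"
    then obtain n k :: nat where x: "x \<in> carrier Q" "\<forall>a\<in>J [^]\<^bsub>ideals_set R\<^esub> n. a \<odot>\<^bsub>Q\<^esub> x = \<zero>\<^bsub>Q\<^esub>"
      and y: "y \<in> carrier Q" "\<forall>a\<in>J [^]\<^bsub>ideals_set R\<^esub> k. a \<odot>\<^bsub>Q\<^esub> y = \<zero>\<^bsub>Q\<^esub>"
      by (elim torsion_partE) blast
    show "x \<oplus>\<^bsub>Q\<^esub> y \<in> torsion_part R J Q"
    proof (rule torsion_partI[of _ _ _ _ "max n k"])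
      fix a assume a: "a \<in> J [^]\<^bsub>ideals_set R\<^esub> (max n k)"
      have "a \<in> J [^]\<^bsub>ideals_set R\<^esub> n" "a \<in> J [^]\<^bsub>ideals_set R\<^esub> k"
        using a ideal_power_antimono[OF Q.R.is_cring assms(2) max.cobounded1[of n k]]
          ideal_power_antimono[OF Q.R.is_cring assms(2) max.cobounded2[of k n]] by auto
      then show "a \<odot>\<^bsub>Q\<^esub> (x \<oplus>\<^bsub>Q\<^esub> y) = \<zero>\<^bsub>Q\<^esub>" using x y c[OF a] by (simp add: Q.smult_r_distr)
    qed (use x y in auto)
  next
    fix r x assume r: "r \<in> carrier R" and "x \<in> torsion_part R J Q"
    then obtain n :: nat where x: "x \<in> carrier Q" "\<forall>a\<in>J [^]\<^bsub>ideals_set R\<^esub> n. a \<odot>\<^bsub>Q\<^esub> x = \<zero>\<^bsub>Q\<^esub>"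
      by (elim torsion_partE) blast
    show "r \<odot>\<^bsub>Q\<^esub> x \<in> torsion_part R J Q"
    proof (rule torsion_partI[of _ _ _ _ n])
      fix a assume a: "a \<in> J [^]\<^bsub>ideals_set R\<^esub> n"
      have "a \<odot>\<^bsub>Q\<^esub> (r \<odot>\<^bsub>Q\<^esub> x) = (a \<otimes>\<^bsub>R\<^esub> r) \<odot>\<^bsub>Q\<^esub> x" using c[OF a] r x(1) by (simp add: Q.smult_assoc1)
      also have "\<dots> = \<zero>\<^bsub>Q\<^esub>" using ideal.I_r_closed[OF ip a r] x(2) by blast
      finally show "a \<odot>\<^bsub>Q\<^esub> (r \<odot>\<^bsub>Q\<^esub> x) = \<zero>\<^bsub>Q\<^esub>" .
    qed (use r x(1) in auto)
  qed
qed


section \<open>Local cohomology in degrees zero and one\<close>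

text \<open>The easy direction of Baer's criterion: a copy of the ring serves as test module.\<close>

lemma baer_injective_module:
  fixes E :: "('a, 'e) module" and j :: "'a \<Rightarrow> 'e"
  assumes "injective_module R E" "cring R" "inj j"
  shows "baer_module R E"
  unfolding baer_module_def
proof (intro allI impI, elim conjE)
  fix I f
  assume I: "ideal I R" and fc: "f \<in> I \<rightarrow> carrier E"
    and fa: "\<forall>a\<in>I. \<forall>b\<in>I. f (a \<oplus>\<^bsub>R\<^esub> b) = f a \<oplus>\<^bsub>E\<^esub> f b"
    and fs: "\<forall>r\<in>carrier R. \<forall>a\<in>I. f (r \<otimes>\<^bsub>R\<^esub> a) = r \<odot>\<^bsub>E\<^esub> f a"
  interpret I: ideal I R by fact
  interpret R: cring R by fact
  have jin: "inj_on j (carrier (ring_module R))" using assms(3) by (rule inj_on_subset) simp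
  let ?B = "transport_module j (ring_module R)"
  have B: "module R ?B" by (rule module_transport[OF module_ring_module[OF assms(2)] jin])
  note T = transport_module_simps[OF jin, simplified]
  have sub: "submodule (j ` I) R ?B"
    unfolding module.submodule_iff[OF B]
  proof (intro conjI ballI)
    show "j ` I \<subseteq> carrier ?B" using I.Icarr by (auto simp: T(1))
    show "\<zero>\<^bsub>?B\<^esub> \<in> j ` I" by (simp add: T(2))
  next
    fix x y assume "x \<in> j ` I" "y \<in> j ` I"
    then show "x \<oplus>\<^bsub>?B\<^esub> y \<in> j ` I" using T(3) I.Icarr by auto
  next
    fix r x assume "r \<in> carrier R" "x \<in> j ` I"
    then show "r \<odot>\<^bsub>?B\<^esub> x \<in> j ` I" using T(4) I.Icarr I.I_l_closed by auto
  qed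
  define h where "h x = f (inv_into UNIV j x)" for x
  have hj: "h (j a) = f a" for a using assms(3) by (simp add: h_def)
  have "h \<in> module_hom R (?B\<lparr>carrier := j ` I\<rparr>) E"
  proof (rule module_homI)
    fix x assume "x \<in> carrier (?B\<lparr>carrier := j ` I\<rparr>)"
    then obtain a where a: "a \<in> I" "x = j a" by auto
    show "h x \<in> carrier E" using fc a by (auto simp: hj)
    show "h (r \<odot>\<^bsub>?B\<lparr>carrier := j ` I\<rparr>\<^esub> x) = r \<odot>\<^bsub>E\<^esub> h x" if "r \<in> carrier R" for r
      using fs that a T(4)[of a r] I.Icarr[OF a(1)] by (simp add: hj)
    fix y assume "y \<in> carrier (?B\<lparr>carrier := j ` I\<rparr>)"
    then obtain b where b: "b \<in> I" "y = j b" by auto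
    show "h (x \<oplus>\<^bsub>?B\<lparr>carrier := j ` I\<rparr>\<^esub> y) = h x \<oplus>\<^bsub>E\<^esub> h y"
      using fa a b T(3)[of a b] I.Icarr[OF a(1)] I.Icarr[OF b(1)] by (simp add: hj)
  qed
  then obtain g where g: "g \<in> module_hom R ?B E" "\<forall>x\<in>j ` I. g x = h x"
    using assms(1) B sub unfolding injective_module_def by blast
  have 1: "j \<one>\<^bsub>R\<^esub> \<in> carrier ?B" by (simp add: T(1))
  have "f a = a \<odot>\<^bsub>E\<^esub> g (j \<one>\<^bsub>R\<^esub>)" if a: "a \<in> I" for a
  proof -
    have "f a = g (j a)" using g(2) a by (simp add: hj)
    also have "j a = a \<odot>\<^bsub>?B\<^esub> j \<one>\<^bsub>R\<^esub>" using T(4)[of "\<one>\<^bsub>R\<^esub>" a] I.Icarr[OF a] by simp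
    also have "g \<dots> = a \<odot>\<^bsub>E\<^esub> g (j \<one>\<^bsub>R\<^esub>)" using module_homD(3)[OF g(1) I.Icarr[OF a] 1] .
    finally show ?thesis .
  qed
  then show "\<exists>e\<in>carrier E. \<forall>a\<in>I. f a = a \<odot>\<^bsub>E\<^esub> e" using module_homD(1)[OF g(1) 1] by blast
qed

lemma zero_module_quotient_iff:
  fixes R :: "'a ring" and E :: "('a, 'e) module"
  assumes "module R E" "submodule H R E" "Z \<subseteq> carrier E" "\<zero>\<^bsub>E\<^esub> \<in> Z"
  shows "zero_module (quotient_module (E\<lparr>carrier := Z\<rparr>) H) \<longleftrightarrow> Z \<subseteq> H"
proof -
  have z: "\<zero>\<^bsub>quotient_module E H\<^esub> = H" by (simp add: quotient_module_def)
  have "carrier (quotient_module (E\<lparr>carrier := Z\<rparr>) H) = (\<lambda>x. H +>\<^bsub>E\<^esub> x) ` Z"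
    by (auto simp: quotient_module_def A_RCOSETS_def' a_r_coset_def')
  moreover have "\<zero>\<^bsub>quotient_module (E\<lparr>carrier := Z\<rparr>) H\<^esub> = H" by (simp add: quotient_module_def)
  moreover have "H +>\<^bsub>E\<^esub> x = H \<longleftrightarrow> x \<in> H" if "x \<in> Z" for x
    using module_quotient(4)[OF assms(1,2), of x] that assms(3) unfolding z by blast
  moreover have "(\<lambda>x. H +>\<^bsub>E\<^esub> x) ` Z = {H} \<longleftrightarrow> (\<forall>x\<in>Z. H +>\<^bsub>E\<^esub> x = H)"
    using assms(4) by blast
  ultimately show ?thesis unfolding zero_module_def subset_eq by simp
qed

lemma local_cohomology_resolution:
  fixes Q :: "('a, 'b) module"
  assumes "noetherian_ring R" "module R Q"
  obtains \<epsilon> and E :: "nat \<Rightarrow> ('a, ('a, 'b) resolution_universe) module" and \<delta>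
  where "injective_resolution R Q \<epsilon> E \<delta>"
    "\<forall>J i. local_cohomology R J i Q = quotient_module ((E i)\<lparr>carrier := torsion_cocycles R J E \<delta> i\<rparr>)
       (torsion_coboundaries R J E \<delta> i)"
proof -
  define p :: "(nat \<Rightarrow> ('a, ('a, 'b) resolution_universe) module) \<times>
      (nat \<Rightarrow> ('a, 'b) resolution_universe \<Rightarrow> ('a, 'b) resolution_universe)"
    where "p = (SOME (E, \<delta>). \<exists>\<epsilon>. injective_resolution R Q \<epsilon> E \<delta>)"
  have "\<exists>p :: (nat \<Rightarrow> ('a, ('a, 'b) resolution_universe) module) \<times>
      (nat \<Rightarrow> ('a, 'b) resolution_universe \<Rightarrow> ('a, 'b) resolution_universe).
      case p of (E, \<delta>) \<Rightarrow> \<exists>\<epsilon>. injective_resolution R Q \<epsilon> E \<delta>"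
  proof -
    obtain \<epsilon> and E :: "nat \<Rightarrow> ('a, ('a, 'b) resolution_universe) module" and \<delta>
      where "injective_resolution R Q \<epsilon> E \<delta>" using injective_resolution_exists[OF assms] by (elim exE)
    then have "case (E, \<delta>) of (E, \<delta>) \<Rightarrow> \<exists>\<epsilon>. injective_resolution R Q \<epsilon> E \<delta>" by auto
    then show ?thesis by (rule exI)
  qed
  then have "case p of (E, \<delta>) \<Rightarrow> \<exists>\<epsilon>. injective_resolution R Q \<epsilon> E \<delta>"
    unfolding p_def by (rule someI_ex)
  then obtain \<epsilon> where \<epsilon>: "injective_resolution R Q \<epsilon> (fst p) (snd p)"
    unfolding case_prod_beta by (elim exE)
  have "local_cohomology R J i Q =
      quotient_module ((fst p i)\<lparr>carrier := torsion_cocycles R J (fst p) (snd p) i\<rparr>)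
       (torsion_coboundaries R J (fst p) (snd p) i)" for J i
    unfolding local_cohomology_def p_def[symmetric] case_prod_beta Let_def ..
  then show ?thesis using that \<epsilon> by blast
qed

text \<open>Every homomorphism from a power of \<open>J\<close> to \<open>Q\<close> extends to the ring, that is,
  \<open>Ext\<^sup>1(R / J\<^sup>n, Q) = 0\<close> for all \<open>n\<close>.\<close>

definition homs_from_powers_extend :: "'a ring \<Rightarrow> 'a set \<Rightarrow> ('a, 'b) module \<Rightarrow> bool" where
  "homs_from_powers_extend R J Q \<longleftrightarrow>
     (\<forall>n::nat. \<forall>\<phi> \<in> module_hom R ((ring_module R)\<lparr>carrier := J [^]\<^bsub>ideals_set R\<^esub> n\<rparr>) Q.
        \<exists>q\<in>carrier Q. \<forall>a\<in>J [^]\<^bsub>ideals_set R\<^esub> n. \<phi> a = a \<odot>\<^bsub>Q\<^esub> q)"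

text \<open>A module with a fixed injective resolution whose type \<open>'e\<close> has room for a copy \<open>j\<close> of the ring.\<close>

locale resolved_module =
  fixes R :: "'a ring" and J :: "'a set" and Q :: "('a, 'b) module"
    and \<epsilon> and E :: "nat \<Rightarrow> ('a, 'e) module" and \<delta> and j :: "'a \<Rightarrow> 'e"
  assumes idl: "ideal J R" and mdl: "module R Q"
    and resolution: "injective_resolution R Q \<epsilon> E \<delta>" and inj_j: "inj j"
begin

lemma res:
  "injective_module R (E n)" "\<epsilon> \<in> module_hom R Q (E 0)" "\<delta> n \<in> module_hom R (E n) (E (Suc n))"
  "inj_on \<epsilon> (carrier Q)" "\<epsilon> ` carrier Q = module_kernel (E 0) (E (Suc 0)) (\<delta> 0)"
  "\<delta> n ` carrier (E n) = module_kernel (E (Suc n)) (E (Suc (Suc n))) (\<delta> (Suc n))"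
  using resolution by (simp_all add: injective_resolution_def)

lemma module_E: "module R (E n)"
  using res(1) by (simp add: injective_module_def)

lemma cring_R: "cring R"
  using mdl by (rule module.axioms(1))

lemma \<delta>_eq_zero: "x \<in> carrier (E 0) \<Longrightarrow> \<delta> 0 x = \<zero>\<^bsub>E (Suc 0)\<^esub> \<longleftrightarrow> x \<in> \<epsilon> ` carrier Q"
  using res(5) by (simp add: module_kernel_def)

lemma \<epsilon>_torsion_iff: "q \<in> carrier Q \<Longrightarrow> \<epsilon> q \<in> torsion_part R J (E 0) \<longleftrightarrow> q \<in> torsion_part R J Q"
proof -
  assume q: "q \<in> carrier Q"
  interpret Q: module R Q by (rule mdl)
  have "a \<odot>\<^bsub>E 0\<^esub> \<epsilon> q = \<zero>\<^bsub>E 0\<^esub> \<longleftrightarrow> a \<odot>\<^bsub>Q\<^esub> q = \<zero>\<^bsub>Q\<^esub>" if "a \<in> J [^]\<^bsub>ideals_set R\<^esub> n" for a and n :: nat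
  proof -
    have a: "a \<in> carrier R" using ideal.Icarr[OF ideal_power_ideal[OF cring_R idl] that] .
    have "a \<odot>\<^bsub>E 0\<^esub> \<epsilon> q = \<epsilon> (a \<odot>\<^bsub>Q\<^esub> q)" using module_homD(3)[OF res(2) a q] by simp
    moreover have "\<zero>\<^bsub>E 0\<^esub> = \<epsilon> \<zero>\<^bsub>Q\<^esub>" using module_hom_zero[OF mdl module_E res(2)] by simp
    ultimately show ?thesis using inj_on_eq_iff[OF res(4)] a q by simp
  qed
  then show ?thesis unfolding torsion_part_def using q module_homD(1)[OF res(2) q] by auto
qed

lemma cocycles_0: "torsion_cocycles R J E \<delta> 0 \<subseteq> torsion_coboundaries R J E \<delta> 0 \<longleftrightarrow>
    torsion_part R J Q = {\<zero>\<^bsub>Q\<^esub>}"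
proof -
  have Z: "torsion_cocycles R J E \<delta> 0 = \<epsilon> ` torsion_part R J Q"
  proof -
    have "torsion_cocycles R J E \<delta> 0 = torsion_part R J (E 0) \<inter> \<epsilon> ` carrier Q"
      unfolding torsion_cocycles_def using res(5) by simp
    also have "\<dots> = \<epsilon> ` torsion_part R J Q"
      using \<epsilon>_torsion_iff submoduleD(1)[OF submodule_torsion_part[OF mdl idl] mdl] by blast
    finally show ?thesis .
  qed
  have T: "submodule (torsion_part R J Q) R Q" by (rule submodule_torsion_part[OF mdl idl])
  have 0: "\<zero>\<^bsub>E 0\<^esub> = \<epsilon> \<zero>\<^bsub>Q\<^esub>" using module_hom_zero[OF mdl module_E res(2)] by simp
  have "\<epsilon> ` torsion_part R J Q \<subseteq> {\<epsilon> \<zero>\<^bsub>Q\<^esub>} \<longleftrightarrow> torsion_part R J Q \<subseteq> {\<zero>\<^bsub>Q\<^esub>}"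
    using inj_on_eq_iff[OF res(4)] submoduleD(1,2)[OF T mdl] by blast
  then show ?thesis unfolding Z torsion_coboundaries_def 0
    using submoduleD(2)[OF T mdl] by auto
qed

text \<open>A torsion cocycle is \<open>x = \<delta> y\<close> with \<open>J\<^sup>n y \<subseteq> Q\<close>. If \<open>a \<mapsto> a y\<close> is multiplication with \<open>q \<in> Q\<close>, then
  \<open>y - q\<close> is a torsion element with the same image \<open>x\<close>.\<close>

lemma cocycles_1_if_extend:
  assumes "homs_from_powers_extend R J Q"
  shows "torsion_cocycles R J E \<delta> 1 \<subseteq> torsion_coboundaries R J E \<delta> 1"
proof
  interpret Q: module R Q by (rule mdl)
  interpret E0: module R "E 0" by (rule module_E)
  interpret E1: module R "E (Suc 0)" by (rule module_E)
  fix x assume "x \<in> torsion_cocycles R J E \<delta> 1"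
  then have tor: "x \<in> torsion_part R J (E (Suc 0))" and ker: "x \<in> module_kernel (E (Suc 0)) (E (Suc (Suc 0))) (\<delta> (Suc 0))"
    by (simp_all add: torsion_cocycles_def)
  obtain n :: nat where "x \<in> carrier (E (Suc 0))"
    and n: "\<forall>a\<in>J [^]\<^bsub>ideals_set R\<^esub> n. a \<odot>\<^bsub>E (Suc 0)\<^esub> x = \<zero>\<^bsub>E (Suc 0)\<^esub>"
    using tor by (rule torsion_partE)
  let ?I = "J [^]\<^bsub>ideals_set R\<^esub> n"
  interpret I: ideal ?I R by (rule ideal_power_ideal[OF cring_R idl])
  have "x \<in> \<delta> 0 ` carrier (E 0)" using ker res(6)[of 0] by simp
  then obtain y where y: "y \<in> carrier (E 0)" "x = \<delta> 0 y" by auto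
  have ay: "a \<odot>\<^bsub>E 0\<^esub> y \<in> \<epsilon> ` carrier Q" if "a \<in> ?I" for a
    using \<delta>_eq_zero[of "a \<odot>\<^bsub>E 0\<^esub> y"] module_homD(3)[OF res(3)[of 0], of a y] bspec[OF n that] y I.Icarr[OF that] by simp
  define \<phi> where "\<phi> a = inv_into (carrier Q) \<epsilon> (a \<odot>\<^bsub>E 0\<^esub> y)" for a
  have \<phi>: "\<phi> a \<in> carrier Q" "\<epsilon> (\<phi> a) = a \<odot>\<^bsub>E 0\<^esub> y" if "a \<in> ?I" for a
    using inv_into_into[OF ay[OF that]] f_inv_into_f[OF ay[OF that]] by (simp_all add: \<phi>_def)
  have \<phi>eq: "\<phi> a = q" if "a \<in> ?I" "q \<in> carrier Q" "\<epsilon> q = a \<odot>\<^bsub>E 0\<^esub> y" for a q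
    using inj_onD[OF res(4), of "\<phi> a" q] \<phi>[OF that(1)] that(2,3) by simp
  have "\<phi> \<in> module_hom R ((ring_module R)\<lparr>carrier := ?I\<rparr>) Q"
  proof (rule module_homI)
    fix a assume "a \<in> carrier ((ring_module R)\<lparr>carrier := ?I\<rparr>)"
    then have a: "a \<in> ?I" by simp
    show "\<phi> a \<in> carrier Q" by (rule \<phi>(1)[OF a])
    show "\<phi> (r \<odot>\<^bsub>(ring_module R)\<lparr>carrier := ?I\<rparr>\<^esub> a) = r \<odot>\<^bsub>Q\<^esub> \<phi> a" if r: "r \<in> carrier R" for r
    proof -
      have "\<epsilon> (r \<odot>\<^bsub>Q\<^esub> \<phi> a) = (r \<otimes>\<^bsub>R\<^esub> a) \<odot>\<^bsub>E 0\<^esub> y"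
        using module_homD(3)[OF res(2) r \<phi>(1)[OF a]] \<phi>(2)[OF a] r I.Icarr[OF a] y(1) by (simp add: E0.smult_assoc1)
      then show ?thesis using \<phi>eq[OF I.I_l_closed[OF a r], of "r \<odot>\<^bsub>Q\<^esub> \<phi> a"] \<phi>(1)[OF a] r by simp
    qed
    fix b assume "b \<in> carrier ((ring_module R)\<lparr>carrier := ?I\<rparr>)"
    then have b: "b \<in> ?I" by simp
    have "\<epsilon> (\<phi> a \<oplus>\<^bsub>Q\<^esub> \<phi> b) = (a \<oplus>\<^bsub>R\<^esub> b) \<odot>\<^bsub>E 0\<^esub> y"
      using module_homD(2)[OF res(2) \<phi>(1)[OF a] \<phi>(1)[OF b]] \<phi>(2)[OF a] \<phi>(2)[OF b] I.Icarr[OF a] I.Icarr[OF b] y(1)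
      by (simp add: E0.smult_l_distr)
    then show "\<phi> (a \<oplus>\<^bsub>(ring_module R)\<lparr>carrier := ?I\<rparr>\<^esub> b) = \<phi> a \<oplus>\<^bsub>Q\<^esub> \<phi> b"
      using \<phi>eq[OF I.a_closed[OF a b], of "\<phi> a \<oplus>\<^bsub>Q\<^esub> \<phi> b"] \<phi>(1)[OF a] \<phi>(1)[OF b] by simp
  qed
  then obtain q where q: "q \<in> carrier Q" "\<forall>a\<in>?I. \<phi> a = a \<odot>\<^bsub>Q\<^esub> q"
    using assms unfolding homs_from_powers_extend_def by blast
  have \<epsilon>q: "\<epsilon> q \<in> carrier (E 0)" by (rule module_homD(1)[OF res(2) q(1)])
  let ?g = "y \<ominus>\<^bsub>E 0\<^esub> \<epsilon> q"
  have "?g \<in> torsion_part R J (E 0)"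
  proof (rule torsion_partI[of _ _ _ _ n])
    fix a assume a: "a \<in> ?I"
    then have ac: "a \<in> carrier R" by (rule I.Icarr)
    have "a \<odot>\<^bsub>E 0\<^esub> y = a \<odot>\<^bsub>E 0\<^esub> \<epsilon> q"
      using \<phi>(2)[OF a] q a module_homD(3)[OF res(2) ac q(1)] by simp
    then show "a \<odot>\<^bsub>E 0\<^esub> ?g = \<zero>\<^bsub>E 0\<^esub>"
      using ac y(1) \<epsilon>q by (simp add: a_minus_def E0.smult_r_distr E0.smult_r_minus E0.r_neg)
  qed (use y(1) \<epsilon>q in simp)
  moreover have "\<delta> 0 ?g = x"
  proof -
    have "\<delta> 0 ?g = \<delta> 0 y \<ominus>\<^bsub>E (Suc 0)\<^esub> \<delta> 0 (\<epsilon> q)"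
      by (rule module_hom_minus[OF module_E module_E res(3) y(1) \<epsilon>q])
    moreover have "\<delta> 0 (\<epsilon> q) = \<zero>\<^bsub>E (Suc 0)\<^esub>" using \<delta>_eq_zero[OF \<epsilon>q] q(1) by simp
    ultimately show ?thesis using module_homD(1)[OF res(3) y(1)] y(2) by (simp add: a_minus_def)
  qed
  ultimately show "x \<in> torsion_coboundaries R J E \<delta> 1"
    by (auto simp: torsion_coboundaries_def)
qed

text \<open>A homomorphism \<open>\<phi>\<close> from \<open>J\<^sup>n\<close> is multiplication with some \<open>y \<in> E 0\<close>, and \<open>\<delta> y\<close> is a torsion cocycle.
  If it is the image of a torsion element \<open>g\<close>, then \<open>q = y - g\<close> lies in \<open>Q\<close>, and \<open>\<phi> a - a q\<close> is
  torsion, hence zero.\<close>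

lemma extend_if_cocycles_1:
  assumes "torsion_cocycles R J E \<delta> 1 \<subseteq> torsion_coboundaries R J E \<delta> 1" "torsion_part R J Q = {\<zero>\<^bsub>Q\<^esub>}"
  shows "homs_from_powers_extend R J Q"
  unfolding homs_from_powers_extend_def
proof (intro allI ballI)
  interpret Q: module R Q by (rule mdl)
  interpret E0: module R "E 0" by (rule module_E)
  fix n :: nat and \<phi>
  let ?I = "J [^]\<^bsub>ideals_set R\<^esub> n"
  assume "\<phi> \<in> module_hom R ((ring_module R)\<lparr>carrier := ?I\<rparr>) Q"
  note \<phi> = module_homD[OF this, simplified]
  interpret I: ideal ?I R by (rule ideal_power_ideal[OF cring_R idl])
  obtain y where y: "y \<in> carrier (E 0)" "\<And>a. a \<in> ?I \<Longrightarrow> \<epsilon> (\<phi> a) = a \<odot>\<^bsub>E 0\<^esub> y"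
  proof (rule baer_moduleD[OF baer_injective_module[OF res(1) cring_R inj_j, of 0] I.is_ideal, of "\<lambda>a. \<epsilon> (\<phi> a)"])
    show "\<epsilon> (\<phi> a) \<in> carrier (E 0)" if "a \<in> ?I" for a
      using module_homD(1)[OF res(2)] \<phi>(1)[OF that] by blast
    show "\<epsilon> (\<phi> (a \<oplus>\<^bsub>R\<^esub> b)) = \<epsilon> (\<phi> a) \<oplus>\<^bsub>E 0\<^esub> \<epsilon> (\<phi> b)" if "a \<in> ?I" "b \<in> ?I" for a b
      using module_homD(2)[OF res(2) \<phi>(1)[OF that(1)] \<phi>(1)[OF that(2)]] \<phi>(2)[OF that] by simp
    show "\<epsilon> (\<phi> (r \<otimes>\<^bsub>R\<^esub> a)) = r \<odot>\<^bsub>E 0\<^esub> \<epsilon> (\<phi> a)" if "r \<in> carrier R" "a \<in> ?I" for r a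
      using module_homD(3)[OF res(2) that(1) \<phi>(1)[OF that(2)]] \<phi>(3)[OF that] by simp
  qed auto
  have \<delta>y: "\<delta> 0 y \<in> carrier (E (Suc 0))" by (rule module_homD(1)[OF res(3) y(1)])
  have "\<delta> 0 y \<in> torsion_part R J (E (Suc 0))"
  proof (rule torsion_partI[of _ _ _ _ n, OF \<delta>y])
    fix a assume a: "a \<in> ?I"
    have "a \<odot>\<^bsub>E (Suc 0)\<^esub> \<delta> 0 y = \<delta> 0 (\<epsilon> (\<phi> a))"
      using module_homD(3)[OF res(3)[of 0] I.Icarr[OF a] y(1)] y(2)[OF a] by simp
    also have "\<dots> = \<zero>\<^bsub>E (Suc 0)\<^esub>"
      using \<delta>_eq_zero[of "\<epsilon> (\<phi> a)"] module_homD(1)[OF res(2) \<phi>(1)[OF a]] \<phi>(1)[OF a] by simp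
    finally show "a \<odot>\<^bsub>E (Suc 0)\<^esub> \<delta> 0 y = \<zero>\<^bsub>E (Suc 0)\<^esub>" .
  qed
  moreover have "\<delta> 0 y \<in> module_kernel (E (Suc 0)) (E (Suc (Suc 0))) (\<delta> (Suc 0))"
    using res(6)[of 0] y(1) by blast
  ultimately have "\<delta> 0 y \<in> torsion_cocycles R J E \<delta> 1" by (simp add: torsion_cocycles_def)
  then have "\<delta> 0 y \<in> \<delta> 0 ` torsion_part R J (E 0)"
    using assms(1) by (auto simp: torsion_coboundaries_def)
  then obtain g where g: "g \<in> torsion_part R J (E 0)" "\<delta> 0 y = \<delta> 0 g" by auto
  have T0: "submodule (torsion_part R J (E 0)) R (E 0)" by (rule submodule_torsion_part[OF module_E idl])
  have gc: "g \<in> carrier (E 0)" using g(1) submoduleD(1)[OF T0 module_E] by blast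
  have "\<delta> 0 (y \<ominus>\<^bsub>E 0\<^esub> g) = \<delta> 0 y \<ominus>\<^bsub>E (Suc 0)\<^esub> \<delta> 0 y"
    using module_hom_minus[OF module_E module_E res(3) y(1) gc] g(2) by simp
  also have "\<dots> = \<zero>\<^bsub>E (Suc 0)\<^esub>"
    using abelian_group.minus_eq_zero_iff[OF module.axioms(2)[OF module_E] \<delta>y \<delta>y] by simp
  finally have "y \<ominus>\<^bsub>E 0\<^esub> g \<in> \<epsilon> ` carrier Q" using \<delta>_eq_zero[of "y \<ominus>\<^bsub>E 0\<^esub> g"] y(1) gc by simp
  then obtain q where q: "q \<in> carrier Q" "y \<ominus>\<^bsub>E 0\<^esub> g = \<epsilon> q" by auto
  have \<epsilon>q: "\<epsilon> q \<in> carrier (E 0)" by (rule module_homD(1)[OF res(2) q(1)])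
  have yg: "y \<ominus>\<^bsub>E 0\<^esub> \<epsilon> q = g"
  proof -
    have "y \<ominus>\<^bsub>E 0\<^esub> (y \<ominus>\<^bsub>E 0\<^esub> g) = g"
      using y(1) gc by (simp add: a_minus_def E0.minus_add E0.a_assoc[symmetric] E0.r_neg)
    then show ?thesis by (simp add: q(2))
  qed
  have "\<phi> a = a \<odot>\<^bsub>Q\<^esub> q" if a: "a \<in> ?I" for a
  proof -
    have ac: "a \<in> carrier R" by (rule I.Icarr[OF a])
    have aq: "a \<odot>\<^bsub>Q\<^esub> q \<in> carrier Q" using ac q(1) by simp
    have "\<epsilon> (\<phi> a \<ominus>\<^bsub>Q\<^esub> a \<odot>\<^bsub>Q\<^esub> q) = a \<odot>\<^bsub>E 0\<^esub> y \<ominus>\<^bsub>E 0\<^esub> a \<odot>\<^bsub>E 0\<^esub> \<epsilon> q"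
      using module_hom_minus[OF mdl module_E res(2) \<phi>(1)[OF a] aq] y(2)[OF a] module_homD(3)[OF res(2) ac q(1)] by simp
    also have "\<dots> = a \<odot>\<^bsub>E 0\<^esub> (y \<ominus>\<^bsub>E 0\<^esub> \<epsilon> q)"
      using ac y(1) \<epsilon>q by (simp add: a_minus_def E0.smult_r_distr E0.smult_r_minus)
    also have "\<dots> \<in> torsion_part R J (E 0)" unfolding yg by (rule submoduleD(4)[OF T0 module_E ac g(1)])
    finally have "\<phi> a \<ominus>\<^bsub>Q\<^esub> a \<odot>\<^bsub>Q\<^esub> q \<in> torsion_part R J Q"
      using \<epsilon>_torsion_iff \<phi>(1)[OF a] aq by simp
    then show ?thesis using assms(2) Q.minus_eq_zero_iff[OF \<phi>(1)[OF a] aq] by simp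
  qed
  then show "\<exists>q\<in>carrier Q. \<forall>a\<in>?I. \<phi> a = a \<odot>\<^bsub>Q\<^esub> q" using q(1) by blast
qed

lemma zero_module_iff:
  "zero_module (quotient_module ((E i)\<lparr>carrier := torsion_cocycles R J E \<delta> i\<rparr>) (torsion_coboundaries R J E \<delta> i))
   \<longleftrightarrow> torsion_cocycles R J E \<delta> i \<subseteq> torsion_coboundaries R J E \<delta> i"
proof (rule zero_module_quotient_iff[OF module_E])
  interpret Ei: module R "E i" by (rule module_E)
  have T: "submodule (torsion_part R J (E n)) R (E n)" for n
    by (rule submodule_torsion_part[OF module_E idl])
  show "submodule (torsion_coboundaries R J E \<delta> i) R (E i)"
  proof (cases i)
    case 0
    then have "torsion_coboundaries R J E \<delta> i = {\<zero>\<^bsub>E i\<^esub>}" by (simp add: torsion_coboundaries_def)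
    then show ?thesis unfolding Ei.submodule_iff by simp
  next
    case (Suc k)
    then show ?thesis
      using submodule_image[OF module_E[of k] module_E[of "Suc k"] res(3)[of k] T[of k]] by (simp add: torsion_coboundaries_def)
  qed
  show "torsion_cocycles R J E \<delta> i \<subseteq> carrier (E i)"
    by (auto simp: torsion_cocycles_def torsion_part_def)
  show "\<zero>\<^bsub>E i\<^esub> \<in> torsion_cocycles R J E \<delta> i"
    using submoduleD(2)[OF T module_E] submoduleD(2)[OF submodule_kernel[OF module_E module_E res(3)] module_E]
    by (simp add: torsion_cocycles_def)
qed

end

lemma local_cohomology_01:
  fixes Q :: "('a, 'b) module"
  assumes "noetherian_ring R" "ideal J R" "module R Q"
  shows "zero_module (local_cohomology R J 0 Q) \<longleftrightarrow> torsion_part R J Q = {\<zero>\<^bsub>Q\<^esub>}"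
    and "torsion_part R J Q = {\<zero>\<^bsub>Q\<^esub>} \<Longrightarrow>
      zero_module (local_cohomology R J 1 Q) \<longleftrightarrow> homs_from_powers_extend R J Q"
proof -
  obtain \<epsilon> and E :: "nat \<Rightarrow> ('a, ('a, 'b) resolution_universe) module" and \<delta>
    where E: "injective_resolution R Q \<epsilon> E \<delta>"
    "\<forall>J i. local_cohomology R J i Q = quotient_module ((E i)\<lparr>carrier := torsion_cocycles R J E \<delta> i\<rparr>)
       (torsion_coboundaries R J E \<delta> i)"
    by (rule local_cohomology_resolution[OF assms(1,3)])
  interpret resolved_module R J Q \<epsilon> E \<delta> "\<lambda>a. [Inl a]"
    by (rule resolved_module.intro) (use assms E(1) in \<open>simp_all add: inj_def\<close>)
  show "zero_module (local_cohomology R J 0 Q) \<longleftrightarrow> torsion_part R J Q = {\<zero>\<^bsub>Q\<^esub>}"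
    unfolding E(2)[rule_format] zero_module_iff by (rule cocycles_0)
  show "zero_module (local_cohomology R J 1 Q) \<longleftrightarrow> homs_from_powers_extend R J Q"
    if "torsion_part R J Q = {\<zero>\<^bsub>Q\<^esub>}"
    unfolding E(2)[rule_format] zero_module_iff using that cocycles_1_if_extend extend_if_cocycles_1 by blast
qed

lemma depth_pos_iff:
  fixes Q :: "('a, 'b) module"
  assumes "noetherian_ring R" "ideal J R" "module R Q"
  shows "depth R J Q > 0 \<longleftrightarrow> torsion_part R J Q = {\<zero>\<^bsub>Q\<^esub>}"
proof -
  have "depth R J Q \<ge> 1 \<longleftrightarrow> (\<forall>i. \<not> zero_module (local_cohomology R J i Q) \<longrightarrow> 1 \<le> enat i)"
    unfolding depth_def le_Inf_iff by auto
  also have "\<dots> \<longleftrightarrow> zero_module (local_cohomology R J 0 Q)"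
    by (metis enat_ord_simps(1) less_one linorder_not_le one_enat_def)
  finally show ?thesis 
    using local_cohomology_01(1)[OF assms] Suc_ile_eq[of 0 "depth R J Q"] by (simp add: one_enat_def zero_enat_def)
qed

lemma depth_eq_one_iff:
  fixes Q :: "('a, 'b) module"
  assumes "noetherian_ring R" "ideal J R" "module R Q" "torsion_part R J Q = {\<zero>\<^bsub>Q\<^esub>}"
  shows "depth R J Q = 1 \<longleftrightarrow> \<not> homs_from_powers_extend R J Q"
proof -
  let ?D = "{enat i | i. \<not> zero_module (local_cohomology R J i Q)}"
  have 0: "enat 0 \<notin> ?D" using local_cohomology_01(1)[OF assms(1-3)] assms(4) by simp
  have 1: "enat 1 \<in> ?D \<longleftrightarrow> \<not> homs_from_powers_extend R J Q"
    using local_cohomology_01(2)[OF assms] by simp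
  have ge: "1 \<le> x" if "x \<in> ?D" for x
    using that 0 by (auto simp: one_enat_def Suc_le_eq intro: gr0I)
  show ?thesis
  proof
    assume d: "depth R J Q = 1"
    show "\<not> homs_from_powers_extend R J Q"
    proof (rule ccontr)
      assume "\<not> \<not> homs_from_powers_extend R J Q"
      then have "enat 1 \<notin> ?D" using 1 by simp
      then have "enat 2 \<le> x" if "x \<in> ?D" for x
        using that ge[OF that] by (auto simp: one_enat_def) (metis One_nat_def Suc_1 Suc_leI le_neq_implies_less)
      then have "enat 2 \<le> depth R J Q" unfolding depth_def by (rule Inf_greatest)
      then show False using d by (simp add: one_enat_def)
    qed
  next
    assume "\<not> homs_from_powers_extend R J Q"
    then have "enat 1 \<in> ?D" using 1 by simp
    then have "depth R J Q \<le> 1" unfolding depth_def one_enat_def by (rule Inf_lower)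
    moreover have "1 \<le> depth R J Q" unfolding depth_def by (rule Inf_greatest) (rule ge)
    ultimately show "depth R J Q = 1" by simp
  qed
qed


section \<open>Free modules and tensor products\<close>

lemma free_module_simps:
  "f \<in> carrier (free_module R S) \<longleftrightarrow>
     (\<forall>s. f s \<in> carrier R) \<and> (\<forall>s. s \<notin> S \<longrightarrow> f s = \<zero>\<^bsub>R\<^esub>) \<and> finite {s. f s \<noteq> \<zero>\<^bsub>R\<^esub>}"
  "\<zero>\<^bsub>free_module R S\<^esub> = (\<lambda>s. \<zero>\<^bsub>R\<^esub>)" "f \<oplus>\<^bsub>free_module R S\<^esub> g = (\<lambda>s. f s \<oplus>\<^bsub>R\<^esub> g s)"
  "r \<odot>\<^bsub>free_module R S\<^esub> f = (\<lambda>s. r \<otimes>\<^bsub>R\<^esub> f s)"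
  by (auto simp: free_module_def)

lemma module_free_module:
  assumes "cring R"
  shows "module R (free_module R S)"
proof -
  interpret cring R by fact
  let ?F = "free_module R S"
  show ?thesis
  proof (rule module_from_smult[OF assms])
    fix f g assume f: "f \<in> carrier ?F" and g: "g \<in> carrier ?F"
    have "{s. f s \<oplus>\<^bsub>R\<^esub> g s \<noteq> \<zero>\<^bsub>R\<^esub>} \<subseteq> {s. f s \<noteq> \<zero>\<^bsub>R\<^esub>} \<union> {s. g s \<noteq> \<zero>\<^bsub>R\<^esub>}" by auto
    then have "finite {s. f s \<oplus>\<^bsub>R\<^esub> g s \<noteq> \<zero>\<^bsub>R\<^esub>}"
      by (rule finite_subset) (use f g in \<open>simp add: free_module_simps\<close>)
    then show "f \<oplus>\<^bsub>?F\<^esub> g \<in> carrier ?F" using f g by (simp add: free_module_simps)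
    show "f \<oplus>\<^bsub>?F\<^esub> g = g \<oplus>\<^bsub>?F\<^esub> f" using f g by (simp add: free_module_simps a_comm)
    fix r assume r: "r \<in> carrier R"
    show "r \<odot>\<^bsub>?F\<^esub> (f \<oplus>\<^bsub>?F\<^esub> g) = r \<odot>\<^bsub>?F\<^esub> f \<oplus>\<^bsub>?F\<^esub> r \<odot>\<^bsub>?F\<^esub> g"
      using f g r by (simp add: free_module_simps r_distr)
  next
    fix f g h assume "f \<in> carrier ?F" "g \<in> carrier ?F" "h \<in> carrier ?F"
    then show "f \<oplus>\<^bsub>?F\<^esub> g \<oplus>\<^bsub>?F\<^esub> h = f \<oplus>\<^bsub>?F\<^esub> (g \<oplus>\<^bsub>?F\<^esub> h)" by (simp add: free_module_simps a_assoc)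
  next
    fix r f assume r: "r \<in> carrier R" and f: "f \<in> carrier ?F"
    have "{s. r \<otimes>\<^bsub>R\<^esub> f s \<noteq> \<zero>\<^bsub>R\<^esub>} \<subseteq> {s. f s \<noteq> \<zero>\<^bsub>R\<^esub>}" using r by auto
    then have "finite {s. r \<otimes>\<^bsub>R\<^esub> f s \<noteq> \<zero>\<^bsub>R\<^esub>}"
      by (rule finite_subset) (use f in \<open>simp add: free_module_simps\<close>)
    then show "r \<odot>\<^bsub>?F\<^esub> f \<in> carrier ?F" using f r by (simp add: free_module_simps)
  qed (simp_all add: free_module_simps l_distr m_assoc)
qed

lemma free_generator_closed:
  assumes "cring R" "s \<in> S"
  shows "free_generator R s \<in> carrier (free_module R S)"
proof -
  interpret cring R by fact
  have "{t. (if t = s then \<one>\<^bsub>R\<^esub> else \<zero>\<^bsub>R\<^esub>) \<noteq> \<zero>\<^bsub>R\<^esub>} \<subseteq> {s}" by auto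
  then have "finite {t. (if t = s then \<one>\<^bsub>R\<^esub> else \<zero>\<^bsub>R\<^esub>) \<noteq> \<zero>\<^bsub>R\<^esub>}" by (rule finite_subset) simp
  then show ?thesis using assms(2) by (auto simp: free_module_simps free_generator_def)
qed

lemma free_module_spanned:
  assumes "cring R" "submodule H R (free_module R S)" "\<And>s. s \<in> S \<Longrightarrow> free_generator R s \<in> H"
    "f \<in> carrier (free_module R S)"
  shows "f \<in> H"
proof -
  interpret cring R by fact
  let ?F = "free_module R S"
  note H = submoduleD[OF assms(2) module_free_module[OF assms(1)]]
  have "\<forall>f\<in>carrier ?F. {s. f s \<noteq> \<zero>\<^bsub>R\<^esub>} \<subseteq> A \<longrightarrow> f \<in> H" if "finite A" for A
    using that
  proof (induction A rule: finite_induct)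
    case empty
    have "f = \<zero>\<^bsub>?F\<^esub>" if "{s. f s \<noteq> \<zero>\<^bsub>R\<^esub>} \<subseteq> {}" for f
      using that by (simp add: free_module_simps fun_eq_iff)
    then show ?case using H(2) by auto
  next
    case (insert a A)
    show ?case
    proof (intro ballI impI)
      fix f assume f: "f \<in> carrier ?F" and supp: "{s. f s \<noteq> \<zero>\<^bsub>R\<^esub>} \<subseteq> insert a A"
      show "f \<in> H"
      proof (cases "f a = \<zero>\<^bsub>R\<^esub>")
        case True
        then have "{s. f s \<noteq> \<zero>\<^bsub>R\<^esub>} \<subseteq> A" using supp by auto
        then show ?thesis using insert.IH f by blast
      next
        case False
        then have a: "a \<in> S" and fa: "f a \<in> carrier R" using f by (auto simp: free_module_simps)
        let ?g = "f(a := \<zero>\<^bsub>R\<^esub>)"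
        have sub: "{s. ?g s \<noteq> \<zero>\<^bsub>R\<^esub>} \<subseteq> {s. f s \<noteq> \<zero>\<^bsub>R\<^esub>}" by auto
        have "finite {s. ?g s \<noteq> \<zero>\<^bsub>R\<^esub>}" by (rule finite_subset[OF sub]) (use f in \<open>simp add: free_module_simps\<close>)
        then have "?g \<in> carrier ?F" using f by (simp add: free_module_simps)
        moreover have "{s. ?g s \<noteq> \<zero>\<^bsub>R\<^esub>} \<subseteq> A" using supp by auto
        ultimately have "?g \<in> H" using insert.IH by blast
        moreover have "f a \<odot>\<^bsub>?F\<^esub> free_generator R a \<in> H" using H(4)[OF fa assms(3)[OF a]] .
        ultimately have "?g \<oplus>\<^bsub>?F\<^esub> f a \<odot>\<^bsub>?F\<^esub> free_generator R a \<in> H" by (rule H(3))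
        moreover have "?g \<oplus>\<^bsub>?F\<^esub> f a \<odot>\<^bsub>?F\<^esub> free_generator R a = f"
          using f fa by (auto simp: free_module_simps free_generator_def fun_eq_iff)
        ultimately show ?thesis by simp
      qed
    qed
  qed
  then show ?thesis using assms(4) by (auto simp: free_module_simps)
qed

lemma free_module_lift:
  assumes "module R P" "\<And>s. s \<in> S \<Longrightarrow> b s \<in> carrier P"
  obtains \<phi> where "\<phi> \<in> module_hom R (free_module R S) P" "\<And>s. s \<in> S \<Longrightarrow> \<phi> (free_generator R s) = b s"
proof -
  interpret P: module R P by fact
  let ?F = "free_module R S"
  interpret F: module R ?F by (rule module_free_module[OF P.R.is_cring])
  define \<phi> where "\<phi> f = (\<Oplus>\<^bsub>P\<^esub>s\<in>{s. f s \<noteq> \<zero>\<^bsub>R\<^esub>}. f s \<odot>\<^bsub>P\<^esub> b s)" for f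
  have t: "f s \<odot>\<^bsub>P\<^esub> b s \<in> carrier P" if "f \<in> carrier ?F" "s \<in> S" for f s
    using that assms(2) by (simp add: free_module_simps)
  have supp: "{s. f s \<noteq> \<zero>\<^bsub>R\<^esub>} \<subseteq> S" "finite {s. f s \<noteq> \<zero>\<^bsub>R\<^esub>}" if "f \<in> carrier ?F" for f
    using that by (auto simp: free_module_simps)
  have \<phi>: "\<phi> f = (\<Oplus>\<^bsub>P\<^esub>s\<in>A. f s \<odot>\<^bsub>P\<^esub> b s)"
    if f: "f \<in> carrier ?F" and A: "finite A" "A \<subseteq> S" "{s. f s \<noteq> \<zero>\<^bsub>R\<^esub>} \<subseteq> A" for f A
    unfolding \<phi>_def
  proof (rule P.add.finprod_mono_neutral_cong_left)
    show "f s \<odot>\<^bsub>P\<^esub> b s = \<zero>\<^bsub>P\<^esub>" if "s \<in> A - {s. f s \<noteq> \<zero>\<^bsub>R\<^esub>}" for s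
      using that A(2) assms(2) by auto
    show "(\<lambda>s. f s \<odot>\<^bsub>P\<^esub> b s) \<in> A \<rightarrow> carrier P" using t[OF f] A(2) by blast
  qed (use A in auto)
  have "\<phi> \<in> module_hom R ?F P"
  proof (rule module_homI)
    fix f assume f: "f \<in> carrier ?F"
    have fP: "(\<lambda>s. f s \<odot>\<^bsub>P\<^esub> b s) \<in> {s. f s \<noteq> \<zero>\<^bsub>R\<^esub>} \<rightarrow> carrier P" using t[OF f] supp(1)[OF f] by blast
    show "\<phi> f \<in> carrier P" unfolding \<phi>_def using fP by (rule P.finsum_closed)
    show "\<phi> (r \<odot>\<^bsub>?F\<^esub> f) = r \<odot>\<^bsub>P\<^esub> \<phi> f" if r: "r \<in> carrier R" for r
    proof -
      have rf: "r \<odot>\<^bsub>?F\<^esub> f \<in> carrier ?F" using r f by simp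
      have sub: "{s. (r \<odot>\<^bsub>?F\<^esub> f) s \<noteq> \<zero>\<^bsub>R\<^esub>} \<subseteq> {s. f s \<noteq> \<zero>\<^bsub>R\<^esub>}"
        using r by (auto simp: free_module_simps)
      have "\<phi> (r \<odot>\<^bsub>?F\<^esub> f) = (\<Oplus>\<^bsub>P\<^esub>s\<in>{s. f s \<noteq> \<zero>\<^bsub>R\<^esub>}. (r \<otimes>\<^bsub>R\<^esub> f s) \<odot>\<^bsub>P\<^esub> b s)"
        unfolding \<phi>[OF rf supp(2)[OF f] supp(1)[OF f] sub] by (simp add: free_module_simps)
      also have "\<dots> = (\<Oplus>\<^bsub>P\<^esub>s\<in>{s. f s \<noteq> \<zero>\<^bsub>R\<^esub>}. r \<odot>\<^bsub>P\<^esub> (f s \<odot>\<^bsub>P\<^esub> b s))"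
      proof (rule P.finsum_cong')
        fix s assume s: "s \<in> {s. f s \<noteq> \<zero>\<^bsub>R\<^esub>}"
        then have "s \<in> S" using supp(1)[OF f] by blast
        then show "(r \<otimes>\<^bsub>R\<^esub> f s) \<odot>\<^bsub>P\<^esub> b s = r \<odot>\<^bsub>P\<^esub> (f s \<odot>\<^bsub>P\<^esub> b s)"
          using r f assms(2) by (simp add: free_module_simps P.smult_assoc1)
      qed (use fP r in auto)
      also have "\<dots> = r \<odot>\<^bsub>P\<^esub> \<phi> f"
        unfolding \<phi>_def using P.finsum_smult_ldistr[OF supp(2)[OF f] r fP] by simp
      finally show ?thesis .
    qed
    fix g assume g: "g \<in> carrier ?F"
    let ?A = "{s. f s \<noteq> \<zero>\<^bsub>R\<^esub>} \<union> {s. g s \<noteq> \<zero>\<^bsub>R\<^esub>}"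
    have A: "finite ?A" "?A \<subseteq> S" using supp[OF f] supp[OF g] by auto
    have fg: "f \<oplus>\<^bsub>?F\<^esub> g \<in> carrier ?F" using f g by simp
    have sub: "{s. (f \<oplus>\<^bsub>?F\<^esub> g) s \<noteq> \<zero>\<^bsub>R\<^esub>} \<subseteq> ?A" by (auto simp: free_module_simps)
    have "\<phi> (f \<oplus>\<^bsub>?F\<^esub> g) = (\<Oplus>\<^bsub>P\<^esub>s\<in>?A. (f \<oplus>\<^bsub>?F\<^esub> g) s \<odot>\<^bsub>P\<^esub> b s)" by (rule \<phi>[OF fg A sub])
    also have "\<dots> = (\<Oplus>\<^bsub>P\<^esub>s\<in>?A. f s \<odot>\<^bsub>P\<^esub> b s \<oplus>\<^bsub>P\<^esub> g s \<odot>\<^bsub>P\<^esub> b s)"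
    proof (rule P.finsum_cong')
      fix s assume "s \<in> ?A"
      then have "s \<in> S" using A(2) by blast
      then show "(f \<oplus>\<^bsub>?F\<^esub> g) s \<odot>\<^bsub>P\<^esub> b s = f s \<odot>\<^bsub>P\<^esub> b s \<oplus>\<^bsub>P\<^esub> g s \<odot>\<^bsub>P\<^esub> b s"
        using f g assms(2) by (simp add: free_module_simps P.smult_l_distr)
    next
      show "(\<lambda>s. f s \<odot>\<^bsub>P\<^esub> b s \<oplus>\<^bsub>P\<^esub> g s \<odot>\<^bsub>P\<^esub> b s) \<in> ?A \<rightarrow> carrier P"
        using t[OF f] t[OF g] A(2) by blast
    qed simp
    also have "\<dots> = (\<Oplus>\<^bsub>P\<^esub>s\<in>?A. f s \<odot>\<^bsub>P\<^esub> b s) \<oplus>\<^bsub>P\<^esub> (\<Oplus>\<^bsub>P\<^esub>s\<in>?A. g s \<odot>\<^bsub>P\<^esub> b s)"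
    proof (rule P.finsum_addf)
      show "(\<lambda>s. f s \<odot>\<^bsub>P\<^esub> b s) \<in> ?A \<rightarrow> carrier P" using t[OF f] A(2) by blast
      show "(\<lambda>s. g s \<odot>\<^bsub>P\<^esub> b s) \<in> ?A \<rightarrow> carrier P" using t[OF g] A(2) by blast
    qed
    also have "\<dots> = \<phi> f \<oplus>\<^bsub>P\<^esub> \<phi> g" using \<phi>[OF f A] \<phi>[OF g A] by simp
    finally show "\<phi> (f \<oplus>\<^bsub>?F\<^esub> g) = \<phi> f \<oplus>\<^bsub>P\<^esub> \<phi> g" .
  qed
  moreover have "\<phi> (free_generator R s) = b s" if s: "s \<in> S" for s
  proof -
    have "\<phi> (free_generator R s) = (\<Oplus>\<^bsub>P\<^esub>t\<in>{s}. free_generator R s t \<odot>\<^bsub>P\<^esub> b t)"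
      by (rule \<phi>[OF free_generator_closed[OF P.R.is_cring s]]) (use s in \<open>auto simp: free_generator_def\<close>)
    also have "\<dots> = b s" using assms(2)[OF s] by (simp add: free_generator_def)
    finally show ?thesis .
  qed
  ultimately show ?thesis using that by blast
qed

lemma submodule_submodule_span:
  assumes "module R M" "S \<subseteq> carrier M"
  shows "submodule (submodule_span R M S) R M" "S \<subseteq> submodule_span R M S"
proof -
  interpret M: module R M by fact
  show "S \<subseteq> submodule_span R M S" by (auto simp: submodule_span_def)
  show "submodule (submodule_span R M S) R M"
    unfolding M.submodule_iff submodule_span_def
    using M.carrier_is_submodule assms(2) submoduleD[OF _ assms(1)] by blast
qed

lemma submodule_span_minimal: "submodule H R M \<Longrightarrow> S \<subseteq> H \<Longrightarrow> submodule_span R M S \<subseteq> H"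
  by (auto simp: submodule_span_def)

text \<open>Only the values of \<open>\<beta>\<close> on \<open>carrier M\<close> and \<open>carrier N\<close> matter.\<close>

definition bilinear_map ::
  "'a ring \<Rightarrow> ('a, 'b) module \<Rightarrow> ('a, 'c) module \<Rightarrow> ('a, 'd) module \<Rightarrow> ('b \<Rightarrow> 'c \<Rightarrow> 'd) \<Rightarrow> bool" where
  "bilinear_map R M N P \<beta> \<longleftrightarrow>
     (\<forall>x\<in>carrier M. \<forall>y\<in>carrier N. \<beta> x y \<in> carrier P) \<and>
     (\<forall>x\<in>carrier M. \<forall>x'\<in>carrier M. \<forall>y\<in>carrier N. \<beta> (x \<oplus>\<^bsub>M\<^esub> x') y = \<beta> x y \<oplus>\<^bsub>P\<^esub> \<beta> x' y) \<and>
     (\<forall>x\<in>carrier M. \<forall>y\<in>carrier N. \<forall>y'\<in>carrier N. \<beta> x (y \<oplus>\<^bsub>N\<^esub> y') = \<beta> x y \<oplus>\<^bsub>P\<^esub> \<beta> x y') \<and>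
     (\<forall>r\<in>carrier R. \<forall>x\<in>carrier M. \<forall>y\<in>carrier N. \<beta> (r \<odot>\<^bsub>M\<^esub> x) y = r \<odot>\<^bsub>P\<^esub> \<beta> x y) \<and>
     (\<forall>r\<in>carrier R. \<forall>x\<in>carrier M. \<forall>y\<in>carrier N. \<beta> x (r \<odot>\<^bsub>N\<^esub> y) = r \<odot>\<^bsub>P\<^esub> \<beta> x y)"

lemma bilinear_mapD:
  assumes "bilinear_map R M N P \<beta>"
  shows "x \<in> carrier M \<Longrightarrow> y \<in> carrier N \<Longrightarrow> \<beta> x y \<in> carrier P"
    "x \<in> carrier M \<Longrightarrow> x' \<in> carrier M \<Longrightarrow> y \<in> carrier N \<Longrightarrow> \<beta> (x \<oplus>\<^bsub>M\<^esub> x') y = \<beta> x y \<oplus>\<^bsub>P\<^esub> \<beta> x' y"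
    "x \<in> carrier M \<Longrightarrow> y \<in> carrier N \<Longrightarrow> y' \<in> carrier N \<Longrightarrow> \<beta> x (y \<oplus>\<^bsub>N\<^esub> y') = \<beta> x y \<oplus>\<^bsub>P\<^esub> \<beta> x y'"
    "r \<in> carrier R \<Longrightarrow> x \<in> carrier M \<Longrightarrow> y \<in> carrier N \<Longrightarrow> \<beta> (r \<odot>\<^bsub>M\<^esub> x) y = r \<odot>\<^bsub>P\<^esub> \<beta> x y"
    "r \<in> carrier R \<Longrightarrow> x \<in> carrier M \<Longrightarrow> y \<in> carrier N \<Longrightarrow> \<beta> x (r \<odot>\<^bsub>N\<^esub> y) = r \<odot>\<^bsub>P\<^esub> \<beta> x y"
  using assms by (simp_all add: bilinear_map_def)

text \<open>The element \<open>x \<otimes> y\<close>, that is, the class of the corresponding free generator.\<close>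

definition pure_tensor :: "'a ring \<Rightarrow> ('a, 'b) module \<Rightarrow> ('a, 'c) module \<Rightarrow> 'b \<Rightarrow> 'c \<Rightarrow> ('b \<times> 'c \<Rightarrow> 'a) set" where
  "pure_tensor R M N x y =
     submodule_span R (free_module R (carrier M \<times> carrier N)) (tensor_relations R M N)
       +>\<^bsub>free_module R (carrier M \<times> carrier N)\<^esub> free_generator R (x, y)"

locale tensor =
  fixes R :: "'a ring" and M :: "('a, 'b) module" and N :: "('a, 'c) module"
  assumes mM: "module R M" and mN: "module R N"
begin

abbreviation "F \<equiv> free_module R (carrier M \<times> carrier N)"
abbreviation "K \<equiv> submodule_span R F (tensor_relations R M N)"
abbreviation "T \<equiv> tensor_product R M N"
abbreviation "gen x y \<equiv> free_generator R (x, y)"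

lemma cring_R: "cring R"
  using mM by (rule module.axioms(1))

lemma mF: "module R F"
  by (rule module_free_module[OF cring_R])

lemma gen: "x \<in> carrier M \<Longrightarrow> y \<in> carrier N \<Longrightarrow> gen x y \<in> carrier F"
  by (rule free_generator_closed[OF cring_R]) simp

lemma relations_closed: "tensor_relations R M N \<subseteq> carrier F"
proof -
  interpret M: module R M by (rule mM)
  interpret N: module R N by (rule mN)
  interpret F: module R F by (rule mF)
  show ?thesis unfolding tensor_relations_def Let_def by (auto simp: gen)
qed

lemma relations:
  "x \<in> carrier M \<Longrightarrow> x' \<in> carrier M \<Longrightarrow> y \<in> carrier N \<Longrightarrow>
     gen (x \<oplus>\<^bsub>M\<^esub> x') y \<ominus>\<^bsub>F\<^esub> (gen x y \<oplus>\<^bsub>F\<^esub> gen x' y) \<in> tensor_relations R M N"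
  "x \<in> carrier M \<Longrightarrow> y \<in> carrier N \<Longrightarrow> y' \<in> carrier N \<Longrightarrow>
     gen x (y \<oplus>\<^bsub>N\<^esub> y') \<ominus>\<^bsub>F\<^esub> (gen x y \<oplus>\<^bsub>F\<^esub> gen x y') \<in> tensor_relations R M N"
  "r \<in> carrier R \<Longrightarrow> x \<in> carrier M \<Longrightarrow> y \<in> carrier N \<Longrightarrow>
     gen (r \<odot>\<^bsub>M\<^esub> x) y \<ominus>\<^bsub>F\<^esub> r \<odot>\<^bsub>F\<^esub> gen x y \<in> tensor_relations R M N"
  "r \<in> carrier R \<Longrightarrow> x \<in> carrier M \<Longrightarrow> y \<in> carrier N \<Longrightarrow>
     gen x (r \<odot>\<^bsub>N\<^esub> y) \<ominus>\<^bsub>F\<^esub> r \<odot>\<^bsub>F\<^esub> gen x y \<in> tensor_relations R M N"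
  unfolding tensor_relations_def Let_def by blast+

lemmas K = submodule_submodule_span[OF mF relations_closed]

lemma T: "T = quotient_module F K"
  by (simp add: tensor_product_def Let_def)

lemmas quot = module_quotient[OF mF K(1), folded T]

lemma module_tensor: "module R T"
  by (rule quot(1))

lemma pure_closed: "x \<in> carrier M \<Longrightarrow> y \<in> carrier N \<Longrightarrow> pure_tensor R M N x y \<in> carrier T"
  unfolding pure_tensor_def by (rule module_homD(1)[OF quot(3) gen])

lemma quot_eq:
  assumes "f \<in> carrier F" "g \<in> carrier F" "f \<ominus>\<^bsub>F\<^esub> g \<in> tensor_relations R M N"
  shows "K +>\<^bsub>F\<^esub> f = K +>\<^bsub>F\<^esub> g"
proof -
  have c: "K +>\<^bsub>F\<^esub> f \<in> carrier T" "K +>\<^bsub>F\<^esub> g \<in> carrier T"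
    using module_homD(1)[OF quot(3)] assms(1,2) by blast+
  have "f \<ominus>\<^bsub>F\<^esub> g \<in> carrier F" using assms(3) relations_closed by blast
  then have "K +>\<^bsub>F\<^esub> (f \<ominus>\<^bsub>F\<^esub> g) = \<zero>\<^bsub>T\<^esub>" using quot(4) assms(3) K(2) by blast
  then have "(K +>\<^bsub>F\<^esub> f) \<ominus>\<^bsub>T\<^esub> (K +>\<^bsub>F\<^esub> g) = \<zero>\<^bsub>T\<^esub>"
    using module_hom_minus[OF mF quot(1) quot(3) assms(1,2)] by simp
  then show ?thesis
    using abelian_group.minus_eq_zero_iff[OF module.axioms(2)[OF quot(1)] c] by blast
qed

lemma bilinear_pure_tensor: "bilinear_map R M N T (pure_tensor R M N)"
proof -
  interpret M: module R M by (rule mM)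
  interpret N: module R N by (rule mN)
  interpret F: module R F by (rule mF)
  note q = module_homD[OF quot(3)]
  show ?thesis
    unfolding bilinear_map_def
  proof (intro conjI ballI)
    show "pure_tensor R M N x y \<in> carrier T" if "x \<in> carrier M" "y \<in> carrier N" for x y
      using pure_closed that .
    show "pure_tensor R M N (x \<oplus>\<^bsub>M\<^esub> x') y = pure_tensor R M N x y \<oplus>\<^bsub>T\<^esub> pure_tensor R M N x' y"
      if "x \<in> carrier M" "x' \<in> carrier M" "y \<in> carrier N" for x x' y
      unfolding pure_tensor_def q(2)[OF gen[OF that(1,3)] gen[OF that(2,3)], symmetric]
      by (rule quot_eq[OF _ _ relations(1)]) (use that in \<open>simp_all add: gen\<close>)
    show "pure_tensor R M N x (y \<oplus>\<^bsub>N\<^esub> y') = pure_tensor R M N x y \<oplus>\<^bsub>T\<^esub> pure_tensor R M N x y'"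
      if "x \<in> carrier M" "y \<in> carrier N" "y' \<in> carrier N" for x y y'
      unfolding pure_tensor_def q(2)[OF gen[OF that(1,2)] gen[OF that(1,3)], symmetric]
      by (rule quot_eq[OF _ _ relations(2)]) (use that in \<open>simp_all add: gen\<close>)
    show "pure_tensor R M N (r \<odot>\<^bsub>M\<^esub> x) y = r \<odot>\<^bsub>T\<^esub> pure_tensor R M N x y"
      if "r \<in> carrier R" "x \<in> carrier M" "y \<in> carrier N" for r x y
      unfolding pure_tensor_def q(3)[OF that(1) gen[OF that(2,3)], symmetric]
      by (rule quot_eq[OF _ _ relations(3)]) (use that in \<open>simp_all add: gen\<close>)
    show "pure_tensor R M N x (r \<odot>\<^bsub>N\<^esub> y) = r \<odot>\<^bsub>T\<^esub> pure_tensor R M N x y"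
      if "r \<in> carrier R" "x \<in> carrier M" "y \<in> carrier N" for r x y
      unfolding pure_tensor_def q(3)[OF that(1) gen[OF that(2,3)], symmetric]
      by (rule quot_eq[OF _ _ relations(4)]) (use that in \<open>simp_all add: gen\<close>)
  qed
qed

text \<open>The universal property; together with the following uniqueness lemma it is all that is used of
  the construction of the tensor product.\<close>

lemma tensor_lift:
  assumes "module R P" "bilinear_map R M N P \<beta>"
  obtains \<phi> where "\<phi> \<in> module_hom R T P"
    "\<And>x y. x \<in> carrier M \<Longrightarrow> y \<in> carrier N \<Longrightarrow> \<phi> (pure_tensor R M N x y) = \<beta> x y"
proof -
  interpret M: module R M by (rule mM)
  interpret N: module R N by (rule mN)
  interpret F: module R F by (rule mF)
  interpret P: module R P by fact
  note \<beta> = bilinear_mapD[OF assms(2)]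
  have "case s of (x, y) \<Rightarrow> \<beta> x y \<in> carrier P" if "s \<in> carrier M \<times> carrier N" for s
    using that \<beta>(1) by auto
  then obtain \<psi> where \<psi>: "\<psi> \<in> module_hom R F P"
    and \<psi>g': "\<And>s. s \<in> carrier M \<times> carrier N \<Longrightarrow> \<psi> (free_generator R s) = (case s of (x, y) \<Rightarrow> \<beta> x y)"
    using free_module_lift[OF assms(1), of "carrier M \<times> carrier N" "\<lambda>(x, y). \<beta> x y"] by (auto simp: split_beta)
  have \<psi>g: "\<psi> (gen x y) = \<beta> x y" if "x \<in> carrier M" "y \<in> carrier N" for x y
    using \<psi>g'[of "(x, y)"] that by simp
  note h = module_homD[OF \<psi>] and m = module_hom_minus[OF mF assms(1) \<psi>]
  have kerI: "u \<ominus>\<^bsub>F\<^esub> v \<in> module_kernel F P \<psi>" if "u \<in> carrier F" "v \<in> carrier F" "\<psi> u = \<psi> v" for u v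
    unfolding module_kernel_def
    using that m[OF that(1,2)] P.minus_eq_zero_iff[OF h(1)[OF that(1)] h(1)[OF that(2)]] by simp
  have "tensor_relations R M N \<subseteq> module_kernel F P \<psi>"
    unfolding tensor_relations_def Let_def
    by (intro Un_least subsetI; elim CollectE exE conjE; hypsubst; rule kerI; simp add: gen h \<psi>g \<beta>)
  then have "K \<subseteq> module_kernel F P \<psi>"
    by (rule submodule_span_minimal[OF submodule_kernel[OF mF assms(1) \<psi>]])
  then have Kz: "\<psi> f = \<zero>\<^bsub>P\<^esub>" if "f \<in> K" for f using that by (auto simp: module_kernel_def)
  obtain \<phi> where \<phi>: "\<phi> \<in> module_hom R (quotient_module F K) P"
    "\<And>f. f \<in> carrier F \<Longrightarrow> \<phi> (K +>\<^bsub>F\<^esub> f) = \<psi> f"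
    using module_hom_quotient_lift[OF mF K(1) assms(1) \<psi> Kz] by metis
  show ?thesis
  proof (rule that[of \<phi>])
    show "\<phi> \<in> module_hom R T P" using \<phi>(1) by (simp add: T)
    show "\<phi> (pure_tensor R M N x y) = \<beta> x y" if "x \<in> carrier M" "y \<in> carrier N" for x y
      unfolding pure_tensor_def using \<phi>(2)[OF gen[OF that]] \<psi>g[OF that] by simp
  qed
qed

lemma tensor_hom_eqI:
  assumes "module R P" "\<phi> \<in> module_hom R T P" "\<psi> \<in> module_hom R T P"
    and "\<And>x y. x \<in> carrier M \<Longrightarrow> y \<in> carrier N \<Longrightarrow> \<phi> (pure_tensor R M N x y) = \<psi> (pure_tensor R M N x y)"
    and "t \<in> carrier T"
  shows "\<phi> t = \<psi> t"
proof -
  interpret P: module R P by fact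
  interpret F: module R F by (rule mF)
  obtain f where f: "f \<in> carrier F" "t = K +>\<^bsub>F\<^esub> f" using assms(5) quot(2) by auto
  note \<phi> = module_hom_comp[OF quot(3) assms(2)] and \<psi> = module_hom_comp[OF quot(3) assms(3)]
  let ?H = "{f \<in> carrier F. \<phi> (K +>\<^bsub>F\<^esub> f) = \<psi> (K +>\<^bsub>F\<^esub> f)}"
  have "submodule ?H R F"
    unfolding F.submodule_iff
    using module_hom_zero[OF mF assms(1) \<phi>] module_hom_zero[OF mF assms(1) \<psi>]
      module_homD(2,3)[OF \<phi>] module_homD(2,3)[OF \<psi>] by auto
  then have "f \<in> ?H"
    by (rule free_module_spanned[OF cring_R])
      (use assms(4) gen f(1) in \<open>auto simp: pure_tensor_def\<close>)
  then show ?thesis using f(2) by simp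
qed

end


section \<open>Minimal generating sets over a local ring\<close>

text \<open>The linear combination of the elements of \<open>S\<close>, assumed to be finite, with coefficients \<open>c\<close>. Its value
  depends only on \<open>c\<close> restricted to \<open>S\<close>.\<close>

definition lincomb :: "('a, 'b) module \<Rightarrow> 'b set \<Rightarrow> ('b \<Rightarrow> 'a) \<Rightarrow> 'b" where
  "lincomb U S c = (\<Oplus>\<^bsub>U\<^esub>s\<in>S. c s \<odot>\<^bsub>U\<^esub> s)"

locale finite_family =
  fixes R :: "'a ring" and U :: "('a, 'b) module" and S :: "'b set"
  assumes mU: "module R U" and fin: "finite S" and sub: "S \<subseteq> carrier U"
begin

sublocale U: module R U by (rule mU)

lemma term_closed: "c \<in> S \<rightarrow> carrier R \<Longrightarrow> (\<lambda>s. c s \<odot>\<^bsub>U\<^esub> s) \<in> S \<rightarrow> carrier U"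
  using sub by auto

lemma lincomb_closed: "c \<in> S \<rightarrow> carrier R \<Longrightarrow> lincomb U S c \<in> carrier U"
  unfolding lincomb_def by (rule U.finsum_closed[OF term_closed])

lemma lincomb_cong:
  assumes "c \<in> S \<rightarrow> carrier R" "\<And>s. s \<in> S \<Longrightarrow> c s = d s"
  shows "lincomb U S c = lincomb U S d"
  unfolding lincomb_def
proof (rule U.finsum_cong')
  have "d \<in> S \<rightarrow> carrier R" using assms by (metis Pi_I Pi_mem)
  then show "(\<lambda>s. d s \<odot>\<^bsub>U\<^esub> s) \<in> S \<rightarrow> carrier U" by (rule term_closed)
  show "c s \<odot>\<^bsub>U\<^esub> s = d s \<odot>\<^bsub>U\<^esub> s" if "s \<in> S" for s using assms(2)[OF that] by simp
qed simp

lemma lincomb_add: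
  assumes "c \<in> S \<rightarrow> carrier R" "d \<in> S \<rightarrow> carrier R"
  shows "lincomb U S c \<oplus>\<^bsub>U\<^esub> lincomb U S d = lincomb U S (\<lambda>s. c s \<oplus>\<^bsub>R\<^esub> d s)"
  unfolding lincomb_def U.finsum_addf[OF term_closed[OF assms(1)] term_closed[OF assms(2)], symmetric]
proof (rule U.finsum_cong')
  fix s assume s: "s \<in> S"
  then have "c s \<in> carrier R" "d s \<in> carrier R" "s \<in> carrier U" using assms sub by auto
  then show "c s \<odot>\<^bsub>U\<^esub> s \<oplus>\<^bsub>U\<^esub> d s \<odot>\<^bsub>U\<^esub> s = (c s \<oplus>\<^bsub>R\<^esub> d s) \<odot>\<^bsub>U\<^esub> s" by (simp add: U.smult_l_distr)
next
  show "(\<lambda>s. (c s \<oplus>\<^bsub>R\<^esub> d s) \<odot>\<^bsub>U\<^esub> s) \<in> S \<rightarrow> carrier U" by (rule term_closed) (use assms in auto)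
qed simp

lemma lincomb_smult:
  assumes "c \<in> S \<rightarrow> carrier R" "r \<in> carrier R"
  shows "r \<odot>\<^bsub>U\<^esub> lincomb U S c = lincomb U S (\<lambda>s. r \<otimes>\<^bsub>R\<^esub> c s)"
  unfolding lincomb_def U.finsum_smult_ldistr[OF fin assms(2) term_closed[OF assms(1)]]
proof (rule U.finsum_cong')
  fix s assume s: "s \<in> S"
  then have "c s \<in> carrier R" "s \<in> carrier U" using assms sub by auto
  then show "r \<odot>\<^bsub>U\<^esub> (c s \<odot>\<^bsub>U\<^esub> s) = (r \<otimes>\<^bsub>R\<^esub> c s) \<odot>\<^bsub>U\<^esub> s" using assms(2) by (simp add: U.smult_assoc1)
next
  show "(\<lambda>s. (r \<otimes>\<^bsub>R\<^esub> c s) \<odot>\<^bsub>U\<^esub> s) \<in> S \<rightarrow> carrier U" by (rule term_closed) (use assms in auto)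
qed simp

lemma lincomb_zero: "lincomb U S (\<lambda>s. \<zero>\<^bsub>R\<^esub>) = \<zero>\<^bsub>U\<^esub>"
  unfolding lincomb_def by (rule U.add.finprod_one_eqI) (use sub in auto)

lemma lincomb_single:
  assumes "t \<in> S" "r \<in> carrier R"
  shows "lincomb U S (\<lambda>s. if s = t then r else \<zero>\<^bsub>R\<^esub>) = r \<odot>\<^bsub>U\<^esub> t"
proof -
  have "lincomb U S (\<lambda>s. if s = t then r else \<zero>\<^bsub>R\<^esub>) = (\<Oplus>\<^bsub>U\<^esub>s\<in>S. if s = t then r \<odot>\<^bsub>U\<^esub> s else \<zero>\<^bsub>U\<^esub>)"
    unfolding lincomb_def by (rule U.finsum_cong') (use sub assms in \<open>auto simp: subset_iff\<close>)
  also have "\<dots> = r \<odot>\<^bsub>U\<^esub> t"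
    by (rule U.add.finprod_singleton_swap[OF assms(1) fin]) (use sub assms in auto)
  finally show ?thesis .
qed

lemma lincomb_minus:
  assumes "c \<in> S \<rightarrow> carrier R" "d \<in> S \<rightarrow> carrier R"
  shows "lincomb U S c \<ominus>\<^bsub>U\<^esub> lincomb U S d = lincomb U S (\<lambda>s. c s \<ominus>\<^bsub>R\<^esub> d s)"
proof -
  have n: "(\<lambda>s. \<ominus>\<^bsub>R\<^esub> \<one>\<^bsub>R\<^esub> \<otimes>\<^bsub>R\<^esub> d s) \<in> S \<rightarrow> carrier R" using assms(2) by auto
  have "\<ominus>\<^bsub>U\<^esub> lincomb U S d = (\<ominus>\<^bsub>R\<^esub> \<one>\<^bsub>R\<^esub>) \<odot>\<^bsub>U\<^esub> lincomb U S d"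
    using U.smult_l_minus[OF U.R.one_closed lincomb_closed[OF assms(2)]] lincomb_closed[OF assms(2)] by simp
  also have "\<dots> = lincomb U S (\<lambda>s. \<ominus>\<^bsub>R\<^esub> \<one>\<^bsub>R\<^esub> \<otimes>\<^bsub>R\<^esub> d s)"
    by (rule lincomb_smult[OF assms(2)]) simp
  finally have "lincomb U S c \<ominus>\<^bsub>U\<^esub> lincomb U S d = lincomb U S (\<lambda>s. c s \<oplus>\<^bsub>R\<^esub> \<ominus>\<^bsub>R\<^esub> \<one>\<^bsub>R\<^esub> \<otimes>\<^bsub>R\<^esub> d s)"
    unfolding a_minus_def using lincomb_add[OF assms(1) n] by simp
  also have "\<dots> = lincomb U S (\<lambda>s. c s \<ominus>\<^bsub>R\<^esub> d s)"
  proof (rule lincomb_cong)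
    show "(\<lambda>s. c s \<oplus>\<^bsub>R\<^esub> \<ominus>\<^bsub>R\<^esub> \<one>\<^bsub>R\<^esub> \<otimes>\<^bsub>R\<^esub> d s) \<in> S \<rightarrow> carrier R" using assms by auto
    fix s assume "s \<in> S"
    then have "d s \<in> carrier R" using assms(2) by auto
    then show "c s \<oplus>\<^bsub>R\<^esub> \<ominus>\<^bsub>R\<^esub> \<one>\<^bsub>R\<^esub> \<otimes>\<^bsub>R\<^esub> d s = c s \<ominus>\<^bsub>R\<^esub> d s" by (simp add: a_minus_def U.R.l_minus)
  qed
  finally show ?thesis .
qed

lemma span_eq: "submodule_span R U S = lincomb U S ` (S \<rightarrow> carrier R)"
proof
  let ?L = "lincomb U S ` (S \<rightarrow> carrier R)"
  show "submodule_span R U S \<subseteq> ?L"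
  proof (rule submodule_span_minimal)
    show "submodule ?L R U"
      unfolding U.submodule_iff
    proof (intro conjI ballI)
      show "?L \<subseteq> carrier U" using lincomb_closed by auto
      show "\<zero>\<^bsub>U\<^esub> \<in> ?L" 
        by (rule image_eqI[of _ _ "\<lambda>s. \<zero>\<^bsub>R\<^esub>"]) (simp_all add: lincomb_zero)
    next
      fix x y assume "x \<in> ?L" "y \<in> ?L"
      then obtain c d where cd: "c \<in> S \<rightarrow> carrier R" "d \<in> S \<rightarrow> carrier R" "x = lincomb U S c" "y = lincomb U S d"
        by auto
      show "x \<oplus>\<^bsub>U\<^esub> y \<in> ?L"
        unfolding cd(3,4) lincomb_add[OF cd(1,2)] by (rule imageI) (use cd in auto)
    next
      fix r x assume r: "r \<in> carrier R" and "x \<in> ?L"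
      then obtain c where c: "c \<in> S \<rightarrow> carrier R" "x = lincomb U S c" by auto
      show "r \<odot>\<^bsub>U\<^esub> x \<in> ?L"
        unfolding c(2) lincomb_smult[OF c(1) r] by (rule imageI) (use c r in auto)
    qed
    show "S \<subseteq> ?L"
    proof
      fix t assume t: "t \<in> S"
      then have "lincomb U S (\<lambda>s. if s = t then \<one>\<^bsub>R\<^esub> else \<zero>\<^bsub>R\<^esub>) = t"
        using lincomb_single[OF t, of "\<one>\<^bsub>R\<^esub>"] sub by auto
      then show "t \<in> ?L"
        by (intro image_eqI[of _ _ "\<lambda>s. if s = t then \<one>\<^bsub>R\<^esub> else \<zero>\<^bsub>R\<^esub>"]) (simp_all add: Pi_iff)
    qed
  qed
  have H: "lincomb U A c \<in> H" if "submodule H R U" "finite A" "A \<subseteq> H" "c \<in> A \<rightarrow> carrier R" for H A c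
    using that(2,3,4)
  proof (induction A rule: finite_induct)
    case empty
    then show ?case using submoduleD(2)[OF that(1) mU] by (simp add: lincomb_def)
  next
    case (insert a A)
    note HD = submoduleD[OF that(1) mU]
    have "lincomb U (insert a A) c = c a \<odot>\<^bsub>U\<^esub> a \<oplus>\<^bsub>U\<^esub> lincomb U A c"
      unfolding lincomb_def
      by (rule U.finsum_insert[OF insert.hyps]) (use insert.prems HD(1) in auto)
    then show ?case using insert.IH insert.prems HD(3,4) by auto
  qed
  show "?L \<subseteq> submodule_span R U S"
    using H[OF submodule_submodule_span(1)[OF mU sub] fin submodule_submodule_span(2)[OF mU sub]] by auto
qed

end

locale local_noetherian =
  fixes R :: "'a ring" and \<mm> :: "'a set"
  assumes local_ring: "noetherian_local_ring R \<mm>"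
begin

sublocale R: cring R using local_ring by (simp add: noetherian_local_ring_def)

lemma noeth: "noetherian_ring R" and maxi: "maximalideal \<mm> R"
  using local_ring by (simp_all add: noetherian_local_ring_def)

lemma ideal_m: "ideal \<mm> R"
  using maxi by (rule maximalideal.axioms(1))

lemma m_carrier: "a \<in> \<mm> \<Longrightarrow> a \<in> carrier R"
  by (rule ideal.Icarr[OF ideal_m])

lemma one_notin_m: "\<one>\<^bsub>R\<^esub> \<notin> \<mm>"
  using ideal.one_imp_carrier[OF ideal_m] maximalideal.I_notcarr[OF maxi] by blast

lemma unit_if_notin_m:
  assumes "a \<in> carrier R" "a \<notin> \<mm>"
  shows "a \<in> Units R"
proof (rule ccontr)
  assume nu: "a \<notin> Units R"
  let ?A = "{I. ideal I R \<and> a \<in> I \<and> \<one>\<^bsub>R\<^esub> \<notin> I}"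
  have "\<exists>M\<in>?A. \<forall>V\<in>?A. M \<subseteq> V \<longrightarrow> V = M"
  proof (rule subset_Zorn_nonempty)
    have "PIdl\<^bsub>R\<^esub> a \<noteq> carrier R" using R.ideal_eq_carrier_iff[OF assms(1)] nu by simp
    then have "\<one>\<^bsub>R\<^esub> \<notin> PIdl\<^bsub>R\<^esub> a" using ideal.one_imp_carrier[OF R.cgenideal_ideal[OF assms(1)]] by blast
    then have "PIdl\<^bsub>R\<^esub> a \<in> ?A"
      using R.cgenideal_ideal[OF assms(1)] R.cgenideal_self[OF assms(1)] by blast
    then show "?A \<noteq> {}" by blast
  next
    fix C assume C: "C \<noteq> {}" "subset.chain ?A C"
    then have "subset.chain {I. ideal I R} C" by (auto simp: subset.chain_def)
    from R.chain_Union_is_ideal[OF this] have "ideal (\<Union>C) R" using C(1) by simp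
    then show "\<Union>C \<in> ?A" using C by (auto simp: subset.chain_def)
  qed
  then obtain M where M: "M \<in> ?A" and max: "\<forall>V\<in>?A. M \<subseteq> V \<longrightarrow> V = M" by (elim bexE)
  have "maximalideal M R"
  proof (rule maximalidealI)
    show "ideal M R" using M by simp
    show "carrier R \<noteq> M" using M by auto
    fix V assume V: "ideal V R" "M \<subseteq> V" "V \<subseteq> carrier R"
    show "V = M \<or> V = carrier R"
    proof (cases "\<one>\<^bsub>R\<^esub> \<in> V")
      case True
      then show ?thesis using ideal.one_imp_carrier[OF V(1)] by blast
    next
      case False
      then have "V \<in> ?A" using V M by blast
      then show ?thesis using max V(2) by blast
    qed
  qed
  then have "M = \<mm>" using local_ring by (simp add: noetherian_local_ring_def)
  then show False using M assms(2) by blast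
qed

end

text \<open>Finite generating sets of least cardinality.\<close>

definition minimal_generators :: "'a ring \<Rightarrow> ('a, 'b) module \<Rightarrow> 'b set \<Rightarrow> bool" where
  "minimal_generators R U S \<longleftrightarrow> finite S \<and> S \<subseteq> carrier U \<and> submodule_span R U S = carrier U \<and>
     (\<forall>S'. finite S' \<and> S' \<subseteq> carrier U \<and> submodule_span R U S' = carrier U \<longrightarrow> card S \<le> card S')"

lemma minimal_generators_exist:
  assumes "finitely_generated_module R U"
  obtains S where "minimal_generators R U S"
proof -
  let ?P = "\<lambda>S. finite S \<and> S \<subseteq> carrier U \<and> submodule_span R U S = carrier U"
  have ex: "\<exists>n S. ?P S \<and> card S = n" using assms by (auto simp: finitely_generated_module_def)
  define n where "n = (LEAST n. \<exists>S. ?P S \<and> card S = n)"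
  have "\<exists>S. ?P S \<and> card S = n" unfolding n_def using ex by (rule LeastI_ex)
  then obtain S where S: "?P S" "card S = n" by blast
  have "card S \<le> card S'" if "?P S'" for S'
    unfolding S(2) n_def using that by (intro Least_le) blast
  then have "minimal_generators R U S" using S by (simp add: minimal_generators_def)
  then show ?thesis using that by blast
qed

locale minimal_family = local_noetherian R \<mm> for R :: "'a ring" and \<mm> +
  fixes U :: "('a, 'b) module" and S :: "'b set"
  assumes mU': "module R U" and minimal: "minimal_generators R U S"
begin

sublocale finite_family R U S
  by (rule finite_family.intro) (use mU' minimal in \<open>simp_all add: minimal_generators_def\<close>)

lemma generates:
  assumes "x \<in> carrier U"
  obtains c where "c \<in> S \<rightarrow> carrier R" "x = lincomb U S c"
proof -
  have "x \<in> submodule_span R U S" using assms minimal by (simp add: minimal_generators_def)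
  then show ?thesis unfolding span_eq using that by blast
qed

text \<open>If \<open>c t\<close> were a unit, the generator \<open>t\<close> would be superfluous.\<close>

lemma relation_in_m:
  assumes c: "c \<in> S \<rightarrow> carrier R" "lincomb U S c = \<zero>\<^bsub>U\<^esub>" and t: "t \<in> S"
  shows "c t \<in> \<mm>"
proof (rule ccontr)
  assume nm: "c t \<notin> \<mm>"
  have ct: "c t \<in> carrier R" and tU: "t \<in> carrier U" using c t sub by auto
  then have unit: "c t \<in> Units R" using unit_if_notin_m nm by blast
  let ?S = "S - {t}"
  have S': "finite ?S" "?S \<subseteq> carrier U" using fin sub by auto
  interpret S': finite_family R U ?S by unfold_locales (use S' in auto)
  let ?H = "submodule_span R U ?S"
  note H = submodule_submodule_span[OF mU S'(2)] and HD = submoduleD[OF submodule_submodule_span(1)[OF mU S'(2)] mU]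
  have cS': "c \<in> ?S \<rightarrow> carrier R" using c by auto
  have "lincomb U (insert t ?S) c = c t \<odot>\<^bsub>U\<^esub> t \<oplus>\<^bsub>U\<^esub> lincomb U ?S c"
    unfolding lincomb_def
    by (rule U.finsum_insert) (use S'.term_closed[OF cS'] fin ct tU in auto)
  then have "c t \<odot>\<^bsub>U\<^esub> t \<oplus>\<^bsub>U\<^esub> lincomb U ?S c = \<zero>\<^bsub>U\<^esub>" using c(2) t by (simp add: insert_absorb)
  then have "c t \<odot>\<^bsub>U\<^esub> t = \<ominus>\<^bsub>U\<^esub> lincomb U ?S c"
    using U.minus_equality[of "c t \<odot>\<^bsub>U\<^esub> t" "lincomb U ?S c"] S'.lincomb_closed[OF cS'] ct tU by simp
  moreover have "lincomb U ?S c \<in> ?H" unfolding S'.span_eq using cS' by blast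
  ultimately have "c t \<odot>\<^bsub>U\<^esub> t \<in> ?H" using U.submoduleE(3)[OF H(1)] by simp
  then have "inv\<^bsub>R\<^esub> (c t) \<odot>\<^bsub>U\<^esub> (c t \<odot>\<^bsub>U\<^esub> t) \<in> ?H" using HD(4) R.Units_inv_closed[OF unit] by blast
  moreover have "inv\<^bsub>R\<^esub> (c t) \<odot>\<^bsub>U\<^esub> (c t \<odot>\<^bsub>U\<^esub> t) = t"
    using U.smult_assoc1[OF R.Units_inv_closed[OF unit] ct tU, symmetric] R.Units_l_inv[OF unit] tU by simp
  ultimately have "t \<in> ?H" by simp
  then have "S \<subseteq> ?H" using H(2) by auto
  then have "submodule_span R U S \<subseteq> ?H" by (rule submodule_span_minimal[OF H(1)])
  then have "?H = carrier U" using minimal HD(1) by (auto simp: minimal_generators_def)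
  then have "card S \<le> card ?S" using minimal S' by (auto simp: minimal_generators_def)
  then show False using card_Diff1_less[OF fin t] by simp
qed

end

context local_noetherian
begin

lemma finitely_generated_ideal:
  assumes "ideal I R"
  shows "finitely_generated_module R ((ring_module R)\<lparr>carrier := I\<rparr>)"
proof -
  let ?I = "(ring_module R)\<lparr>carrier := I\<rparr>"
  have sm: "submodule I R (ring_module R)" using assms by (simp add: submodule_ring_module_iff R.is_cring)
  have mI: "module R ?I" by (rule submodule.submodule_is_module[OF sm module_ring_module[OF R.is_cring]])
  obtain A where A: "A \<subseteq> carrier R" "finite A" "I = Idl\<^bsub>R\<^esub> A"
    using noetherian_ring.finetely_gen[OF noeth assms] by blast
  have AI: "A \<subseteq> I" using R.genideal_self[OF A(1)] A(3) by simp
  have "I \<subseteq> H" if H: "submodule H R ?I" "A \<subseteq> H" for H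
  proof -
    note HD = submoduleD[OF H(1) mI, simplified]
    have "submodule H R (ring_module R)"
      unfolding module.submodule_iff[OF module_ring_module[OF R.is_cring]]
      using HD ideal.Icarr[OF assms] by auto
    then have "ideal H R" by (simp add: submodule_ring_module_iff R.is_cring)
    then show ?thesis unfolding A(3) using H(2) by (rule R.genideal_minimal)
  qed
  then have "I \<subseteq> submodule_span R ?I A"
    by (auto simp: submodule_span_def)
  moreover have "submodule_span R ?I A \<subseteq> I"
    using submodule_span_minimal[OF module.carrier_is_submodule[OF mI], of A] AI by simp
  ultimately have "submodule_span R ?I A = carrier ?I" by simp
  then show ?thesis unfolding finitely_generated_module_def using mI A(2) AI by auto
qed

text \<open>If \<open>I\<close> had a nonempty minimal generating set, writing a generator \<open>t\<close> as a combination with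
  coefficients in \<open>\<mm>\<close> would give a relation in which \<open>t\<close> has a coefficient outside \<open>\<mm>\<close>.\<close>

lemma nakayama_ideal:
  assumes I: "ideal I R" "I \<subseteq> \<mm> \<cdot>\<^bsub>R\<^esub> I"
  shows "I = {\<zero>\<^bsub>R\<^esub>}"
proof -
  let ?I = "(ring_module R)\<lparr>carrier := I\<rparr>"
  have fg: "finitely_generated_module R ?I" by (rule finitely_generated_ideal[OF I(1)])
  obtain S where S: "minimal_generators R ?I S" by (rule minimal_generators_exist[OF fg])
  interpret S: minimal_family R \<mm> ?I S
    by (intro minimal_family.intro minimal_family_axioms.intro local_noetherian_axioms)
      (use fg S in \<open>simp_all add: finitely_generated_module_def\<close>)
  have prod: "\<exists>c\<in>S \<rightarrow> \<mm>. x = lincomb ?I S c" if "x \<in> \<mm> \<cdot>\<^bsub>R\<^esub> I" for x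
    using that
  proof (induction x rule: ideal_prod.induct)
    case (prod i x)
    have "x \<in> carrier ?I" using prod(2) by simp
    then obtain c where c: "c \<in> S \<rightarrow> carrier R" "x = lincomb ?I S c" by (rule S.generates)
    have "i \<otimes>\<^bsub>R\<^esub> x = lincomb ?I S (\<lambda>s. i \<otimes>\<^bsub>R\<^esub> c s)"
      using S.lincomb_smult[OF c(1) m_carrier[OF prod(1)]] c(2) by simp
    moreover have "(\<lambda>s. i \<otimes>\<^bsub>R\<^esub> c s) \<in> S \<rightarrow> \<mm>" using c(1) ideal.I_r_closed[OF ideal_m prod(1)] by auto
    ultimately show ?case by blast
  next
    case (sum x y)
    then obtain c d where cd: "c \<in> S \<rightarrow> \<mm>" "d \<in> S \<rightarrow> \<mm>" "x = lincomb ?I S c" "y = lincomb ?I S d" by blast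
    have R: "c \<in> S \<rightarrow> carrier R" "d \<in> S \<rightarrow> carrier R" using cd(1,2) m_carrier by auto
    have "x \<oplus>\<^bsub>R\<^esub> y = lincomb ?I S (\<lambda>s. c s \<oplus>\<^bsub>R\<^esub> d s)" using S.lincomb_add[OF R] cd(3,4) by simp
    moreover have "(\<lambda>s. c s \<oplus>\<^bsub>R\<^esub> d s) \<in> S \<rightarrow> \<mm>"
      using cd(1,2) additive_subgroup.a_closed[OF ideal.axioms(1)[OF ideal_m]] by auto
    ultimately show ?case by blast
  qed
  have "S = {}"
  proof (rule ccontr)
    assume "S \<noteq> {}"
    then obtain t where t: "t \<in> S" by auto
    then have tI: "t \<in> I" using S.sub by auto
    then have tR: "t \<in> carrier R" using ideal.Icarr[OF I(1)] by blast
    obtain c where c: "c \<in> S \<rightarrow> \<mm>" "t = lincomb ?I S c" using prod[of t] I(2) tI by blast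
    have cR: "c \<in> S \<rightarrow> carrier R" using c(1) m_carrier by auto
    let ?e = "\<lambda>s. if s = t then \<one>\<^bsub>R\<^esub> else \<zero>\<^bsub>R\<^esub>"
    have e: "?e \<in> S \<rightarrow> carrier R" by auto
    have "lincomb ?I S ?e = t" using S.lincomb_single[OF t, of "\<one>\<^bsub>R\<^esub>"] tR by simp
    then have "lincomb ?I S c \<ominus>\<^bsub>?I\<^esub> lincomb ?I S ?e = t \<ominus>\<^bsub>?I\<^esub> t" using c(2) by simp
    also have "\<dots> = \<zero>\<^bsub>?I\<^esub>" using S.U.minus_eq_zero_iff[of t t] tI by simp
    finally have "lincomb ?I S (\<lambda>s. c s \<ominus>\<^bsub>R\<^esub> ?e s) = \<zero>\<^bsub>?I\<^esub>" using S.lincomb_minus[OF cR e] by simp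
    moreover have "(\<lambda>s. c s \<ominus>\<^bsub>R\<^esub> ?e s) \<in> S \<rightarrow> carrier R" using cR e by auto
    ultimately have "c t \<ominus>\<^bsub>R\<^esub> ?e t \<in> \<mm>" using S.relation_in_m[OF _ _ t] by blast
    then have 1: "c t \<ominus>\<^bsub>R\<^esub> \<one>\<^bsub>R\<^esub> \<in> \<mm>" by simp
    have ct: "c t \<in> \<mm>" "c t \<in> carrier R" using c(1) cR t by auto
    interpret m: ideal \<mm> R by (rule ideal_m)
    have "c t \<oplus>\<^bsub>R\<^esub> \<ominus>\<^bsub>R\<^esub> (c t \<ominus>\<^bsub>R\<^esub> \<one>\<^bsub>R\<^esub>) \<in> \<mm>" using ct(1) 1 by simp
    moreover have "c t \<oplus>\<^bsub>R\<^esub> \<ominus>\<^bsub>R\<^esub> (c t \<ominus>\<^bsub>R\<^esub> \<one>\<^bsub>R\<^esub>) = \<one>\<^bsub>R\<^esub>"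
      using ct(2) by (simp add: a_minus_def R.minus_add R.a_assoc[symmetric] R.r_neg)
    ultimately show False using one_notin_m by simp
  qed
  have "x = \<zero>\<^bsub>R\<^esub>" if "x \<in> I" for x
  proof -
    have "x \<in> carrier ?I" using that by simp
    then obtain c where "x = lincomb ?I S c" by (rule S.generates)
    then show ?thesis by (simp add: \<open>S = {}\<close> lincomb_def)
  qed
  moreover have "\<zero>\<^bsub>R\<^esub> \<in> I" by (rule additive_subgroup.zero_closed[OF ideal.axioms(1)[OF I(1)]])
  ultimately show ?thesis by blast
qed

end


section \<open>A criterion for freeness\<close>

text \<open>An ideal as a module.\<close>

abbreviation ideal_module :: "'a ring \<Rightarrow> 'a set \<Rightarrow> ('a, 'a) module" where
  "ideal_module R I \<equiv> (ring_module R)\<lparr>carrier := I\<rparr>"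

lemma module_ideal_module:
  assumes "cring R" "ideal I R"
  shows "module R (ideal_module R I)"
  using submodule.submodule_is_module[OF _ module_ring_module[OF assms(1)]]
    submodule_ring_module_iff[OF assms(1)] assms(2) by blast

context minimal_family
begin

abbreviation "mm \<equiv> ideal_module R \<mm>"

lemma module_mm: "module R mm"
  by (rule module_ideal_module[OF R.is_cring ideal_m])

text \<open>The ideal of the coefficients of \<open>t\<close> in the relations among the generators.\<close>

definition coefficient_ideal :: "'b \<Rightarrow> 'a set" where
  "coefficient_ideal t = {c t | c. c \<in> S \<rightarrow> carrier R \<and> lincomb U S c = \<zero>\<^bsub>U\<^esub>}"

lemma ideal_coefficient_ideal:
  assumes t: "t \<in> S"
  shows "ideal (coefficient_ideal t) R"
proof -
  let ?I = "coefficient_ideal t"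
  have "submodule ?I R (ring_module R)"
    unfolding module.submodule_iff[OF module_ring_module[OF R.is_cring]]
  proof (intro conjI ballI)
    show "?I \<subseteq> carrier (ring_module R)" using t by (auto simp: coefficient_ideal_def)
    show "\<zero>\<^bsub>ring_module R\<^esub> \<in> ?I"
      unfolding coefficient_ideal_def using lincomb_zero
      by (intro CollectI exI[of _ "\<lambda>s. \<zero>\<^bsub>R\<^esub>"]) simp
  next
    fix x y assume "x \<in> ?I" "y \<in> ?I"
    then obtain c d where cd: "c \<in> S \<rightarrow> carrier R" "lincomb U S c = \<zero>\<^bsub>U\<^esub>" "x = c t"
      "d \<in> S \<rightarrow> carrier R" "lincomb U S d = \<zero>\<^bsub>U\<^esub>" "y = d t" unfolding coefficient_ideal_def by blast
    have "lincomb U S (\<lambda>s. c s \<oplus>\<^bsub>R\<^esub> d s) = \<zero>\<^bsub>U\<^esub>" using lincomb_add[OF cd(1,4)] cd(2,5) by simp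
    moreover have "(\<lambda>s. c s \<oplus>\<^bsub>R\<^esub> d s) \<in> S \<rightarrow> carrier R" using cd(1,4) by auto
    ultimately show "x \<oplus>\<^bsub>ring_module R\<^esub> y \<in> ?I"
      unfolding coefficient_ideal_def using cd(3,6) by (intro CollectI exI[of _ "\<lambda>s. c s \<oplus>\<^bsub>R\<^esub> d s"]) simp
  next
    fix r x assume r: "r \<in> carrier R" and "x \<in> ?I"
    then obtain c where c: "c \<in> S \<rightarrow> carrier R" "lincomb U S c = \<zero>\<^bsub>U\<^esub>" "x = c t"
      unfolding coefficient_ideal_def by blast
    have "lincomb U S (\<lambda>s. r \<otimes>\<^bsub>R\<^esub> c s) = \<zero>\<^bsub>U\<^esub>" using lincomb_smult[OF c(1) r] c(2) r by simp
    moreover have "(\<lambda>s. r \<otimes>\<^bsub>R\<^esub> c s) \<in> S \<rightarrow> carrier R" using c(1) r by auto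
    ultimately show "r \<odot>\<^bsub>ring_module R\<^esub> x \<in> ?I"
      unfolding coefficient_ideal_def using c(3) by (intro CollectI exI[of _ "\<lambda>s. r \<otimes>\<^bsub>R\<^esub> c s"]) simp
  qed
  then show ?thesis by (simp add: submodule_ring_module_iff R.is_cring)
qed

text \<open>The tensor that belongs to a relation among the generators is killed by \<open>\<mm>\<close>, since
  \<open>a (\<Sum> c\<^sub>s \<otimes> s) = a \<otimes> (\<Sum> c\<^sub>s s) = 0\<close>. It makes sense because \<open>c\<^sub>s \<in> \<mm>\<close>.\<close>

lemma relation_tensor_torsion:
  assumes c: "c \<in> S \<rightarrow> carrier R" "lincomb U S c = \<zero>\<^bsub>U\<^esub>"
  shows "(\<Oplus>\<^bsub>tensor_product R mm U\<^esub>s\<in>S. pure_tensor R mm U (c s) s) \<in> torsion_part R \<mm> (tensor_product R mm U)"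
proof -
  interpret tensor R mm U by (rule tensor.intro[OF module_mm mU])
  interpret T: module R T by (rule module_tensor)
  note b = bilinear_mapD[OF bilinear_pure_tensor]
  let ?p = "pure_tensor R mm U"
  have cm: "c s \<in> \<mm>" if "s \<in> S" for s using relation_in_m[OF c that] .
  have cR: "c s \<in> carrier R" and sU: "s \<in> carrier U" if "s \<in> S" for s using c(1) sub that by auto
  have pc: "(\<lambda>s. ?p (c s) s) \<in> S \<rightarrow> carrier T" using b(1) cm sU by auto
  show ?thesis
  proof (rule torsion_partI[of _ _ _ _ 1])
    show "(\<Oplus>\<^bsub>T\<^esub>s\<in>S. ?p (c s) s) \<in> carrier T" by (rule T.finsum_closed[OF pc])
    fix a assume "a \<in> \<mm> [^]\<^bsub>ideals_set R\<^esub> (1::nat)"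
    then have a: "a \<in> \<mm>" using ideal_power_1[OF R.is_cring ideal_m] by simp
    have aR: "a \<in> carrier R" by (rule m_carrier[OF a])
    have pa: "?p a \<in> module_hom R U T"
      by (rule module_homI) (use a b(1,3,5) in simp_all)
    have "a \<odot>\<^bsub>T\<^esub> (\<Oplus>\<^bsub>T\<^esub>s\<in>S. ?p (c s) s) = (\<Oplus>\<^bsub>T\<^esub>s\<in>S. a \<odot>\<^bsub>T\<^esub> ?p (c s) s)"
      by (rule T.finsum_smult_ldistr[OF fin aR pc])
    also have "\<dots> = (\<Oplus>\<^bsub>T\<^esub>s\<in>S. ?p a (c s \<odot>\<^bsub>U\<^esub> s))"
    proof (rule T.finsum_cong')
      show "(\<lambda>s. ?p a (c s \<odot>\<^bsub>U\<^esub> s)) \<in> S \<rightarrow> carrier T" using b(1) a cR sU by auto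
      fix s assume s: "s \<in> S"
      have "a \<odot>\<^bsub>T\<^esub> ?p (c s) s = ?p (a \<otimes>\<^bsub>R\<^esub> c s) s" using b(4)[of a "c s" s] aR cm[OF s] sU[OF s] by simp
      also have "a \<otimes>\<^bsub>R\<^esub> c s = c s \<otimes>\<^bsub>R\<^esub> a" using aR cR[OF s] by (rule R.m_comm)
      also have "?p (c s \<otimes>\<^bsub>R\<^esub> a) s = c s \<odot>\<^bsub>T\<^esub> ?p a s" using b(4)[of "c s" a s] a cR[OF s] sU[OF s] by simp
      also have "\<dots> = ?p a (c s \<odot>\<^bsub>U\<^esub> s)" using b(5)[of "c s" a s] a cR[OF s] sU[OF s] by simp
      finally show "a \<odot>\<^bsub>T\<^esub> ?p (c s) s = ?p a (c s \<odot>\<^bsub>U\<^esub> s)" .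
    qed simp
    also have "\<dots> = ?p a (lincomb U S c)"
      unfolding lincomb_def
      by (rule module_hom_finsum[OF mU module_tensor pa fin term_closed[OF c(1)], symmetric])
    also have "\<dots> = \<zero>\<^bsub>T\<^esub>" unfolding c(2) by (rule module_hom_zero[OF mU module_tensor pa])
    finally show "a \<odot>\<^bsub>T\<^esub> (\<Oplus>\<^bsub>T\<^esub>s\<in>S. ?p (c s) s) = \<zero>\<^bsub>T\<^esub>" .
  qed
qed

text \<open>A choice of coefficients with respect to the generators, which need not be unique.\<close>

definition coords :: "'b \<Rightarrow> 'b \<Rightarrow> 'a" where
  "coords u = (SOME c. c \<in> S \<rightarrow> carrier R \<and> u = lincomb U S c)"

lemma coords:
  assumes "u \<in> carrier U"
  shows "coords u \<in> S \<rightarrow> carrier R" "u = lincomb U S (coords u)"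
proof -
  obtain c where "c \<in> S \<rightarrow> carrier R" "u = lincomb U S c" using assms by (rule generates)
  then have "\<exists>c. c \<in> S \<rightarrow> carrier R \<and> u = lincomb U S c" by blast
  then have "coords u \<in> S \<rightarrow> carrier R \<and> u = lincomb U S (coords u)"
    unfolding coords_def by (rule someI_ex)
  then show "coords u \<in> S \<rightarrow> carrier R" "u = lincomb U S (coords u)" by blast+
qed

text \<open>The coefficient of \<open>t\<close> in \<open>u\<close> is determined up to the coefficient ideal \<open>I\<close>, so that
  \<open>a \<otimes> u\<close> has a well-defined \<open>t\<close>-coefficient in \<open>R / \<mm> I\<close>.\<close>

lemma coefficient_hom:
  assumes t: "t \<in> S"
  defines "H \<equiv> \<mm> \<cdot>\<^bsub>R\<^esub> coefficient_ideal t"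
  obtains \<phi> where "\<phi> \<in> module_hom R (tensor_product R mm U) (quotient_module (ring_module R) H)"
    "\<And>a c. a \<in> \<mm> \<Longrightarrow> c \<in> S \<rightarrow> carrier R \<Longrightarrow>
       \<phi> (pure_tensor R mm U a (lincomb U S c)) = H +>\<^bsub>ring_module R\<^esub> (a \<otimes>\<^bsub>R\<^esub> c t)"
proof -
  interpret tensor R mm U by (rule tensor.intro[OF module_mm mU])
  note mR = module_ring_module[OF R.is_cring]
  have "ideal H R" unfolding H_def by (rule R.ideal_prod_is_ideal[OF ideal_m ideal_coefficient_ideal[OF t]])
  then have sH: "submodule H R (ring_module R)" by (simp add: submodule_ring_module_iff R.is_cring)
  note q = module_quotient[OF mR sH]
  let ?Q = "quotient_module (ring_module R) H"
  interpret Q: module R ?Q by (rule q(1))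
  let ?q = "\<lambda>r. H +>\<^bsub>ring_module R\<^esub> r"
  note qh = module_homD[OF q(3), simplified]
  have wd: "?q (a \<otimes>\<^bsub>R\<^esub> c t) = ?q (a \<otimes>\<^bsub>R\<^esub> d t)"
    if a: "a \<in> \<mm>" and c: "c \<in> S \<rightarrow> carrier R" and d: "d \<in> S \<rightarrow> carrier R"
      and eq: "lincomb U S c = lincomb U S d" for a c d
  proof -
    have cd: "c t \<in> carrier R" "d t \<in> carrier R" using c d t by auto
    note aR = m_carrier[OF a]
    have "lincomb U S (\<lambda>s. c s \<ominus>\<^bsub>R\<^esub> d s) = lincomb U S d \<ominus>\<^bsub>U\<^esub> lincomb U S d"
      using lincomb_minus[OF c d] eq by simp
    also have "\<dots> = \<zero>\<^bsub>U\<^esub>" using U.minus_eq_zero_iff lincomb_closed[OF d] by blast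
    finally have "c t \<ominus>\<^bsub>R\<^esub> d t \<in> coefficient_ideal t"
      unfolding coefficient_ideal_def using c d
      by (intro CollectI exI[of _ "\<lambda>s. c s \<ominus>\<^bsub>R\<^esub> d s"]) (auto simp: Pi_iff)
    then have H': "a \<otimes>\<^bsub>R\<^esub> (c t \<ominus>\<^bsub>R\<^esub> d t) \<in> H" unfolding H_def by (rule ideal_prod.prod[OF a])
    have e: "a \<otimes>\<^bsub>R\<^esub> c t = a \<otimes>\<^bsub>R\<^esub> (c t \<ominus>\<^bsub>R\<^esub> d t) \<oplus>\<^bsub>R\<^esub> a \<otimes>\<^bsub>R\<^esub> d t"
      using aR cd by (simp add: a_minus_def R.r_distr R.r_minus R.a_assoc R.l_neg)
    have "?q (a \<otimes>\<^bsub>R\<^esub> c t) = ?q (a \<otimes>\<^bsub>R\<^esub> (c t \<ominus>\<^bsub>R\<^esub> d t)) \<oplus>\<^bsub>?Q\<^esub> ?q (a \<otimes>\<^bsub>R\<^esub> d t)"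
      by (subst e) (rule qh(2), use aR cd in simp_all)
    also have "?q (a \<otimes>\<^bsub>R\<^esub> (c t \<ominus>\<^bsub>R\<^esub> d t)) = \<zero>\<^bsub>?Q\<^esub>"
      using q(4)[of "a \<otimes>\<^bsub>R\<^esub> (c t \<ominus>\<^bsub>R\<^esub> d t)"] H' aR cd by simp
    finally show ?thesis using qh(1)[of "a \<otimes>\<^bsub>R\<^esub> d t"] aR cd by simp
  qed
  define \<beta> where "\<beta> a u = ?q (a \<otimes>\<^bsub>R\<^esub> coords u t)" for a u
  have \<beta>: "\<beta> a (lincomb U S c) = ?q (a \<otimes>\<^bsub>R\<^esub> c t)" if "a \<in> \<mm>" "c \<in> S \<rightarrow> carrier R" for a c
    unfolding \<beta>_def using coords[OF lincomb_closed[OF that(2)]] that by (intro wd) simp_all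
  have ct: "coords u t \<in> carrier R" if "u \<in> carrier U" for u using coords(1)[OF that] t by auto
  have "bilinear_map R mm U ?Q \<beta>"
    unfolding bilinear_map_def
  proof (intro conjI ballI)
    fix a u assume a: "a \<in> carrier mm" and u: "u \<in> carrier U"
    then have am: "a \<in> \<mm>" and aR: "a \<in> carrier R" using m_carrier by auto
    show "\<beta> a u \<in> carrier ?Q" unfolding \<beta>_def using qh(1) aR ct[OF u] by simp
    fix v assume v: "v \<in> carrier U"
    have s: "(\<lambda>s. coords u s \<oplus>\<^bsub>R\<^esub> coords v s) \<in> S \<rightarrow> carrier R"
      using coords(1)[OF u] coords(1)[OF v] by auto
    have "u \<oplus>\<^bsub>U\<^esub> v = lincomb U S (\<lambda>s. coords u s \<oplus>\<^bsub>R\<^esub> coords v s)"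
      using lincomb_add[OF coords(1)[OF u] coords(1)[OF v]] coords(2)[OF u] coords(2)[OF v] by simp
    then have "\<beta> a (u \<oplus>\<^bsub>U\<^esub> v) = ?q (a \<otimes>\<^bsub>R\<^esub> (coords u t \<oplus>\<^bsub>R\<^esub> coords v t))" using \<beta>[OF am s] by simp
    also have "\<dots> = \<beta> a u \<oplus>\<^bsub>?Q\<^esub> \<beta> a v"
      unfolding \<beta>_def using qh(2)[of "a \<otimes>\<^bsub>R\<^esub> coords u t" "a \<otimes>\<^bsub>R\<^esub> coords v t"] aR ct[OF u] ct[OF v]
      by (simp add: R.r_distr)
    finally show "\<beta> a (u \<oplus>\<^bsub>U\<^esub> v) = \<beta> a u \<oplus>\<^bsub>?Q\<^esub> \<beta> a v" .
  next
    fix a b u assume "a \<in> carrier mm" "b \<in> carrier mm" and u: "u \<in> carrier U"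
    then have "a \<in> carrier R" "b \<in> carrier R" using m_carrier by auto
    then show "\<beta> (a \<oplus>\<^bsub>mm\<^esub> b) u = \<beta> a u \<oplus>\<^bsub>?Q\<^esub> \<beta> b u"
      unfolding \<beta>_def using qh(2)[of "a \<otimes>\<^bsub>R\<^esub> coords u t" "b \<otimes>\<^bsub>R\<^esub> coords u t"] ct[OF u]
      by (simp add: R.l_distr)
  next
    fix r a u assume r: "r \<in> carrier R" and a: "a \<in> carrier mm" and u: "u \<in> carrier U"
    then have am: "a \<in> \<mm>" and aR: "a \<in> carrier R" using m_carrier by auto
    show "\<beta> (r \<odot>\<^bsub>mm\<^esub> a) u = r \<odot>\<^bsub>?Q\<^esub> \<beta> a u"
      unfolding \<beta>_def using qh(3)[of r "a \<otimes>\<^bsub>R\<^esub> coords u t"] r aR ct[OF u] by (simp add: R.m_assoc)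
    have s: "(\<lambda>s. r \<otimes>\<^bsub>R\<^esub> coords u s) \<in> S \<rightarrow> carrier R" using coords(1)[OF u] r by auto
    have "r \<odot>\<^bsub>U\<^esub> u = lincomb U S (\<lambda>s. r \<otimes>\<^bsub>R\<^esub> coords u s)"
      using lincomb_smult[OF coords(1)[OF u] r] coords(2)[OF u] by simp
    then have "\<beta> a (r \<odot>\<^bsub>U\<^esub> u) = ?q (a \<otimes>\<^bsub>R\<^esub> (r \<otimes>\<^bsub>R\<^esub> coords u t))" using \<beta>[OF am s] by simp
    also have "a \<otimes>\<^bsub>R\<^esub> (r \<otimes>\<^bsub>R\<^esub> coords u t) = r \<otimes>\<^bsub>R\<^esub> (a \<otimes>\<^bsub>R\<^esub> coords u t)"
      using r aR ct[OF u] by (simp add: R.m_lcomm)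
    also have "?q \<dots> = r \<odot>\<^bsub>?Q\<^esub> \<beta> a u"
      unfolding \<beta>_def using qh(3)[of r "a \<otimes>\<^bsub>R\<^esub> coords u t"] r aR ct[OF u] by simp
    finally show "\<beta> a (r \<odot>\<^bsub>U\<^esub> u) = r \<odot>\<^bsub>?Q\<^esub> \<beta> a u" .
  qed
  then obtain \<phi> where \<phi>: "\<phi> \<in> module_hom R T ?Q"
    "\<And>x y. x \<in> carrier mm \<Longrightarrow> y \<in> carrier U \<Longrightarrow> \<phi> (pure_tensor R mm U x y) = \<beta> x y"
    using tensor_lift[OF q(1)] by blast
  show ?thesis
  proof (rule that[OF \<phi>(1)])
    fix a c assume "a \<in> \<mm>" "c \<in> S \<rightarrow> carrier R"
    then show "\<phi> (pure_tensor R mm U a (lincomb U S c)) = ?q (a \<otimes>\<^bsub>R\<^esub> c t)"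
      using \<phi>(2)[of a "lincomb U S c"] lincomb_closed[of c] \<beta>[of a c] by simp
  qed
qed

text \<open>If \<open>\<mm> \<otimes> U\<close> has no torsion, the tensor \<open>\<Sum> c\<^sub>s \<otimes> s\<close> of a relation \<open>c\<close> vanishes, and so does its
  \<open>t\<close>-coefficient \<open>c\<^sub>t\<close> in \<open>R / \<mm> I\<close>. Hence \<open>I = \<mm> I\<close> for the coefficient ideal \<open>I\<close>.\<close>

lemma coefficient_ideal_zero:
  assumes tf: "torsion_part R \<mm> (tensor_product R mm U) = {\<zero>\<^bsub>tensor_product R mm U\<^esub>}" and t: "t \<in> S"
  shows "coefficient_ideal t = {\<zero>\<^bsub>R\<^esub>}"
proof (rule nakayama_ideal[OF ideal_coefficient_ideal[OF t]], rule subsetI)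
  interpret tensor R mm U by (rule tensor.intro[OF module_mm mU])
  interpret T: module R T by (rule module_tensor)
  note mR = module_ring_module[OF R.is_cring]
  let ?H = "\<mm> \<cdot>\<^bsub>R\<^esub> coefficient_ideal t"
  have "ideal ?H R" by (rule R.ideal_prod_is_ideal[OF ideal_m ideal_coefficient_ideal[OF t]])
  then have sH: "submodule ?H R (ring_module R)" by (simp add: submodule_ring_module_iff R.is_cring)
  note q = module_quotient[OF mR sH]
  let ?Q = "quotient_module (ring_module R) ?H"
  interpret Q: module R ?Q by (rule q(1))
  let ?q = "\<lambda>r. ?H +>\<^bsub>ring_module R\<^esub> r"
  let ?p = "pure_tensor R mm U"
  fix r assume "r \<in> coefficient_ideal t"
  then obtain c where c: "c \<in> S \<rightarrow> carrier R" "lincomb U S c = \<zero>\<^bsub>U\<^esub>" "r = c t"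
    unfolding coefficient_ideal_def by blast
  obtain \<phi> where \<phi>: "\<phi> \<in> module_hom R T ?Q"
    "\<And>a c. a \<in> \<mm> \<Longrightarrow> c \<in> S \<rightarrow> carrier R \<Longrightarrow> \<phi> (?p a (lincomb U S c)) = ?q (a \<otimes>\<^bsub>R\<^esub> c t)"
    by (rule coefficient_hom[OF t]) blast
  have cm: "c s \<in> \<mm>" if "s \<in> S" for s using relation_in_m[OF c(1,2) that] .
  have cR: "c s \<in> carrier R" and sU: "s \<in> carrier U" if "s \<in> S" for s using c(1) sub that by auto
  have pc: "(\<lambda>s. ?p (c s) s) \<in> S \<rightarrow> carrier T" using pure_closed cm sU by auto
  have "\<phi> (?p (c s) s) = (if s = t then ?q (c s) else \<zero>\<^bsub>?Q\<^esub>)" if s: "s \<in> S" for s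
  proof -
    let ?e = "\<lambda>v. if v = s then \<one>\<^bsub>R\<^esub> else \<zero>\<^bsub>R\<^esub>"
    have "s = lincomb U S ?e" using lincomb_single[OF s R.one_closed] sU[OF s] by simp
    then have "\<phi> (?p (c s) s) = ?q (c s \<otimes>\<^bsub>R\<^esub> ?e t)" using \<phi>(2)[OF cm[OF s], of ?e] by (simp add: Pi_iff)
    moreover have "?q \<zero>\<^bsub>R\<^esub> = \<zero>\<^bsub>?Q\<^esub>" using module_hom_zero[OF mR q(1) q(3)] by simp
    ultimately show ?thesis using cR[OF s] by auto
  qed
  then have "(\<Oplus>\<^bsub>?Q\<^esub>s\<in>S. \<phi> (?p (c s) s)) = (\<Oplus>\<^bsub>?Q\<^esub>s\<in>S. if s = t then ?q (c s) else \<zero>\<^bsub>?Q\<^esub>)"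
    using module_homD(1)[OF q(3)] cR by (intro Q.finsum_cong') auto
  also have "\<dots> = ?q (c t)"
    by (rule Q.add.finprod_singleton_swap[OF t fin]) (use module_homD(1)[OF q(3)] cR in auto)
  finally have "?q (c t) = \<phi> (\<Oplus>\<^bsub>T\<^esub>s\<in>S. ?p (c s) s)"
    using module_hom_finsum[OF module_tensor q(1) \<phi>(1) fin pc] by simp
  also have "(\<Oplus>\<^bsub>T\<^esub>s\<in>S. ?p (c s) s) = \<zero>\<^bsub>T\<^esub>" using relation_tensor_torsion[OF c(1,2)] tf by blast
  also have "\<phi> \<zero>\<^bsub>T\<^esub> = \<zero>\<^bsub>?Q\<^esub>" by (rule module_hom_zero[OF module_tensor q(1) \<phi>(1)])
  finally show "r \<in> ?H" using q(4)[of "c t"] cR[OF t] c(3) by simp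
qed

text \<open>So \<open>U\<close> is free on \<open>S\<close>, with coordinate functions \<open>\<kappa> s\<close>.\<close>

lemma coordinates:
  assumes tf: "torsion_part R \<mm> (tensor_product R mm U) = {\<zero>\<^bsub>tensor_product R mm U\<^esub>}"
  obtains \<kappa> where "\<And>s. s \<in> S \<Longrightarrow> \<kappa> s \<in> module_hom R U (ring_module R)"
    "\<And>u. u \<in> carrier U \<Longrightarrow> u = lincomb U S (\<lambda>s. \<kappa> s u)" "\<And>s. s \<in> S \<Longrightarrow> \<kappa> s s = \<one>\<^bsub>R\<^esub>"
proof -
  have un: "c t = d t" if c: "c \<in> S \<rightarrow> carrier R" and d: "d \<in> S \<rightarrow> carrier R"
    and eq: "lincomb U S c = lincomb U S d" and t: "t \<in> S" for c d t
  proof -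
    have "lincomb U S (\<lambda>s. c s \<ominus>\<^bsub>R\<^esub> d s) = lincomb U S d \<ominus>\<^bsub>U\<^esub> lincomb U S d"
      using lincomb_minus[OF c d] eq by simp
    also have "\<dots> = \<zero>\<^bsub>U\<^esub>" using U.minus_eq_zero_iff lincomb_closed[OF d] by blast
    finally have "c t \<ominus>\<^bsub>R\<^esub> d t \<in> coefficient_ideal t"
      unfolding coefficient_ideal_def using c d
      by (intro CollectI exI[of _ "\<lambda>s. c s \<ominus>\<^bsub>R\<^esub> d s"]) (auto simp: Pi_iff)
    then have "c t \<ominus>\<^bsub>R\<^esub> d t = \<zero>\<^bsub>R\<^esub>" using coefficient_ideal_zero[OF tf t] by blast
    then show ?thesis using c d t R.minus_eq_zero_iff by (metis Pi_mem)
  qed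
  have eqI: "coords u t = c t" if "c \<in> S \<rightarrow> carrier R" "u = lincomb U S c" "t \<in> S" for u c t
  proof -
    have "u \<in> carrier U" using lincomb_closed[OF that(1)] that(2) by simp
    from un[OF coords(1)[OF this] that(1) _ that(3)] coords(2)[OF this] that(2) show ?thesis by simp
  qed
  show ?thesis
  proof (rule that[of "\<lambda>s u. coords u s"])
    fix s assume s: "s \<in> S"
    show "(\<lambda>u. coords u s) \<in> module_hom R U (ring_module R)"
    proof (rule module_homI; unfold ring_module_simps)
      fix u assume u: "u \<in> carrier U"
      show "coords u s \<in> carrier R" using coords(1)[OF u] s by auto
      show "coords (r \<odot>\<^bsub>U\<^esub> u) s = r \<otimes>\<^bsub>R\<^esub> coords u s" if r: "r \<in> carrier R" for r
        by (rule eqI[of "\<lambda>s. r \<otimes>\<^bsub>R\<^esub> coords u s"])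
          (use coords[OF u] lincomb_smult[OF coords(1)[OF u] r] r s in auto)
      show "coords (u \<oplus>\<^bsub>U\<^esub> v) s = coords u s \<oplus>\<^bsub>R\<^esub> coords v s" if v: "v \<in> carrier U" for v
        by (rule eqI[of "\<lambda>s. coords u s \<oplus>\<^bsub>R\<^esub> coords v s"])
          (use coords[OF u] coords[OF v] lincomb_add[OF coords(1)[OF u] coords(1)[OF v]] s in auto)
    qed
    have "s = lincomb U S (\<lambda>v. if v = s then \<one>\<^bsub>R\<^esub> else \<zero>\<^bsub>R\<^esub>)"
      using lincomb_single[OF s R.one_closed] s sub by auto
    from eqI[OF _ this s] show "coords s s = \<one>\<^bsub>R\<^esub>" by (simp add: Pi_iff)
  qed (rule coords(2))
qed

end


section \<open>Depth one\<close>

lemma module_hom_torsion_part: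
  assumes "module R P" "module R Q" "ideal J R" "f \<in> module_hom R P Q" "x \<in> torsion_part R J P"
  shows "f x \<in> torsion_part R J Q"
proof -
  interpret P: module R P by fact
  obtain n :: nat where x: "x \<in> carrier P" "\<forall>a\<in>J [^]\<^bsub>ideals_set R\<^esub> n. a \<odot>\<^bsub>P\<^esub> x = \<zero>\<^bsub>P\<^esub>"
    using assms(5) by (rule torsion_partE)
  show ?thesis
  proof (rule torsion_partI[of _ _ _ _ n])
    show "f x \<in> carrier Q" by (rule module_homD(1)[OF assms(4) x(1)])
    fix a assume a: "a \<in> J [^]\<^bsub>ideals_set R\<^esub> n"
    have "a \<in> carrier R" using ideal.Icarr[OF ideal_power_ideal[OF P.R.is_cring assms(3)] a] .
    then have "a \<odot>\<^bsub>Q\<^esub> f x = f (a \<odot>\<^bsub>P\<^esub> x)" using module_homD(3)[OF assms(4) _ x(1)] by simp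
    also have "\<dots> = f \<zero>\<^bsub>P\<^esub>" using bspec[OF x(2) a] by simp
    also have "\<dots> = \<zero>\<^bsub>Q\<^esub>" by (rule module_hom_zero[OF assms(1,2,4)])
    finally show "a \<odot>\<^bsub>Q\<^esub> f x = \<zero>\<^bsub>Q\<^esub>" .
  qed
qed

lemma torsionless_torsion_free:
  assumes "domain R" "torsionless R U" "a \<in> carrier R" "a \<noteq> \<zero>\<^bsub>R\<^esub>" "u \<in> carrier U" "a \<odot>\<^bsub>U\<^esub> u = \<zero>\<^bsub>U\<^esub>"
  shows "u = \<zero>\<^bsub>U\<^esub>"
proof -
  interpret R: domain R by fact
  have mU: "module R U" and inj: "inj_on (biduality_map R U) (carrier U)"
    using assms(2) by (simp_all add: torsionless_def)
  interpret U: module R U by (rule mU)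
  note mR = module_ring_module[OF R.is_cring]
  have "f u = f \<zero>\<^bsub>U\<^esub>" if "f \<in> carrier (dual_module R U)" for f
  proof -
    have f: "f \<in> module_hom R U (ring_module R)" using that by (simp add: dual_module_def)
    have f0: "f \<zero>\<^bsub>U\<^esub> = \<zero>\<^bsub>R\<^esub>" using module_hom_zero[OF mU mR f] by simp
    have fu: "f u \<in> carrier R" using module_homD(1)[OF f assms(5)] by simp
    have "a \<otimes>\<^bsub>R\<^esub> f u = f (a \<odot>\<^bsub>U\<^esub> u)" using module_homD(3)[OF f assms(3,5)] by simp
    also have "\<dots> = \<zero>\<^bsub>R\<^esub>" using assms(6) f0 by simp
    finally show ?thesis using R.integral[OF _ assms(3) fu] assms(4) f0 by simp
  qed
  then have "biduality_map R U u = biduality_map R U \<zero>\<^bsub>U\<^esub>"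
    using assms(5) by (auto simp: biduality_map_def fun_eq_iff)
  then show ?thesis using inj_onD[OF inj _ assms(5) U.zero_closed] by blast
qed

lemma torsion_part_torsion_free:
  assumes "domain R" "module R Q" "a \<in> J" "a \<in> carrier R" "a \<noteq> \<zero>\<^bsub>R\<^esub>"
    and tf: "\<And>a x. a \<in> carrier R \<Longrightarrow> a \<noteq> \<zero>\<^bsub>R\<^esub> \<Longrightarrow> x \<in> carrier Q \<Longrightarrow> a \<odot>\<^bsub>Q\<^esub> x = \<zero>\<^bsub>Q\<^esub> \<Longrightarrow> x = \<zero>\<^bsub>Q\<^esub>"
  shows "torsion_part R J Q \<subseteq> {\<zero>\<^bsub>Q\<^esub>}"
proof
  interpret R: domain R by fact
  fix x assume "x \<in> torsion_part R J Q"
  then obtain n :: nat where x: "x \<in> carrier Q" "\<forall>b\<in>J [^]\<^bsub>ideals_set R\<^esub> n. b \<odot>\<^bsub>Q\<^esub> x = \<zero>\<^bsub>Q\<^esub>"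
    by (rule torsion_partE)
  have "a [^]\<^bsub>R\<^esub> k \<noteq> \<zero>\<^bsub>R\<^esub>" for k :: nat
  proof (induction k)
    case (Suc k)
    then show ?case using R.integral[of "a [^]\<^bsub>R\<^esub> k" a] assms(4,5) by auto
  qed simp
  moreover have "a [^]\<^bsub>R\<^esub> n \<in> J [^]\<^bsub>ideals_set R\<^esub> n"
    by (rule element_power_in_ideal_power[OF R.is_cring assms(3)])
  ultimately have "x = \<zero>\<^bsub>Q\<^esub>" using tf[of "a [^]\<^bsub>R\<^esub> n" x] assms(4) x by simp
  then show "x \<in> {\<zero>\<^bsub>Q\<^esub>}" by simp
qed

lemma torsion_part_zeroI:
  assumes "module R Q" "ideal J R" "torsion_part R J Q \<subseteq> {\<zero>\<^bsub>Q\<^esub>}"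
  shows "torsion_part R J Q = {\<zero>\<^bsub>Q\<^esub>}"
  using submoduleD(2)[OF submodule_torsion_part[OF assms(1,2)] assms(1)] assms(3) by blast

text \<open>Multiplication with a fixed vector is a homomorphism from the maximal ideal that does not
  extend, as soon as a linear form with values in the maximal ideal detects it.\<close>

lemma (in local_noetherian) not_homs_from_powers_extend:
  assumes "domain R" "module R Q" "a0 \<in> \<mm>" "a0 \<noteq> \<zero>\<^bsub>R\<^esub>"
    and \<phi>: "\<phi> \<in> module_hom R (ideal_module R \<mm>) Q" and \<kappa>: "\<kappa> \<in> module_hom R Q (ideal_module R \<mm>)"
    and id: "\<And>a. a \<in> \<mm> \<Longrightarrow> \<kappa> (\<phi> a) = a"
  shows "\<not> homs_from_powers_extend R \<mm> Q"
proof
  interpret dom: domain R by fact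
  assume "homs_from_powers_extend R \<mm> Q"
  moreover have "\<phi> \<in> module_hom R (ideal_module R (\<mm> [^]\<^bsub>ideals_set R\<^esub> (1::nat))) Q"
    using \<phi> unfolding ideal_power_1[OF R.is_cring ideal_m] .
  ultimately obtain q where q: "q \<in> carrier Q" "\<forall>a\<in>\<mm> [^]\<^bsub>ideals_set R\<^esub> (1::nat). \<phi> a = a \<odot>\<^bsub>Q\<^esub> q"
    unfolding homs_from_powers_extend_def by blast
  have a0: "a0 \<in> carrier R" by (rule m_carrier[OF assms(3)])
  have "\<phi> a0 = a0 \<odot>\<^bsub>Q\<^esub> q" using q(2) assms(3) unfolding ideal_power_1[OF R.is_cring ideal_m] by blast
  then have "a0 = a0 \<otimes>\<^bsub>R\<^esub> \<kappa> q" using id[OF assms(3)] module_homD(3)[OF \<kappa> a0 q(1)] by simp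
  moreover have \<kappa>q: "\<kappa> q \<in> \<mm>" using module_homD(1)[OF \<kappa> q(1)] by simp
  ultimately have "\<kappa> q = \<one>\<^bsub>R\<^esub>"
    using dom.m_lcancel[OF assms(4) a0 m_carrier[OF \<kappa>q] R.one_closed] a0 by simp
  then show False using \<kappa>q one_notin_m by simp
qed

context minimal_family
begin

abbreviation "RR \<equiv> ring_module R"

lemma module_RR: "module R RR"
  by (rule module_ring_module[OF R.is_cring])

text \<open>One half of the isomorphism \<open>R \<otimes> U \<cong> U\<close> is enough to transfer properties of \<open>U\<close> to \<open>R \<otimes> U\<close>.\<close>

lemma ring_tensor_iso:
  obtains \<theta> \<eta> where "\<theta> \<in> module_hom R (tensor_product R RR U) U"
    "\<eta> \<in> module_hom R U (tensor_product R RR U)"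
    "\<And>x. x \<in> carrier (tensor_product R RR U) \<Longrightarrow> \<eta> (\<theta> x) = x"
proof -
  interpret tensor R RR U by (rule tensor.intro[OF module_RR mU])
  note b = bilinear_mapD[OF bilinear_pure_tensor]
  have "bilinear_map R RR U U (\<lambda>r u. r \<odot>\<^bsub>U\<^esub> u)"
    unfolding bilinear_map_def
    by (auto simp: U.smult_l_distr U.smult_r_distr U.smult_assoc1[symmetric] R.m_comm)
  then obtain \<theta> where \<theta>: "\<theta> \<in> module_hom R T U"
    "\<And>x y. x \<in> carrier RR \<Longrightarrow> y \<in> carrier U \<Longrightarrow> \<theta> (pure_tensor R RR U x y) = x \<odot>\<^bsub>U\<^esub> y"
    using tensor_lift[OF mU] by blast
  define \<eta> where "\<eta> u = pure_tensor R RR U \<one>\<^bsub>R\<^esub> u" for u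
  have \<eta>: "\<eta> \<in> module_hom R U T"
    by (rule module_homI) (simp_all add: \<eta>_def b)
  have "\<eta> (\<theta> x) = x" if "x \<in> carrier T" for x
  proof (rule tensor_hom_eqI[OF module_tensor module_hom_comp[OF \<theta>(1) \<eta>] _ _ that])
    show "(\<lambda>x. x) \<in> module_hom R T T" by (rule module_homI) simp_all
    fix r u assume r: "r \<in> carrier RR" and u: "u \<in> carrier U"
    have "\<eta> (\<theta> (pure_tensor R RR U r u)) = r \<odot>\<^bsub>T\<^esub> pure_tensor R RR U \<one>\<^bsub>R\<^esub> u"
      using \<theta>(2)[OF r u] b(5)[of r "\<one>\<^bsub>R\<^esub>" u] r u by (simp add: \<eta>_def)
    also have "\<dots> = pure_tensor R RR U r u" using b(4)[of r "\<one>\<^bsub>R\<^esub>" u] r u by simp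
    finally show "\<eta> (\<theta> (pure_tensor R RR U r u)) = pure_tensor R RR U r u" .
  qed
  then show ?thesis using that \<theta>(1) \<eta> by blast
qed

text \<open>For a free module \<open>U\<close> the extension property of \<open>R\<close> is used in each coordinate.\<close>

lemma homs_from_powers_extend_tensor:
  assumes \<kappa>: "\<And>s. s \<in> S \<Longrightarrow> \<kappa> s \<in> module_hom R U RR"
    "\<And>u. u \<in> carrier U \<Longrightarrow> u = lincomb U S (\<lambda>s. \<kappa> s u)"
    and ext: "homs_from_powers_extend R \<mm> RR"
  shows "homs_from_powers_extend R \<mm> (tensor_product R RR U)"
  unfolding homs_from_powers_extend_def
proof (intro allI ballI)
  let ?T = "tensor_product R RR U"
  fix n :: nat and \<phi>
  let ?I = "\<mm> [^]\<^bsub>ideals_set R\<^esub> n"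
  assume \<phi>: "\<phi> \<in> module_hom R (ideal_module R ?I) ?T"
  obtain \<theta> \<eta> where \<theta>: "\<theta> \<in> module_hom R ?T U" and \<eta>: "\<eta> \<in> module_hom R U ?T"
    and \<eta>\<theta>: "\<And>x. x \<in> carrier ?T \<Longrightarrow> \<eta> (\<theta> x) = x" by (rule ring_tensor_iso) blast
  have IR: "a \<in> carrier R" if "a \<in> ?I" for a
    using ideal.Icarr[OF ideal_power_ideal[OF R.is_cring ideal_m] that] .
  have \<phi>T: "\<phi> a \<in> carrier ?T" if "a \<in> ?I" for a using module_homD(1)[OF \<phi>] that by simp
  have "\<forall>s\<in>S. \<exists>r. r \<in> carrier R \<and> (\<forall>a\<in>?I. \<kappa> s (\<theta> (\<phi> a)) = a \<otimes>\<^bsub>R\<^esub> r)"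
  proof
    fix s assume s: "s \<in> S"
    have "(\<lambda>a. \<kappa> s (\<theta> (\<phi> a))) \<in> module_hom R (ideal_module R ?I) RR"
      by (rule module_hom_comp[OF module_hom_comp[OF \<phi> \<theta>] \<kappa>(1)[OF s]])
    then have "\<exists>r\<in>carrier RR. \<forall>a\<in>?I. \<kappa> s (\<theta> (\<phi> a)) = a \<odot>\<^bsub>RR\<^esub> r"
      by (rule ext[unfolded homs_from_powers_extend_def, THEN spec, THEN bspec])
    then show "\<exists>r. r \<in> carrier R \<and> (\<forall>a\<in>?I. \<kappa> s (\<theta> (\<phi> a)) = a \<otimes>\<^bsub>R\<^esub> r)" by auto
  qed
  then obtain r where r: "\<forall>s\<in>S. r s \<in> carrier R \<and> (\<forall>a\<in>?I. \<kappa> s (\<theta> (\<phi> a)) = a \<otimes>\<^bsub>R\<^esub> r s)"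
    by (elim bchoice[THEN exE])
  then have rS: "r \<in> S \<rightarrow> carrier R" by blast
  have lr: "lincomb U S r \<in> carrier U" by (rule lincomb_closed[OF rS])
  have "\<phi> a = a \<odot>\<^bsub>?T\<^esub> \<eta> (lincomb U S r)" if a: "a \<in> ?I" for a
  proof -
    have \<theta>\<phi>: "\<theta> (\<phi> a) \<in> carrier U" by (rule module_homD(1)[OF \<theta> \<phi>T[OF a]])
    have "\<theta> (\<phi> a) = lincomb U S (\<lambda>s. \<kappa> s (\<theta> (\<phi> a)))" by (rule \<kappa>(2)[OF \<theta>\<phi>])
    also have "\<dots> = lincomb U S (\<lambda>s. a \<otimes>\<^bsub>R\<^esub> r s)"
    proof (rule lincomb_cong)
      show "(\<lambda>s. \<kappa> s (\<theta> (\<phi> a))) \<in> S \<rightarrow> carrier R"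
        using module_homD(1)[OF \<kappa>(1) \<theta>\<phi>] by auto
      show "\<kappa> s (\<theta> (\<phi> a)) = a \<otimes>\<^bsub>R\<^esub> r s" if "s \<in> S" for s using r that a by blast
    qed
    also have "\<dots> = a \<odot>\<^bsub>U\<^esub> lincomb U S r" by (rule lincomb_smult[OF rS IR[OF a], symmetric])
    finally have "\<eta> (\<theta> (\<phi> a)) = a \<odot>\<^bsub>?T\<^esub> \<eta> (lincomb U S r)"
      using module_homD(3)[OF \<eta> IR[OF a] lr] by simp
    then show ?thesis using \<eta>\<theta>[OF \<phi>T[OF a]] by simp
  qed
  then show "\<exists>q\<in>carrier ?T. \<forall>a\<in>?I. \<phi> a = a \<odot>\<^bsub>?T\<^esub> q"
    using module_homD(1)[OF \<eta> lr] by blast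
qed

lemma torsion_part_ring_tensor:
  assumes "torsion_part R \<mm> U = {\<zero>\<^bsub>U\<^esub>}"
  shows "torsion_part R \<mm> (tensor_product R RR U) = {\<zero>\<^bsub>tensor_product R RR U\<^esub>}"
proof -
  interpret tensor R RR U by (rule tensor.intro[OF module_RR mU])
  obtain \<theta> \<eta> where \<theta>: "\<theta> \<in> module_hom R T U" and \<eta>: "\<eta> \<in> module_hom R U T"
    and \<eta>\<theta>: "\<And>x. x \<in> carrier T \<Longrightarrow> \<eta> (\<theta> x) = x" by (rule ring_tensor_iso) blast
  have "x = \<zero>\<^bsub>T\<^esub>" if x: "x \<in> torsion_part R \<mm> T" for x
  proof -
    have "\<theta> x = \<zero>\<^bsub>U\<^esub>"
      using module_hom_torsion_part[OF module_tensor mU ideal_m \<theta> x] assms by simp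
    moreover have "x \<in> carrier T" using x by (simp add: torsion_part_def)
    ultimately show ?thesis using \<eta>\<theta>[of x] module_hom_zero[OF mU module_tensor \<eta>] by simp
  qed
  then show ?thesis by (intro torsion_part_zeroI[OF module_tensor ideal_m] subsetI) simp
qed

text \<open>The homomorphism in question is \<open>a \<mapsto> a \<otimes> t\<close>, detected by the coordinate function \<open>\<kappa>\<close> of \<open>t\<close>.\<close>

lemma not_homs_from_powers_extend_tensor:
  assumes "domain R" "a0 \<in> \<mm>" "a0 \<noteq> \<zero>\<^bsub>R\<^esub>"
    and t: "t \<in> S" "\<kappa> \<in> module_hom R U RR" "\<kappa> t = \<one>\<^bsub>R\<^esub>"
  shows "\<not> homs_from_powers_extend R \<mm> (tensor_product R mm U)"
proof -
  interpret tensor R mm U by (rule tensor.intro[OF module_mm mU])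
  note b = bilinear_mapD[OF bilinear_pure_tensor] and k = module_homD[OF t(2), simplified]
  have tU: "t \<in> carrier U" using t(1) sub by auto
  have "bilinear_map R mm U mm (\<lambda>a u. a \<otimes>\<^bsub>R\<^esub> \<kappa> u)"
    unfolding bilinear_map_def
  proof (intro conjI ballI)
    fix a u assume a: "a \<in> carrier mm" and u: "u \<in> carrier U"
    then have am: "a \<in> \<mm>" and aR: "a \<in> carrier R" using m_carrier by auto
    show "a \<otimes>\<^bsub>R\<^esub> \<kappa> u \<in> carrier mm" using ideal.I_r_closed[OF ideal_m am k(1)[OF u]] by simp
    show "a \<otimes>\<^bsub>R\<^esub> \<kappa> (u \<oplus>\<^bsub>U\<^esub> v) = a \<otimes>\<^bsub>R\<^esub> \<kappa> u \<oplus>\<^bsub>mm\<^esub> a \<otimes>\<^bsub>R\<^esub> \<kappa> v" if "v \<in> carrier U" for v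
      using aR u that k by (simp add: R.r_distr)
  next
    fix a b u assume "a \<in> carrier mm" "b \<in> carrier mm" and u: "u \<in> carrier U"
    then have "a \<in> carrier R" "b \<in> carrier R" using m_carrier by auto
    then show "(a \<oplus>\<^bsub>mm\<^esub> b) \<otimes>\<^bsub>R\<^esub> \<kappa> u = a \<otimes>\<^bsub>R\<^esub> \<kappa> u \<oplus>\<^bsub>mm\<^esub> b \<otimes>\<^bsub>R\<^esub> \<kappa> u"
      using u k by (simp add: R.l_distr)
  next
    fix r a u assume r: "r \<in> carrier R" and a: "a \<in> carrier mm" and u: "u \<in> carrier U"
    then have aR: "a \<in> carrier R" using m_carrier by auto
    show "(r \<odot>\<^bsub>mm\<^esub> a) \<otimes>\<^bsub>R\<^esub> \<kappa> u = r \<odot>\<^bsub>mm\<^esub> (a \<otimes>\<^bsub>R\<^esub> \<kappa> u)"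
      using r aR u k by (simp add: R.m_assoc)
    show "a \<otimes>\<^bsub>R\<^esub> \<kappa> (r \<odot>\<^bsub>U\<^esub> u) = r \<odot>\<^bsub>mm\<^esub> (a \<otimes>\<^bsub>R\<^esub> \<kappa> u)"
      using r aR u k by (simp add: R.m_lcomm)
  qed
  then obtain g where g: "g \<in> module_hom R T mm"
    "\<And>x y. x \<in> carrier mm \<Longrightarrow> y \<in> carrier U \<Longrightarrow> g (pure_tensor R mm U x y) = x \<otimes>\<^bsub>R\<^esub> \<kappa> y"
    using tensor_lift[OF module_mm] by blast
  show ?thesis
  proof (rule not_homs_from_powers_extend[OF assms(1) module_tensor assms(2,3) _ g(1)])
    show "(\<lambda>a. pure_tensor R mm U a t) \<in> module_hom R mm T"
      by (rule module_homI) (use b tU in simp_all)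
    show "g (pure_tensor R mm U a t) = a" if "a \<in> \<mm>" for a
      using g(2)[of a t] that tU t(3) m_carrier[OF that] by simp
  qed
qed

end

theorem mainTheorem8:
  fixes R :: "'a ring" and \<mm> :: "'a set" and d :: enat
    and M N :: "('a, 'a) module" and U :: "('a, 'u) module"
  assumes "noetherian_local_ring R \<mm>" and "domain R"
    and "depth R \<mm> (ring_module R) = d" and "d > 0"
    and "M = (ring_module R)\<lparr>carrier := \<mm>\<rparr>" and "N = ring_module R"
    and "finitely_generated_module R U" and "torsionless R U" and "\<not> zero_module U"
    and "depth R \<mm> (tensor_product R M U) = depth R \<mm> (tensor_product R N U)"
  shows "depth R \<mm> M \<le> depth R \<mm> N \<and> d = 1"
proof -
  interpret local_noetherian R \<mm> by unfold_locales (rule assms(1))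
  interpret dom: domain R by (rule assms(2))
  note mR = module_ring_module[OF R.is_cring] and mM = module_ideal_module[OF R.is_cring ideal_m]
  have mU: "module R U" using assms(7) by (simp add: finitely_generated_module_def)
  have tor_R: "torsion_part R \<mm> (ring_module R) = {\<zero>\<^bsub>R\<^esub>}"
    using depth_pos_iff[OF noeth ideal_m mR] assms(3,4) by simp
  have "\<mm> \<noteq> {\<zero>\<^bsub>R\<^esub>}"
  proof
    assume m0: "\<mm> = {\<zero>\<^bsub>R\<^esub>}"
    have "\<one>\<^bsub>R\<^esub> \<in> torsion_part R \<mm> (ring_module R)"
    proof (rule torsion_partI[of _ _ _ _ 1])
      fix a assume "a \<in> \<mm> [^]\<^bsub>ideals_set R\<^esub> (1::nat)"
      then have "a \<in> \<mm>" unfolding ideal_power_1[OF R.is_cring ideal_m] .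
      then have "a = \<zero>\<^bsub>R\<^esub>" unfolding m0 by simp
      then show "a \<odot>\<^bsub>ring_module R\<^esub> \<one>\<^bsub>R\<^esub> = \<zero>\<^bsub>ring_module R\<^esub>" by simp
    qed simp
    then show False using tor_R dom.one_not_zero by simp
  qed
  then obtain a0 where a0: "a0 \<in> \<mm>" "a0 \<noteq> \<zero>\<^bsub>R\<^esub>"
    using additive_subgroup.zero_closed[OF ideal.axioms(1)[OF ideal_m]] by blast
  note tfree = torsion_part_torsion_free[OF assms(2) _ a0(1) m_carrier[OF a0(1)] a0(2)]
  have tor_m: "torsion_part R \<mm> (ideal_module R \<mm>) = {\<zero>\<^bsub>ideal_module R \<mm>\<^esub>}"
  proof (rule torsion_part_zeroI[OF mM ideal_m], rule tfree[OF mM])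
    fix a x assume "a \<in> carrier R" "a \<noteq> \<zero>\<^bsub>R\<^esub>" "x \<in> carrier (ideal_module R \<mm>)"
      "a \<odot>\<^bsub>ideal_module R \<mm>\<^esub> x = \<zero>\<^bsub>ideal_module R \<mm>\<^esub>"
    then show "x = \<zero>\<^bsub>ideal_module R \<mm>\<^esub>" using dom.integral[of a x] m_carrier[of x] by auto
  qed
  \<comment> \<open>The identity of \<open>\<mm>\<close> does not extend to the ring, so the depth of \<open>\<mm>\<close> is one.\<close>
  have "(\<lambda>a. a) \<in> module_hom R (ideal_module R \<mm>) (ideal_module R \<mm>)" by (rule module_homI) simp_all
  then have "\<not> homs_from_powers_extend R \<mm> (ideal_module R \<mm>)"
    by (intro not_homs_from_powers_extend[OF assms(2) mM a0, of "\<lambda>a. a" "\<lambda>a. a"]) simp_all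
  then have "depth R \<mm> M = 1"
    unfolding assms(5) using depth_eq_one_iff[OF noeth ideal_m mM tor_m] by blast
  then have le: "depth R \<mm> M \<le> depth R \<mm> N"
    using assms(3,4,6) ileI1[of 0 d] by (simp add: one_eSuc)
  obtain S where S: "minimal_generators R U S" by (rule minimal_generators_exist[OF assms(7)])
  interpret S: minimal_family R \<mm> U S
    by (intro minimal_family.intro minimal_family_axioms.intro local_noetherian_axioms mU S)
  have mT: "module R (tensor_product R (ideal_module R \<mm>) U)"
    by (rule tensor.module_tensor[OF tensor.intro[OF mM mU]])
  have mT': "module R (tensor_product R (ring_module R) U)"
    by (rule tensor.module_tensor[OF tensor.intro[OF mR mU]])
  have "torsion_part R \<mm> U = {\<zero>\<^bsub>U\<^esub>}"
  proof (rule torsion_part_zeroI[OF mU ideal_m], rule tfree[OF mU])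
    fix a u assume "a \<in> carrier R" "a \<noteq> \<zero>\<^bsub>R\<^esub>" "u \<in> carrier U" "a \<odot>\<^bsub>U\<^esub> u = \<zero>\<^bsub>U\<^esub>"
    then show "u = \<zero>\<^bsub>U\<^esub>" by (rule torsionless_torsion_free[OF assms(2,8)])
  qed
  then have tor_T': "torsion_part R \<mm> (tensor_product R (ring_module R) U) = {\<zero>\<^bsub>tensor_product R (ring_module R) U\<^esub>}"
    by (rule S.torsion_part_ring_tensor)
  then have "depth R \<mm> (tensor_product R (ideal_module R \<mm>) U) > 0"
    using depth_pos_iff[OF noeth ideal_m mT'] assms(10) unfolding assms(5,6) by simp
  then have tor_T: "torsion_part R \<mm> (tensor_product R (ideal_module R \<mm>) U) = {\<zero>\<^bsub>tensor_product R (ideal_module R \<mm>) U\<^esub>}"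
    using depth_pos_iff[OF noeth ideal_m mT] by blast
  \<comment> \<open>From here on \<open>U\<close> is known to be free with basis \<open>S\<close>.\<close>
  obtain \<kappa> where \<kappa>: "\<And>s. s \<in> S \<Longrightarrow> \<kappa> s \<in> module_hom R U (ring_module R)"
    "\<And>u. u \<in> carrier U \<Longrightarrow> u = lincomb U S (\<lambda>s. \<kappa> s u)" "\<And>s. s \<in> S \<Longrightarrow> \<kappa> s s = \<one>\<^bsub>R\<^esub>"
    by (rule S.coordinates[OF tor_T]) blast
  have "S \<noteq> {}"
  proof
    assume "S = {}"
    then have "u = \<zero>\<^bsub>U\<^esub>" if "u \<in> carrier U" for u using \<kappa>(2)[OF that] by (simp add: lincomb_def)
    then show False using assms(9) S.U.zero_closed unfolding zero_module_def by blast
  qed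
  then obtain t where t: "t \<in> S" by blast
  have "\<not> homs_from_powers_extend R \<mm> (tensor_product R (ideal_module R \<mm>) U)"
    by (rule S.not_homs_from_powers_extend_tensor[OF assms(2) a0 t \<kappa>(1)[OF t] \<kappa>(3)[OF t]])
  then have "depth R \<mm> (tensor_product R (ring_module R) U) = 1"
    using depth_eq_one_iff[OF noeth ideal_m mT tor_T] assms(10) unfolding assms(5,6) by simp
  then have "\<not> homs_from_powers_extend R \<mm> (tensor_product R (ring_module R) U)"
    using depth_eq_one_iff[OF noeth ideal_m mT' tor_T'] by blast
  then have "\<not> homs_from_powers_extend R \<mm> (ring_module R)"
    using S.homs_from_powers_extend_tensor[OF \<kappa>(1,2)] by blast
  then have "d = 1" using depth_eq_one_iff[OF noeth ideal_m mR] tor_R assms(3) by simp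
  then show ?thesis using le by blast
qed

end
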